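(* Let $0<\alpha<2$, $H>0$, and let $\mathbf{X}=\{X(t)\}_{t\in\mathbb{R}^d}$ be a real-valued $H$-self-similar $S\alpha S$ random field with stationary increments and integral representation $$X(t)\stackrel{d}{=}\int_E f_t(s)\,M(ds),\qquad t\in\mathbb{R}^d,$$ where $M$ is an $S\alpha S$ random measure on a measurable space $(E,\mathcal{E})$ with $\sigma$-finite control measure $m$ and $f_t\in L^\alpha(E,m)$ for all $t\in\mathbb{R}^d$. Let $V=\{-1,0,1\}^d\setminus\{\mathbf{0}\}$ and, for $v\in V$, $Y^{(v)}(t)=X(t+v)-X(t)$. If for every $v\in V$ the increment field $\{Y^{(v)}(t)\}_{t\in\mathbb{Z}^d}$ has weak effective dimension bounded by $\theta_2\in(0,\alpha H)$, then for any $0<\gamma<\alpha$, with $T=[0,1]^d$, $$\limsup_{h\to0+}\ \frac{\sup_{t\in T}\ \sup_{s\in T,\ |s-t|_\infty\le h}|X(t)-X(s)|}{h^{H-\theta_2/\alpha}\,(\log(1/h))^{1/\gamma}}=0\qquad\text{almost surely},$$ where $|s-t|_\infty=\max_{1\le j\le d}|s_j-t_j|$.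
   Context: $d\ge1$ is an integer. $u\le v$ for vectors means coordinatewise inequality; $\mathbf{0}=(0,\dots,0)$, $\mathbf{1}=(1,\dots,1)$. $\stackrel{d}{=}$ between fields means equality of finite-dimensional distributions. As usual for almost sure statements about suprema over uncountable sets, $\mathbf{X}$ is taken to be a separable version. A real-valued field is $S\alpha S$ (symmetric $\alpha$-stable) if every finite linear combination of its values has a symmetric $\alpha$-stable distribution. An $S\alpha S$ random measure $M$ with $\sigma$-finite control measure $m$ is an independently scattered, $\sigma$-additive random set function on sets of finite $m$-measure with $\mathbb{E}e^{i\theta M(A)}=e^{-|\theta|^\alpha m(A)}$; for $g\in L^\alpha(E,m)$, $\mathbb{E}\exp(i\theta\int g\,dM)=\exp(-|\theta|^\alpha\int|g|^\alpha dm)$. $\{X(t)\}_{t\in\mathbb{R}^d}$ is $H$-self-similar ($H>0$) if $\{X(ct)\}\stackrel{d}{=}\{c^HX(t)\}$ for all $c>0$; it has stationary increments if $\{X(t+u)-X(u)\}_{t\in\mathbb{R}^d}\stackrel{d}{=}\{X(t)-X(0)\}_{t\in\mathbb{R}^d}$ for each $u\in\mathbb{R}^d$. Then each $\{Y^{(v)}(t)\}_{t\in\mathbb{Z}^d}$ is a stationary $S\alpha S$ random field, with representation $Y^{(v)}(t)=\int_E f^{(v)}_t(x)\,M(dx)$, $f^{(v)}_t=f_{v+t}-f_t$. Put $$b^{(v)}_n=\left(\int_E\max_{\mathbf{0}\le t\le(n-1)\mathbf{1}}|f^{(v)}_t(x)|^\alpha\,m(dx)\right)^{1/\alpha},$$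 the maximum being over $t\in\mathbb{Z}^d$. The field $\{Y^{(v)}(t)\}_{t\in\mathbb{Z}^d}$ has weak effective dimension bounded by $\theta_2\in(0,d]$ if there exist constants $c_1>0$, $c_2>0$ and $\theta_1\in(0,\theta_2]$ such that $c_1n^{\theta_1}\le (b_n^{(v)})^\alpha\le c_2n^{\theta_2}$ for all sufficiently large $n$. *)

theory Defs
  imports "HOL-Probability.Probability"
begin

section \<open>Random fields\<close>

definition fdd_eq ::
  "'w measure \<Rightarrow> ('t \<Rightarrow> 'w \<Rightarrow> real) \<Rightarrow> 'q measure \<Rightarrow> ('t \<Rightarrow> 'q \<Rightarrow> real) \<Rightarrow> bool" where
  "fdd_eq P X Q Z \<longleftrightarrow>
     (\<forall>F. finite F \<longrightarrow>
        distr P (\<Pi>\<^sub>M t\<in>F. borel) (\<lambda>\<omega>. \<lambda>t\<in>F. X t \<omega>) =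
        distr Q (\<Pi>\<^sub>M t\<in>F. borel) (\<lambda>\<omega>. \<lambda>t\<in>F. Z t \<omega>))"

text \<open>The scale \<open>\<sigma> = 0\<close>, i.e. the point mass at the origin, is allowed.\<close>

definition sas_distribution :: "real \<Rightarrow> real measure \<Rightarrow> bool" where
  "sas_distribution \<alpha> \<mu> \<longleftrightarrow>
     (\<exists>\<sigma>\<ge>0. \<forall>\<theta>. char \<mu> \<theta> = complex_of_real (exp (- (\<sigma> powr \<alpha> * \<bar>\<theta>\<bar> powr \<alpha>))))"

definition sas_field :: "real \<Rightarrow> 'w measure \<Rightarrow> ('t \<Rightarrow> 'w \<Rightarrow> real) \<Rightarrow> bool" where
  "sas_field \<alpha> P X \<longleftrightarrow>
     (\<forall>t. X t \<in> borel_measurable P) \<and>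
     (\<forall>F a. finite F \<longrightarrow> sas_distribution \<alpha> (distr P borel (\<lambda>\<omega>. \<Sum>t\<in>F. a t * X t \<omega>)))"

definition self_similar ::
  "real \<Rightarrow> 'w measure \<Rightarrow> (real^'d \<Rightarrow> 'w \<Rightarrow> real) \<Rightarrow> bool" where
  "self_similar H P X \<longleftrightarrow>
     (\<forall>c>0. fdd_eq P (\<lambda>t. X (c *\<^sub>R t)) P (\<lambda>t \<omega>. c powr H * X t \<omega>))"

definition stationary_increments ::
  "'w measure \<Rightarrow> (real^'d \<Rightarrow> 'w \<Rightarrow> real) \<Rightarrow> bool" where
  "stationary_increments P X \<longleftrightarrow>
     (\<forall>u. fdd_eq P (\<lambda>t \<omega>. X (t + u) \<omega> - X u \<omega>) P (\<lambda>t \<omega>. X t \<omega> - X 0 \<omega>))"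

text \<open>
  Separability in the sense of Doob.  Density of the separating set \<open>S\<close> follows by
  taking \<open>F = {}\<close>.
\<close>

definition separable_field ::
  "'w measure \<Rightarrow> ('t::topological_space \<Rightarrow> 'w \<Rightarrow> real) \<Rightarrow> bool" where
  "separable_field P X \<longleftrightarrow>
     (\<exists>S. countable S \<and>
        (AE \<omega> in P. \<forall>G F. open G \<longrightarrow> closed F \<longrightarrow>
           (\<forall>t\<in>G \<inter> S. X t \<omega> \<in> F) \<longrightarrow> (\<forall>t\<in>G. X t \<omega> \<in> F)))"

section \<open>Stable random measures and integrals\<close>

definition finite_sets :: "'e measure \<Rightarrow> 'e set set" where
  "finite_sets m = {A \<in> sets m. emeasure m A < \<infinity>}"

text \<open>
  The values of \<open>M\<close> outside \<open>finite_sets m\<close> are irrelevant.  Finite disjoint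
  families are covered by the sequences below upon padding with the empty set.
\<close>

definition sas_random_measure ::
  "real \<Rightarrow> 'e measure \<Rightarrow> 'q measure \<Rightarrow> ('e set \<Rightarrow> 'q \<Rightarrow> real) \<Rightarrow> bool" where
  "sas_random_measure \<alpha> m Q M \<longleftrightarrow>
     prob_space Q \<and> sigma_finite_measure m \<and>
     (\<forall>A\<in>finite_sets m. M A \<in> borel_measurable Q) \<and>
     (\<forall>A\<in>finite_sets m. \<forall>\<theta>.
        char (distr Q borel (M A)) \<theta> =
          complex_of_real (exp (- (\<bar>\<theta>\<bar> powr \<alpha> * measure m A)))) \<and>
     (\<forall>A :: nat \<Rightarrow> 'e set. range A \<subseteq> finite_sets m \<longrightarrow> disjoint_family A \<longrightarrow>
        prob_space.indep_vars Q (\<lambda>_. borel) (\<lambda>i. M (A i)) UNIV) \<and>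
     (\<forall>A :: nat \<Rightarrow> 'e set. range A \<subseteq> finite_sets m \<longrightarrow> disjoint_family A \<longrightarrow>
        (\<Union>i. A i) \<in> finite_sets m \<longrightarrow>
        (AE \<omega> in Q. (\<lambda>i. M (A i) \<omega>) sums M (\<Union>i. A i) \<omega>))"

definition L_space :: "real \<Rightarrow> 'e measure \<Rightarrow> ('e \<Rightarrow> real) set" where
  "L_space \<alpha> m = {g \<in> borel_measurable m. integrable m (\<lambda>x. \<bar>g x\<bar> powr \<alpha>)}"

definition simple_stable_integral ::
  "'e measure \<Rightarrow> ('e set \<Rightarrow> 'q \<Rightarrow> real) \<Rightarrow> ('e \<Rightarrow> real) \<Rightarrow> 'q \<Rightarrow> real" where
  "simple_stable_integral m M g \<omega> =
     (\<Sum>y\<in>g ` space m - {0}. y * M {x \<in> space m. g x = y} \<omega>)"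

text \<open>
  \<open>Z\<close> is a version of the integral of \<open>g\<close> with respect to \<open>M\<close>: the limit in probability
  of the integrals of simple functions converging to \<open>g\<close> in \<open>L\<^sup>\<alpha>\<close>.
\<close>

definition has_stable_integral ::
  "real \<Rightarrow> 'e measure \<Rightarrow> 'q measure \<Rightarrow> ('e set \<Rightarrow> 'q \<Rightarrow> real) \<Rightarrow>
     ('e \<Rightarrow> real) \<Rightarrow> ('q \<Rightarrow> real) \<Rightarrow> bool" where
  "has_stable_integral \<alpha> m Q M g Z \<longleftrightarrow>
     g \<in> L_space \<alpha> m \<and> Z \<in> borel_measurable Q \<and>
     (\<exists>s. (\<forall>k. simple_function m (s k) \<and> {x \<in> space m. s k x \<noteq> 0} \<in> finite_sets m) \<and>
        (\<lambda>k. \<integral>\<^sup>+x. ennreal (\<bar>s k x - g x\<bar> powr \<alpha>) \<partial>m) \<longlonglongrightarrow> 0 \<and>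
        (\<forall>\<epsilon>>0. (\<lambda>k. measure Q {\<omega> \<in> space Q. \<bar>simple_stable_integral m M (s k) \<omega> - Z \<omega>\<bar> > \<epsilon>})
           \<longlonglongrightarrow> 0))"

section \<open>Weak effective dimension of the increment fields\<close>

definition of_int_vec :: "int^'d \<Rightarrow> real^'d" where
  "of_int_vec k = (\<chi> i. real_of_int (k $ i))"

definition directions :: "(int^'d) set" where
  "directions = {v. \<forall>i. v $ i \<in> {-1, 0, 1}} - {0}"

definition increment_kernel ::
  "(real^'d \<Rightarrow> 'e \<Rightarrow> real) \<Rightarrow> int^'d \<Rightarrow> int^'d \<Rightarrow> 'e \<Rightarrow> real" where
  "increment_kernel f v t x = f (of_int_vec (v + t)) x - f (of_int_vec t) x"

text \<open>
  In the next two definitions \<open>g\<close> is the kernel of the integral representation of the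
  field on the integer lattice.  The value at \<open>n = 0\<close> is irrelevant.
\<close>

definition max_scale ::
  "real \<Rightarrow> 'e measure \<Rightarrow> (int^'d \<Rightarrow> 'e \<Rightarrow> real) \<Rightarrow> nat \<Rightarrow> real" where
  "max_scale \<alpha> m g n =
     (\<integral>x. Max ((\<lambda>t. \<bar>g t x\<bar> powr \<alpha>) ` {t. 0 \<le> t \<and> t \<le> (\<chi> i. int n - 1)}) \<partial>m) powr (1 / \<alpha>)"

definition weak_effective_dim_bounded ::
  "real \<Rightarrow> 'e measure \<Rightarrow> (int^'d \<Rightarrow> 'e \<Rightarrow> real) \<Rightarrow> real \<Rightarrow> bool" where
  "weak_effective_dim_bounded \<alpha> m g \<theta>\<^sub>2 \<longleftrightarrow>
     0 < \<theta>\<^sub>2 \<and> \<theta>\<^sub>2 \<le> real CARD('d) \<and>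
     (\<exists>c\<^sub>1>0. \<exists>c\<^sub>2>0. \<exists>\<theta>\<^sub>1. 0 < \<theta>\<^sub>1 \<and> \<theta>\<^sub>1 \<le> \<theta>\<^sub>2 \<and>
        (\<forall>\<^sub>F n in sequentially.
           c\<^sub>1 * real n powr \<theta>\<^sub>1 \<le> max_scale \<alpha> m g n powr \<alpha> \<and>
           max_scale \<alpha> m g n powr \<alpha> \<le> c\<^sub>2 * real n powr \<theta>\<^sub>2))"

end

theory Submission
  imports Defs "HOL-Real_Asymp.Real_Asymp"
begin

text \<open>
  By self-similarity and stationarity of the increments, the largest increment of
  \<open>X\<close> in a direction \<open>v\<close> between neighbouring points of the grid of mesh \<open>2^(-n)\<close> has the law of
  \<open>2^(-n * H)\<close> times the maximum of the increment field in direction \<open>v\<close> over of the order of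
  \<open>2^(n * d)\<close> lattice points.  Everything rests on the estimate that this maximum exceeds
  a multiple \<open>\<kappa> \<ge> 1\<close> of \<open>2^(n * \<theta> / \<alpha>)\<close>, where \<open>\<theta>\<close> bounds the effective dimension, with
  probability of order \<open>\<kappa>^(-\<alpha>) + 2^(-n)\<close>; see \<open>lattice_increment_tail\<close>.
  Taking \<open>\<kappa>\<close> to be a small multiple of \<open>n^(1 / \<gamma>)\<close> makes
  these probabilities summable because \<open>\<gamma> < \<alpha>\<close>, so by Borel-Cantelli all but finitely
  many levels are small, and chaining along dyadic points sums the levels up to the
  modulus of continuity.

  The tail estimate is obtained by truncation (\<open>max_stable_sum_tail\<close>).
  For simple kernels the whole field is a family of linear combinations
  \<open>\<Sum>i. a t i * \<xi> i\<close> of the same independent stable variables.  If \<open>A i\<close> bounds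
  \<open>\<bar>a t i\<bar>\<close> over \<open>t\<close>, then the probability that some \<open>A i * \<bar>\<xi> i\<bar>\<close> exceeds \<open>L\<close> is of
  order \<open>L^(-\<alpha>)\<close> times the integral of the maximal kernel, and this is the only place
  where the maximal kernel enters.  Off that event the summands are bounded by
  \<open>L\<close> and symmetric, and their variances are small compared with \<open>L\<^sup>2\<close> because each single kernel has
  bounded norm while the threshold grows; Chernoff's bound then gives a
  power of \<open>2^(-n)\<close> as large as desired when \<open>L\<close> is a small fraction of the threshold, which
  beats the number of grid points.  The estimate passes to general
  kernels by the definition of the stable integral
  (\<open>max_stable_integral_tail\<close>).

  Finally \<open>X\<close> is continuous in probability, so its values on the separating set are limits
  of its values at dyadic points, and separability carries the modulus over to all points
  (\<open>separable_modulus\<close>).  Since a neighbourhood of a point on the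
  boundary of the unit cube leaves the cube, the chaining is done on the cube with sides \<open>[-1, 3]\<close>.
\<close>

section \<open>Truncated moments of a symmetric stable variable\<close>

lemma square_le_one_minus_cos:
  fixes y :: real
  assumes "\<bar>y\<bar> \<le> 2"
  shows "y\<^sup>2 \<le> 4 * (1 - cos y)"
proof -
  define w where "w = \<bar>y\<bar> / 2"
  have w: "0 \<le> w" "w \<le> 1" using assms by (auto simp: w_def)
  have "\<bar>sin w - w\<bar> \<le> w^3 / 6"
    using Maclaurin_sin_bound[of w 3] w
    by (simp add: sin_coeff_def numeral_eq_Suc field_simps)
  then have "w - w^3 / 6 \<le> sin w" by linarith
  moreover have "w^3 \<le> w" using w power_decreasing[of 1 3 w] by simp
  ultimately have s: "5/6 * w \<le> sin w" by simp
  have "(5/6 * w)\<^sup>2 \<le> (sin w)\<^sup>2" using s w by (intro power_mono) auto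
  then have "25/36 * w\<^sup>2 \<le> (sin w)\<^sup>2" by (simp add: power_mult_distrib power2_eq_square)
  moreover have "cos y = 1 - 2 * (sin w)\<^sup>2"
    using cos_double_sin[of w] by (simp add: w_def)
  moreover have "y\<^sup>2 = 4 * w\<^sup>2" by (simp add: w_def power_divide)
  ultimately show ?thesis using zero_le_power2[of w] by argo
qed

text \<open>
  A single frequency cannot detect a large \<open>y\<close>, as \<open>cos y\<close> may be \<open>1\<close>; halving \<open>y\<close>
  until it lies between \<open>1\<close> and \<open>2\<close> avoids the zeros of \<open>1 - cos\<close>.  The bound allows
  truncated second moments to be read off from the characteristic function.
\<close>

lemma min_one_square_le_dyadic_cos:
  fixes y :: real
  obtains k :: nat where "min 1 (y\<^sup>2) \<le> 4 * (1 - cos (y / 2^k))"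
proof (cases "\<bar>y\<bar> \<le> 2")
  case True
  then show ?thesis using square_le_one_minus_cos[of y] that[of 0] by simp
next
  case False
  define k where "k = nat \<lfloor>log 2 \<bar>y\<bar>\<rfloor>"
  have p: "0 < \<bar>y\<bar>" "0 \<le> log 2 \<bar>y\<bar>" using False by auto
  have "real k \<le> log 2 \<bar>y\<bar>" "log 2 \<bar>y\<bar> < real k + 1"
    using p by (auto simp: k_def)
  then have "2 powr real k \<le> \<bar>y\<bar>" "\<bar>y\<bar> < 2 powr (real k + 1)"
    using p by (auto simp: le_log_iff log_less_iff)
  then have b: "2^k \<le> \<bar>y\<bar>" "\<bar>y\<bar> < 2 * 2^k" by (auto simp: powr_add powr_realpow)
  define z where "z = y / 2^k"
  have z: "1 \<le> \<bar>z\<bar>" "\<bar>z\<bar> \<le> 2" using b by (auto simp: z_def field_simps)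
  have "1 \<le> z\<^sup>2" using power_mono[OF z(1), of 2] by simp
  then show ?thesis using square_le_one_minus_cos[OF z(2)] that[of k] by (simp add: z_def)
qed

text \<open>
  Four times the geometric series with ratio \<open>2 powr (-\<alpha>)\<close>, which arises from summing the
  characteristic function over dyadic frequencies.
\<close>

definition stable_const :: "real \<Rightarrow> real" where
  "stable_const \<alpha> = 4 / (1 - 2 powr (-\<alpha>))"

lemma stable_const_pos: "0 < \<alpha> \<Longrightarrow> 0 < stable_const \<alpha>"
  by (auto simp: stable_const_def powr_less_one)

text \<open>
  The parameter \<open>\<sigma>\<close> is the scale to the power \<open>\<alpha>\<close>, which is additive over independent
  variables and corresponds to the control measure.
\<close>

definition has_sas_law :: "real \<Rightarrow> 'w measure \<Rightarrow> real \<Rightarrow> ('w \<Rightarrow> real) \<Rightarrow> bool" where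
  "has_sas_law \<alpha> Q \<sigma> \<xi> \<longleftrightarrow> 0 \<le> \<sigma> \<and> \<xi> \<in> borel_measurable Q \<and>
     (\<forall>\<theta>. char (distr Q borel \<xi>) \<theta> = complex_of_real (exp (- (\<bar>\<theta>\<bar> powr \<alpha> * \<sigma>))))"

context prob_space begin

lemma expectation_cos_eq_Re_char:
  assumes [measurable]: "\<xi> \<in> borel_measurable M"
  shows "expectation (\<lambda>\<omega>. cos (\<theta> * \<xi> \<omega>)) = Re (char (distr M borel \<xi>) \<theta>)"
proof -
  have "char (distr M borel \<xi>) \<theta> = expectation (\<lambda>\<omega>. iexp (\<theta> * \<xi> \<omega>))"
    unfolding char_def by (subst integral_distr) auto
  moreover have "integrable M (\<lambda>\<omega>. iexp (\<theta> * \<xi> \<omega>))"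
    by (rule integrable_const_bound[of _ 1]) auto
  ultimately show ?thesis by (simp add: Re_exp flip: integral_Re)
qed

text \<open>
  Bounding the truncated square by the sum over all dyadic frequencies and integrating
  term by term leaves \<open>1 - exp (- \<bar>c / 2^k\<bar> powr \<alpha> * \<sigma>)\<close> for each \<open>k\<close>, a
  geometric series.  The estimate contains both the tail bound, through Markov's inequality, and
  the variance bound for the truncated variable.
\<close>

lemma sas_truncated_second_moment:
  assumes "0 < \<alpha>" "has_sas_law \<alpha> M \<sigma> \<xi>" "0 \<le> c"
  shows "expectation (\<lambda>\<omega>. min 1 ((c * \<xi> \<omega>)\<^sup>2)) \<le> stable_const \<alpha> * \<sigma> * c powr \<alpha>"
proof -
  have [measurable]: "\<xi> \<in> borel_measurable M" and s: "0 \<le> \<sigma>"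
    using assms(2) by (auto simp: has_sas_law_def)
  define g where "g k \<omega> = 4 * (1 - cos (c / 2^k * \<xi> \<omega>))" for k :: nat and \<omega>
  have [measurable]: "g k \<in> borel_measurable M" for k unfolding g_def by measurable
  have g0: "0 \<le> g k \<omega>" for k \<omega> by (simp add: g_def)
  have int_g: "integrable M (g k)" for k
    unfolding g_def by (intro integrable_mult_right Bochner_Integration.integrable_diff
        integrable_const integrable_const_bound[of _ 1]) auto
  have geo: "(\<lambda>k. 4 * (\<sigma> * c powr \<alpha>) * (2 powr (-\<alpha>))^k) sums (stable_const \<alpha> * \<sigma> * c powr \<alpha>)"
    using sums_mult[OF geometric_sums[of "2 powr (-\<alpha>)"], of "4 * (\<sigma> * c powr \<alpha>)"] assms(1)
    by (simp add: stable_const_def powr_less_one mult_ac)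
  have Eg: "expectation (g k) \<le> 4 * (\<sigma> * c powr \<alpha>) * (2 powr (-\<alpha>))^k" for k
  proof -
    have "expectation (g k) = 4 * (1 - Re (char (distr M borel \<xi>) (c / 2^k)))"
      unfolding g_def
      by (subst integral_mult_right_zero, subst Bochner_Integration.integral_diff)
        (auto intro!: integrable_const_bound[of _ 1]
          simp: prob_space expectation_cos_eq_Re_char[symmetric])
    also have "\<dots> = 4 * (1 - exp (- (\<bar>c / 2^k\<bar> powr \<alpha> * \<sigma>)))"
      using assms(2) by (simp add: has_sas_law_def)
    also have "\<dots> \<le> 4 * (\<bar>c / 2^k\<bar> powr \<alpha> * \<sigma>)"
      using exp_ge_add_one_self[of "- (\<bar>c / 2^k\<bar> powr \<alpha> * \<sigma>)"] by argo
    also have "\<bar>c / 2^k\<bar> powr \<alpha> = c powr \<alpha> * (2 powr (-\<alpha>))^k"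
    proof -
      have "\<bar>c / 2^k\<bar> powr \<alpha> = c powr \<alpha> / (2^k) powr \<alpha>" using assms(3) by (simp add: powr_divide)
      also have "(2^k) powr \<alpha> = (2 powr \<alpha>)^k"
        by (simp add: powr_realpow[symmetric] powr_powr mult.commute)
      finally show ?thesis by (simp add: powr_minus power_inverse divide_inverse)
    qed
    finally show ?thesis by (simp add: mult_ac)
  qed
  have "(\<integral>\<^sup>+\<omega>. ennreal (min 1 ((c * \<xi> \<omega>)\<^sup>2)) \<partial>M) \<le> (\<integral>\<^sup>+\<omega>. (\<Sum>k. ennreal (g k \<omega>)) \<partial>M)"
  proof (intro nn_integral_mono)
    fix \<omega>
    obtain k where "min 1 ((c * \<xi> \<omega>)\<^sup>2) \<le> 4 * (1 - cos ((c * \<xi> \<omega>) / 2^k))"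
      using min_one_square_le_dyadic_cos by blast
    then have "ennreal (min 1 ((c * \<xi> \<omega>)\<^sup>2)) \<le> ennreal (g k \<omega>)"
      by (intro ennreal_leI) (simp add: g_def)
    also have "\<dots> \<le> (\<Sum>k. ennreal (g k \<omega>))"
      using sum_le_suminf[of "\<lambda>k. ennreal (g k \<omega>)" "{k}"] by simp
    finally show "ennreal (min 1 ((c * \<xi> \<omega>)\<^sup>2)) \<le> (\<Sum>k. ennreal (g k \<omega>))" .
  qed
  also have "\<dots> = (\<Sum>k. \<integral>\<^sup>+\<omega>. ennreal (g k \<omega>) \<partial>M)"
    by (intro nn_integral_suminf) simp
  also have "\<dots> \<le> (\<Sum>k. ennreal (4 * (\<sigma> * c powr \<alpha>) * (2 powr (-\<alpha>))^k))"
    using Eg int_g g0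
    by (intro suminf_le) (auto simp: nn_integral_eq_integral intro!: ennreal_leI)
  also have "\<dots> = ennreal (stable_const \<alpha> * \<sigma> * c powr \<alpha>)"
    using geo s by (subst suminf_ennreal_eq[OF _ geo]) auto
  finally have *: "(\<integral>\<^sup>+\<omega>. ennreal (min 1 ((c * \<xi> \<omega>)\<^sup>2)) \<partial>M) \<le> ennreal (stable_const \<alpha> * \<sigma> * c powr \<alpha>)" .
  have "(\<integral>\<^sup>+\<omega>. ennreal (min 1 ((c * \<xi> \<omega>)\<^sup>2)) \<partial>M) = ennreal (expectation (\<lambda>\<omega>. min 1 ((c * \<xi> \<omega>)\<^sup>2)))"
    by (intro nn_integral_eq_integral integrable_const_bound[of _ 1]) auto
  with * show ?thesis
    using stable_const_pos[OF assms(1)] s by (simp add: ennreal_le_iff)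
qed

lemma sas_symmetric:
  assumes "has_sas_law \<alpha> M \<sigma> \<xi>"
  shows "distr M borel (\<lambda>\<omega>. - \<xi> \<omega>) = distr M borel \<xi>"
proof -
  have [measurable]: "\<xi> \<in> borel_measurable M" using assms by (auto simp: has_sas_law_def)
  have "char (distr M borel (\<lambda>\<omega>. - \<xi> \<omega>)) \<theta> = char (distr M borel \<xi>) (-\<theta>)" for \<theta>
    unfolding char_def by (simp add: integral_distr)
  then have "char (distr M borel (\<lambda>\<omega>. - \<xi> \<omega>)) = char (distr M borel \<xi>)"
    using assms by (auto simp: has_sas_law_def fun_eq_iff)
  then show ?thesis
    by (intro Levy_uniqueness real_distribution_distr) auto
qed

end

section \<open>The maximum of finitely many linear combinations of independent stable variables\<close>

lemma cosh_le_quadratic_exp: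
  fixes z :: real
  shows "cosh z \<le> 1 + z\<^sup>2 / 2 * exp \<bar>z\<bar>"
proof -
  define w where "w = \<bar>z\<bar> / 2"
  have w: "0 \<le> w" by (simp add: w_def)
  have "1 - 2 * w \<le> exp (- (2 * w))" using exp_ge_add_one_self[of "- (2 * w)"] by simp
  then have "exp w * (1 - 2 * w) \<le> exp w * exp (- (2 * w))" by (intro mult_left_mono) auto
  also have "\<dots> = exp (- w)" by (simp flip: exp_add)
  finally have "sinh w \<le> w * exp w" by (simp add: sinh_field_def algebra_simps)
  then have "(sinh w)\<^sup>2 \<le> (w * exp w)\<^sup>2" using w by (intro power_mono) auto
  moreover have "(exp w)\<^sup>2 = exp \<bar>z\<bar>" by (simp add: w_def flip: exp_double)
  moreover have "cosh z = 1 + 2 * (sinh w)\<^sup>2"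
  proof -
    have "cosh z = cosh (2 * w)" by (simp add: w_def abs_if)
    also have "\<dots> = 1 + 2 * (sinh w)\<^sup>2" unfolding cosh_double using cosh_square_eq[of w] by simp
    finally show ?thesis .
  qed
  moreover have "w\<^sup>2 = z\<^sup>2 / 4" by (simp add: w_def power_divide)
  ultimately show ?thesis by (simp add: power_mult_distrib)
qed

text \<open>
  The square of \<open>y / L\<close> is kept as a factor, so that after taking expectations it becomes the
  truncated second moment; the crude exponent \<open>2 * u * L\<close> absorbs the polynomial factor.
\<close>

lemma cosh_le_of_bounded:
  fixes u y L :: real
  assumes "0 \<le> u" "0 < L" "\<bar>y\<bar> \<le> L"
  shows "cosh (u * y) \<le> 1 + exp (2 * u * L) * (y / L)\<^sup>2"
proof -
  have uL: "0 \<le> u * L" using assms by simp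
  have "cosh (u * y) \<le> 1 + (u * y)\<^sup>2 / 2 * exp \<bar>u * y\<bar>" by (rule cosh_le_quadratic_exp)
  also have "(u * y)\<^sup>2 / 2 * exp \<bar>u * y\<bar> \<le> (u * y)\<^sup>2 / 2 * exp (u * L)"
    using assms by (intro mult_left_mono) (auto simp: abs_mult mult_left_mono)
  also have "(u * y)\<^sup>2 / 2 = (u * L)\<^sup>2 / 2 * (y / L)\<^sup>2"
    using assms by (simp add: field_simps)
  also have "(u * L)\<^sup>2 / 2 * (y / L)\<^sup>2 * exp (u * L) \<le> exp (u * L) * (y / L)\<^sup>2 * exp (u * L)"
    using exp_lower_Taylor_quadratic[OF uL] uL
    by (intro mult_right_mono) auto
  also have "\<dots> = exp (2 * u * L) * (y / L)\<^sup>2"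
    by (simp add: mult_exp_exp algebra_simps)
  finally show ?thesis by simp
qed

context prob_space begin

text \<open>
  By symmetry the exponential may be replaced by its even part \<open>cosh\<close>, which has no linear
  term.  The variable is cut off in terms of the majorant \<open>A\<close> and not of \<open>a\<close> itself: one
  truncation then serves all linear combinations simultaneously.
\<close>

lemma sas_truncated_exponential_moment:
  assumes "0 < \<alpha>" "has_sas_law \<alpha> M \<sigma> \<xi>" "0 \<le> u" "0 < L" "\<bar>a\<bar> \<le> A"
  shows "expectation (\<lambda>\<omega>. exp (u * (a * (if A * \<bar>\<xi> \<omega>\<bar> \<le> L then \<xi> \<omega> else 0))))
      \<le> 1 + exp (2 * u * L) * (stable_const \<alpha> * \<sigma> * (\<bar>a\<bar> / L) powr \<alpha>)"
proof -
  have [measurable]: "\<xi> \<in> borel_measurable M" using assms by (auto simp: has_sas_law_def)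
  define T where "T x = (if A * \<bar>x\<bar> \<le> L then x else 0)" for x :: real
  have [measurable]: "T \<in> borel_measurable borel" unfolding T_def by measurable
  have aT: "\<bar>a * T x\<bar> \<le> L" for x
    using mult_right_mono[OF assms(5), of "\<bar>x\<bar>"] assms(4) by (auto simp: T_def abs_mult)
  have uaT: "\<bar>u * (a * T x)\<bar> \<le> u * L" for x
    using aT[of x] assms(3) by (simp add: abs_mult mult_left_mono)
  have int: "integrable M (\<lambda>\<omega>. exp (u * (a * T (\<xi> \<omega>))))" "integrable M (\<lambda>\<omega>. exp (- (u * (a * T (\<xi> \<omega>)))))"
    using uaT by (auto intro!: integrable_const_bound[of _ "exp (u * L)"] simp: abs_le_iff minus_le_iff)
  have "expectation (\<lambda>\<omega>. exp (u * (a * T (\<xi> \<omega>)))) = expectation (\<lambda>\<omega>. exp (u * (a * T (- \<xi> \<omega>))))"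
    using integral_distr[of \<xi> M borel "\<lambda>x. exp (u * (a * T x))"]
      integral_distr[of "\<lambda>\<omega>. - \<xi> \<omega>" M borel "\<lambda>x. exp (u * (a * T x))"] sas_symmetric[OF assms(2)]
    by simp
  also have "\<dots> = expectation (\<lambda>\<omega>. exp (- (u * (a * T (\<xi> \<omega>)))))"
    by (intro Bochner_Integration.integral_cong) (auto simp: T_def)
  finally have "expectation (\<lambda>\<omega>. exp (u * (a * T (\<xi> \<omega>)))) = expectation (\<lambda>\<omega>. cosh (u * (a * T (\<xi> \<omega>))))"
    using int by (simp add: cosh_field_def)
  also have "\<dots> \<le> expectation (\<lambda>\<omega>. 1 + exp (2 * u * L) * min 1 ((\<bar>a\<bar> / L * \<xi> \<omega>)\<^sup>2))"
  proof (intro integral_mono)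
    show "integrable M (\<lambda>\<omega>. cosh (u * (a * T (\<xi> \<omega>))))"
      using int by (simp add: cosh_field_def)
    show "integrable M (\<lambda>\<omega>. 1 + exp (2 * u * L) * min 1 ((\<bar>a\<bar> / L * \<xi> \<omega>)\<^sup>2))"
      by (intro Bochner_Integration.integrable_add integrable_mult_right integrable_const
          integrable_const_bound[of _ 1]) auto
    fix \<omega>
    have "(a * T (\<xi> \<omega>) / L)\<^sup>2 \<le> 1"
      using aT[of "\<xi> \<omega>"] assms(4) by (simp add: abs_square_le_1)
    moreover have "(a * T (\<xi> \<omega>) / L)\<^sup>2 \<le> (\<bar>a\<bar> / L * \<xi> \<omega>)\<^sup>2"
      by (auto simp: T_def power_mult_distrib power_divide)
    ultimately have "(a * T (\<xi> \<omega>) / L)\<^sup>2 \<le> min 1 ((\<bar>a\<bar> / L * \<xi> \<omega>)\<^sup>2)" by simp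
    then show "cosh (u * (a * T (\<xi> \<omega>))) \<le> 1 + exp (2 * u * L) * min 1 ((\<bar>a\<bar> / L * \<xi> \<omega>)\<^sup>2)"
      using cosh_le_of_bounded[OF assms(3,4) aT[of "\<xi> \<omega>"]]
      by (smt (verit) exp_ge_zero mult_left_mono)
  qed
  also have "\<dots> = 1 + exp (2 * u * L) * expectation (\<lambda>\<omega>. min 1 ((\<bar>a\<bar> / L * \<xi> \<omega>)\<^sup>2))"
    by (subst Bochner_Integration.integral_add)
      (auto simp: prob_space intro!: integrable_mult_right integrable_const_bound[of _ 1])
  also have "\<dots> \<le> 1 + exp (2 * u * L) * (stable_const \<alpha> * \<sigma> * (\<bar>a\<bar> / L) powr \<alpha>)"
    using sas_truncated_second_moment[OF assms(1,2), of "\<bar>a\<bar> / L"] assms(4) by simp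
  finally show ?thesis by (simp add: T_def)
qed

text \<open>
  Chernoff's inequality: by independence the exponential moment of the sum is at most
  \<open>exp (exp (2 * u * L) * \<kappa>)\<close> with \<open>\<kappa> = stable_const \<alpha> * V / L powr \<alpha>\<close>.
\<close>

lemma truncated_sum_tail:
  assumes "0 < \<alpha>" "finite I" "indep_vars (\<lambda>_. borel) \<xi> I"
    and law: "\<And>i. i \<in> I \<Longrightarrow> has_sas_law \<alpha> M (\<sigma> i) (\<xi> i)"
    and "\<And>i. i \<in> I \<Longrightarrow> \<bar>a i\<bar> \<le> A i" "0 < L" "0 < V"
    and V: "(\<Sum>i\<in>I. \<sigma> i * \<bar>a i\<bar> powr \<alpha>) \<le> V"
    and kappa: "stable_const \<alpha> * V / L powr \<alpha> < 1"
  shows "prob {\<omega> \<in> space M. x \<le> (\<Sum>i\<in>I. a i * (if A i * \<bar>\<xi> i \<omega>\<bar> \<le> L then \<xi> i \<omega> else 0))}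
      \<le> exp 1 * (stable_const \<alpha> * V / L powr \<alpha>) powr (x / (2 * L))"
proof -
  define \<kappa> where "\<kappa> = stable_const \<alpha> * V / L powr \<alpha>"
  have \<kappa>: "0 < \<kappa>" "\<kappa> < 1"
    using kappa stable_const_pos[OF assms(1)] assms(6,7) by (auto simp: \<kappa>_def)
  (* the value of u for which exp (2 * u * L) * \<kappa> = 1 *)
  define u where "u = - ln \<kappa> / (2 * L)"
  have u: "0 < u" using \<kappa> assms(6) by (simp add: u_def divide_neg_pos)
  have [measurable]: "i \<in> I \<Longrightarrow> \<xi> i \<in> borel_measurable M" for i
    using law by (auto simp: has_sas_law_def)
  define T where "T i x = a i * (if A i * \<bar>x\<bar> \<le> L then x else 0)" for i and x :: real
  have T_meas[measurable]: "T i \<in> borel_measurable borel" for i unfolding T_def by measurable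
  have T_bd: "\<bar>T i x\<bar> \<le> L" if "i \<in> I" for i x
    using mult_right_mono[OF assms(5)[OF that], of "\<bar>x\<bar>"] assms(6) by (auto simp: T_def abs_mult)
  have indep: "indep_vars (\<lambda>_. borel) (\<lambda>i \<omega>. exp (u * T i (\<xi> i \<omega>))) I"
    by (rule indep_vars_compose2[OF assms(3)]) simp
  have bd: "\<bar>exp (u * T i (\<xi> i \<omega>))\<bar> \<le> exp (u * L)" if "i \<in> I" for i \<omega>
    using T_bd[OF that, of "\<xi> i \<omega>"] u by (auto intro!: mult_left_mono)
  have int: "integrable M (\<lambda>\<omega>. exp (u * T i (\<xi> i \<omega>)))" if "i \<in> I" for i
    using bd[OF that] that by (intro integrable_const_bound[of _ "exp (u * L)"]) auto
  have prod: "exp (u * (\<Sum>i\<in>I. T i (\<xi> i \<omega>))) = (\<Prod>i\<in>I. exp (u * T i (\<xi> i \<omega>)))" for \<omega>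
    by (simp add: sum_distrib_left exp_sum[OF assms(2)])
  have int': "integrable M (\<lambda>\<omega>. exp (u * (\<Sum>i\<in>I. T i (\<xi> i \<omega>))))"
    unfolding prod by (rule indep_vars_integrable[OF assms(2) indep int])
  have "expectation (\<lambda>\<omega>. exp (u * (\<Sum>i\<in>I. T i (\<xi> i \<omega>)))) = (\<Prod>i\<in>I. expectation (\<lambda>\<omega>. exp (u * T i (\<xi> i \<omega>))))"
    unfolding prod by (rule indep_vars_lebesgue_integral[OF assms(2) indep int])
  also have "\<dots> \<le> (\<Prod>i\<in>I. exp (exp (2 * u * L) * (stable_const \<alpha> * \<sigma> i * (\<bar>a i\<bar> / L) powr \<alpha>)))"
  proof (intro prod_mono conjI)
    fix i assume i: "i \<in> I"
    show "0 \<le> expectation (\<lambda>\<omega>. exp (u * T i (\<xi> i \<omega>)))" by simp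
    have "expectation (\<lambda>\<omega>. exp (u * T i (\<xi> i \<omega>))) \<le> 1 + exp (2 * u * L) * (stable_const \<alpha> * \<sigma> i * (\<bar>a i\<bar> / L) powr \<alpha>)"
      using sas_truncated_exponential_moment[OF assms(1) law[OF i] less_imp_le[OF u] assms(6) assms(5)[OF i]]
      by (simp add: T_def)
    also have "\<dots> \<le> exp (exp (2 * u * L) * (stable_const \<alpha> * \<sigma> i * (\<bar>a i\<bar> / L) powr \<alpha>))"
      by (rule exp_ge_add_one_self)
    finally show "expectation (\<lambda>\<omega>. exp (u * T i (\<xi> i \<omega>))) \<le> \<dots>" .
  qed
  also have "\<dots> = exp (exp (2 * u * L) * (stable_const \<alpha> / L powr \<alpha> * (\<Sum>i\<in>I. \<sigma> i * \<bar>a i\<bar> powr \<alpha>)))"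
    using assms(6)
    by (simp add: exp_sum[OF assms(2), symmetric] sum_distrib_left powr_divide mult_ac)
  also have "\<dots> \<le> exp (exp (2 * u * L) * (stable_const \<alpha> / L powr \<alpha> * V))"
    using V stable_const_pos[OF assms(1)] by (auto intro!: mult_left_mono divide_right_mono)
  also have "\<dots> = exp 1"
  proof -
    have "2 * u * L = - ln \<kappa>" using assms(6) by (simp add: u_def)
    then have "exp (2 * u * L) = 1 / \<kappa>" using \<kappa> by (simp add: exp_minus divide_inverse)
    moreover have "stable_const \<alpha> / L powr \<alpha> * V = \<kappa>" by (simp add: \<kappa>_def)
    ultimately show ?thesis using \<kappa> by simp
  qed
  finally have E: "expectation (\<lambda>\<omega>. exp (u * (\<Sum>i\<in>I. T i (\<xi> i \<omega>)))) \<le> exp 1" .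
  have "prob {\<omega> \<in> space M. x \<le> (\<Sum>i\<in>I. T i (\<xi> i \<omega>))}
      \<le> exp (- u * x) * (\<integral>\<omega>\<in>space M. exp (u * (\<Sum>i\<in>I. T i (\<xi> i \<omega>))) \<partial>M)"
    using int' by (intro Chernoff_ineq_ge u) (auto simp: set_integrable_def cong: Bochner_Integration.integrable_cong)
  also have "(\<integral>\<omega>\<in>space M. exp (u * (\<Sum>i\<in>I. T i (\<xi> i \<omega>))) \<partial>M) = expectation (\<lambda>\<omega>. exp (u * (\<Sum>i\<in>I. T i (\<xi> i \<omega>))))"
    by (rule set_integral_space[OF int'])
  also have "exp (- u * x) * \<dots> \<le> exp (- u * x) * exp 1" using E by (intro mult_left_mono) auto
  also have "exp (- u * x) = \<kappa> powr (x / (2 * L))"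
    using \<kappa> by (simp add: u_def powr_def)
  finally show ?thesis by (simp add: T_def \<kappa>_def mult.commute)
qed

text \<open>
  The first term accounts for the event that some variable had to be truncated, the second is
  a union bound over the truncated sums.  The joint majorant \<open>A\<close> enters only through \<open>B\<close>, whereas
  \<open>V\<close> bounds the members of the family one at a time.  If the base of the power is at least \<open>1\<close>,
  the bound is trivial.
\<close>

lemma max_stable_sum_tail:
  assumes "0 < \<alpha>" "finite I" "indep_vars (\<lambda>_. borel) \<xi> I"
    and law: "\<And>i. i \<in> I \<Longrightarrow> has_sas_law \<alpha> M (\<sigma> i) (\<xi> i)"
    and "finite F" and bound: "\<And>t i. t \<in> F \<Longrightarrow> i \<in> I \<Longrightarrow> \<bar>a t i\<bar> \<le> A i"
    and A0: "\<And>i. i \<in> I \<Longrightarrow> 0 \<le> A i"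
    and "0 < x" "0 < L" "0 < V"
    and B: "(\<Sum>i\<in>I. \<sigma> i * A i powr \<alpha>) \<le> B"
    and V: "\<And>t. t \<in> F \<Longrightarrow> (\<Sum>i\<in>I. \<sigma> i * \<bar>a t i\<bar> powr \<alpha>) \<le> V"
  shows "prob {\<omega> \<in> space M. \<exists>t\<in>F. x \<le> \<bar>\<Sum>i\<in>I. a t i * \<xi> i \<omega>\<bar>}
      \<le> stable_const \<alpha> * B / L powr \<alpha>
        + card F * (2 * exp 1 * (stable_const \<alpha> * V / L powr \<alpha>) powr (x / (2 * L)))"
proof -
  define \<kappa> where "\<kappa> = stable_const \<alpha> * V / L powr \<alpha>"
  have C: "0 < stable_const \<alpha>" using stable_const_pos[OF assms(1)] .
  have [measurable]: "i \<in> I \<Longrightarrow> \<xi> i \<in> borel_measurable M" for i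
    using law by (auto simp: has_sas_law_def)
  have \<sigma>: "i \<in> I \<Longrightarrow> 0 \<le> \<sigma> i" for i using law by (auto simp: has_sas_law_def)
  have B0: "0 \<le> B" using B \<sigma> by (intro order_trans[OF sum_nonneg B]) auto
  show ?thesis
  proof (cases "\<kappa> < 1")
    case False
    show ?thesis
    proof (cases "F = {}")
      case True
      then show ?thesis using B0 C by simp
    next
      case F: False
      have "1 \<le> \<kappa> powr (x / (2 * L))" using False assms by (intro ge_one_powr_ge_zero) auto
      moreover have "1 \<le> exp (1::real)" by simp
      ultimately have "1 * 1 \<le> exp 1 * \<kappa> powr (x / (2 * L))" by (intro mult_mono) auto
      then have e: "1 \<le> 2 * exp 1 * \<kappa> powr (x / (2 * L))" by linarith
      have "1 \<le> card F" using F assms(5) by (simp add: Suc_leI card_gt_0_iff)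
      then have "1 * 1 \<le> real (card F) * (2 * exp 1 * \<kappa> powr (x / (2 * L)))"
        using e by (intro mult_mono) auto
      moreover have "0 \<le> stable_const \<alpha> * B / L powr \<alpha>" using B0 C by simp
      ultimately show ?thesis unfolding \<kappa>_def by (intro order_trans[OF prob_le_1]) linarith
    qed
  next
    case True
    define S where "S t \<omega> = (\<Sum>i\<in>I. a t i * (if A i * \<bar>\<xi> i \<omega>\<bar> \<le> L then \<xi> i \<omega> else 0))" for t \<omega>
    define big where "big i = {\<omega> \<in> space M. L \<le> A i * \<bar>\<xi> i \<omega>\<bar>}" for i
    define up where "up t = {\<omega> \<in> space M. x \<le> S t \<omega>}" for t
    define dn where "dn t = {\<omega> \<in> space M. x \<le> - S t \<omega>}" for t
    have [measurable]: "S t \<in> borel_measurable M" for t unfolding S_def by measurable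
    have [measurable]: "up t \<in> sets M" "dn t \<in> sets M" for t unfolding up_def dn_def by measurable
    have big_sets[measurable]: "i \<in> I \<Longrightarrow> big i \<in> sets M" for i unfolding big_def by measurable
    have up_le: "prob (up t) \<le> exp 1 * \<kappa> powr (x / (2 * L))" if "t \<in> F" for t
      unfolding up_def S_def \<kappa>_def
      using truncated_sum_tail[OF assms(1-3) law bound[OF that] assms(9,10) V[OF that]] True
      by (simp add: \<kappa>_def)
    have dn_le: "prob (dn t) \<le> exp 1 * \<kappa> powr (x / (2 * L))" if "t \<in> F" for t
      unfolding dn_def S_def \<kappa>_def
      using truncated_sum_tail[OF assms(1-3) law, of "\<lambda>i. - a t i" A L V x] bound[OF that] assms(9,10) V[OF that] True
      by (simp add: \<kappa>_def sum_negf)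
    have big_le: "prob (big i) \<le> stable_const \<alpha> / L powr \<alpha> * (\<sigma> i * A i powr \<alpha>)" if i: "i \<in> I" for i
    proof -
      have [measurable]: "\<xi> i \<in> borel_measurable M" using i by simp
      have "big i \<subseteq> {\<omega> \<in> space M. 1 \<le> min 1 ((A i / L * \<xi> i \<omega>)\<^sup>2)}"
      proof
        fix \<omega> assume "\<omega> \<in> big i"
        then have "1 \<le> \<bar>A i / L * \<xi> i \<omega>\<bar>" "\<omega> \<in> space M"
          using assms(9) A0[OF i] by (auto simp: big_def abs_mult)
        then show "\<omega> \<in> {\<omega> \<in> space M. 1 \<le> min 1 ((A i / L * \<xi> i \<omega>)\<^sup>2)}"
          using power_mono[of 1 "\<bar>A i / L * \<xi> i \<omega>\<bar>" 2] by (simp only: power2_abs) simp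
      qed
      then have "prob (big i) \<le> prob {\<omega> \<in> space M. 1 \<le> min 1 ((A i / L * \<xi> i \<omega>)\<^sup>2)}"
        by (intro finite_measure_mono) measurable
      also have "\<dots> \<le> expectation (\<lambda>\<omega>. min 1 ((A i / L * \<xi> i \<omega>)\<^sup>2)) / 1"
        by (intro integral_Markov_inequality_measure) (auto intro!: integrable_const_bound[of _ 1])
      also have "\<dots> \<le> stable_const \<alpha> * \<sigma> i * (A i / L) powr \<alpha>"
        using sas_truncated_second_moment[OF assms(1) law[OF i], of "A i / L"] A0[OF i] assms(9) by simp
      finally show ?thesis using A0[OF i] assms(9) by (simp add: powr_divide mult_ac)
    qed
    have "{\<omega> \<in> space M. \<exists>t\<in>F. x \<le> \<bar>\<Sum>i\<in>I. a t i * \<xi> i \<omega>\<bar>} \<subseteq> (\<Union>i\<in>I. big i) \<union> (\<Union>t\<in>F. up t \<union> dn t)"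
    proof
      fix \<omega> assume \<omega>: "\<omega> \<in> {\<omega> \<in> space M. \<exists>t\<in>F. x \<le> \<bar>\<Sum>i\<in>I. a t i * \<xi> i \<omega>\<bar>}"
      then obtain t where t: "t \<in> F" "x \<le> \<bar>\<Sum>i\<in>I. a t i * \<xi> i \<omega>\<bar>" by auto
      show "\<omega> \<in> (\<Union>i\<in>I. big i) \<union> (\<Union>t\<in>F. up t \<union> dn t)"
      proof (cases "\<exists>i\<in>I. \<omega> \<in> big i")
        case False
        then have "(\<Sum>i\<in>I. a t i * \<xi> i \<omega>) = S t \<omega>"
          unfolding S_def using \<omega> by (intro sum.cong) (auto simp: big_def)
        then show ?thesis using t \<omega> by (auto simp: up_def dn_def abs_real_def split: if_splits)
      qed auto
    qed
    then have "prob {\<omega> \<in> space M. \<exists>t\<in>F. x \<le> \<bar>\<Sum>i\<in>I. a t i * \<xi> i \<omega>\<bar>}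
        \<le> prob ((\<Union>i\<in>I. big i) \<union> (\<Union>t\<in>F. up t \<union> dn t))"
      using assms(2,5) by (intro finite_measure_mono sets.Un sets.finite_UN) auto
    also have "\<dots> \<le> prob (\<Union>i\<in>I. big i) + prob (\<Union>t\<in>F. up t \<union> dn t)"
      using assms(2,5) by (intro measure_Un_le sets.finite_UN) auto
    also have "\<dots> \<le> (\<Sum>i\<in>I. prob (big i)) + (\<Sum>t\<in>F. prob (up t \<union> dn t))"
      using assms(2,5) by (intro add_mono finite_measure_subadditive_finite) auto
    also have "\<dots> \<le> (\<Sum>i\<in>I. stable_const \<alpha> / L powr \<alpha> * (\<sigma> i * A i powr \<alpha>))
        + (\<Sum>t\<in>F. exp 1 * \<kappa> powr (x / (2 * L)) + exp 1 * \<kappa> powr (x / (2 * L)))"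
      using up_le dn_le
      by (intro add_mono sum_mono big_le order_trans[OF measure_Un_le]) auto
    also have "\<dots> = stable_const \<alpha> / L powr \<alpha> * (\<Sum>i\<in>I. \<sigma> i * A i powr \<alpha>) + card F * (2 * exp 1 * \<kappa> powr (x / (2 * L)))"
      by (simp add: sum_distrib_left)
    also have "\<dots> \<le> stable_const \<alpha> / L powr \<alpha> * B + card F * (2 * exp 1 * \<kappa> powr (x / (2 * L)))"
      using B C by (intro add_mono mult_left_mono) auto
    finally show ?thesis by (simp add: \<kappa>_def)
  qed
qed

end

section \<open>Stable integrals of simple functions\<close>

text \<open>
  Needed to pass from sequences to arbitrary finite index sets.
\<close>

lemma (in prob_space) indep_vars_reindex_inj:
  assumes "indep_vars (\<lambda>_. N) X UNIV" "inj_on h I"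
  shows "indep_vars (\<lambda>_. N) (\<lambda>i. X (h i)) I"
  unfolding indep_vars_def2
proof (intro conjI ballI indep_setsI)
  show "random_variable N (X (h i))" for i using assms(1) by (auto simp: indep_vars_def2)
  show "{X (h i) -` A \<inter> space M |A. A \<in> sets N} \<subseteq> events" if "i \<in> I" for i
    using assms(1) by (auto simp: indep_vars_def2 intro: measurable_sets)
  fix A J assume J: "J \<noteq> {}" "J \<subseteq> I" "finite J"
    and A: "\<forall>j\<in>J. A j \<in> {X (h j) -` A \<inter> space M |A. A \<in> sets N}"
  have inj: "inj_on h J" using assms(2) J(2) by (rule inj_on_subset)
  have "prob (\<Inter>k\<in>h ` J. A (inv_into J h k)) = (\<Prod>k\<in>h ` J. prob (A (inv_into J h k)))"
    using assms(1) J A inj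
    by (intro indep_setsD[of "\<lambda>k. {X k -` A \<inter> space M |A. A \<in> sets N}" UNIV])
      (auto simp: indep_vars_def2)
  then show "prob (\<Inter> (A ` J)) = (\<Prod>j\<in>J. prob (A j))"
    using inj by (simp add: prod.reindex image_image)
qed

text \<open>
  A substitute for Minkowski's inequality that holds for every positive exponent, including
  those below \<open>1\<close>.
\<close>

lemma powr_abs_add_le:
  fixes a b :: real
  assumes "0 < \<alpha>"
  shows "\<bar>a + b\<bar> powr \<alpha> \<le> 2 powr \<alpha> * (\<bar>a\<bar> powr \<alpha> + \<bar>b\<bar> powr \<alpha>)"
proof -
  have "\<bar>a + b\<bar> powr \<alpha> \<le> (2 * max \<bar>a\<bar> \<bar>b\<bar>) powr \<alpha>"
    using assms by (intro powr_mono2) auto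
  also have "\<dots> = 2 powr \<alpha> * max \<bar>a\<bar> \<bar>b\<bar> powr \<alpha>" by (simp add: powr_mult)
  also have "\<dots> \<le> 2 powr \<alpha> * (\<bar>a\<bar> powr \<alpha> + \<bar>b\<bar> powr \<alpha>)"
    by (intro mult_left_mono) (auto simp: max_def)
  finally show ?thesis .
qed

lemma (in prob_space) char_tendsto_of_tendsto_in_prob:
  assumes [measurable]: "\<And>k. S k \<in> borel_measurable M" "Z \<in> borel_measurable M"
    and conv: "\<And>\<epsilon>. 0 < \<epsilon> \<Longrightarrow> (\<lambda>k. prob {\<omega> \<in> space M. \<epsilon> < \<bar>S k \<omega> - Z \<omega>\<bar>}) \<longlonglongrightarrow> 0"
  shows "(\<lambda>k. char (distr M borel (S k)) 1) \<longlonglongrightarrow> char (distr M borel Z) 1"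
proof (rule LIMSEQ_I)
  fix e :: real assume e: "0 < e"
  have "\<forall>\<^sub>F k in sequentially. prob {\<omega> \<in> space M. e / 2 < \<bar>S k \<omega> - Z \<omega>\<bar>} < e / 4"
    using e by (intro order_tendstoD(2)[OF conv]) auto
  then obtain N where N: "\<And>k. N \<le> k \<Longrightarrow> prob {\<omega> \<in> space M. e / 2 < \<bar>S k \<omega> - Z \<omega>\<bar>} < e / 4"
    by (auto simp: eventually_sequentially)
  have "norm (char (distr M borel (S k)) 1 - char (distr M borel Z) 1) < e" if "N \<le> k" for k
  proof -
    let ?A = "{\<omega> \<in> space M. e / 2 < \<bar>S k \<omega> - Z \<omega>\<bar>}"
    have A[measurable]: "?A \<in> sets M" by measurable
    have int: "integrable M (\<lambda>\<omega>. iexp (Y \<omega>))" if [measurable]: "Y \<in> borel_measurable M" for Y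
      by (rule integrable_const_bound[of _ 1]) auto
    have "char (distr M borel (S k)) 1 - char (distr M borel Z) 1 = expectation (\<lambda>\<omega>. iexp (S k \<omega>) - iexp (Z \<omega>))"
      using int by (simp add: char_def integral_distr)
    also have "norm \<dots> \<le> expectation (\<lambda>\<omega>. norm (iexp (S k \<omega>) - iexp (Z \<omega>)))"
      by (rule integral_norm_bound)
    also have "\<dots> \<le> expectation (\<lambda>\<omega>. e / 2 + 2 * indicator ?A \<omega>)"
    proof (intro integral_mono)
      show "integrable M (\<lambda>\<omega>. norm (iexp (S k \<omega>) - iexp (Z \<omega>)))"
        using int by (intro integrable_norm Bochner_Integration.integrable_diff) auto
      show "integrable M (\<lambda>\<omega>. e / 2 + 2 * indicator ?A \<omega>)"
        by (intro Bochner_Integration.integrable_add integrable_mult_right integrable_real_indicator)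
          (auto simp: less_top[symmetric])
      fix \<omega> assume \<omega>: "\<omega> \<in> space M"
      have "norm (iexp (S k \<omega>) - iexp (Z \<omega>)) \<le> 2"
        using norm_triangle_ineq4[of "iexp (S k \<omega>)" "iexp (Z \<omega>)"] by simp
      moreover have "norm (iexp (S k \<omega>) - iexp (Z \<omega>)) \<le> \<bar>S k \<omega> - Z \<omega>\<bar>"
      proof -
        have "iexp (S k \<omega>) - iexp (Z \<omega>) = iexp (Z \<omega>) * (iexp (S k \<omega> - Z \<omega>) - 1)"
          by (simp add: algebra_simps exp_diff)
        also have "norm \<dots> = norm (iexp (S k \<omega> - Z \<omega>) - 1)" by (simp add: norm_mult)
        also have "\<dots> \<le> \<bar>S k \<omega> - Z \<omega>\<bar>"
          using iexp_approx1[of "S k \<omega> - Z \<omega>" 0] by simp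
        finally show ?thesis .
      qed
      ultimately show "norm (iexp (S k \<omega>) - iexp (Z \<omega>)) \<le> e / 2 + 2 * indicator ?A \<omega>"
        using \<omega> e by (auto simp: indicator_def)
    qed
    also have "\<dots> = e / 2 + 2 * prob ?A"
      by (subst Bochner_Integration.integral_add) (auto simp: prob_space less_top[symmetric])
    also have "\<dots> < e" using N[OF that] by simp
    finally show ?thesis .
  qed
  then show "\<exists>N. \<forall>k\<ge>N. norm (char (distr M borel (S k)) 1 - char (distr M borel Z) 1) < e" by blast
qed

lemma nn_integral_powr_le_approx:
  assumes "0 < \<alpha>" and [measurable]: "g \<in> borel_measurable m" "s \<in> borel_measurable m"
  shows "(\<integral>\<^sup>+x. ennreal (\<bar>g x\<bar> powr \<alpha>) \<partial>m)
      \<le> ennreal (2 powr \<alpha>) * ((\<integral>\<^sup>+x. ennreal (\<bar>s x\<bar> powr \<alpha>) \<partial>m) + (\<integral>\<^sup>+x. ennreal (\<bar>s x - g x\<bar> powr \<alpha>) \<partial>m))"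
proof -
  have "(\<integral>\<^sup>+x. ennreal (\<bar>g x\<bar> powr \<alpha>) \<partial>m)
      \<le> (\<integral>\<^sup>+x. ennreal (2 powr \<alpha>) * (ennreal (\<bar>s x\<bar> powr \<alpha>) + ennreal (\<bar>s x - g x\<bar> powr \<alpha>)) \<partial>m)"
  proof (intro nn_integral_mono)
    fix x
    have "\<bar>g x\<bar> powr \<alpha> \<le> 2 powr \<alpha> * (\<bar>s x\<bar> powr \<alpha> + \<bar>s x - g x\<bar> powr \<alpha>)"
      using powr_abs_add_le[OF assms(1), of "s x" "g x - s x"] by (simp add: abs_minus_commute)
    then show "ennreal (\<bar>g x\<bar> powr \<alpha>)
        \<le> ennreal (2 powr \<alpha>) * (ennreal (\<bar>s x\<bar> powr \<alpha>) + ennreal (\<bar>s x - g x\<bar> powr \<alpha>))"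
      by (simp add: ennreal_plus[symmetric] ennreal_mult'[symmetric] ennreal_leI del: ennreal_plus)
  qed
  also have "\<dots> = ennreal (2 powr \<alpha>) * ((\<integral>\<^sup>+x. ennreal (\<bar>s x\<bar> powr \<alpha>) \<partial>m) + (\<integral>\<^sup>+x. ennreal (\<bar>s x - g x\<bar> powr \<alpha>) \<partial>m))"
    by (subst nn_integral_cmult) (auto simp: nn_integral_add)
  finally show ?thesis .
qed

definition finite_simple :: "'e measure \<Rightarrow> ('e \<Rightarrow> real) \<Rightarrow> bool" where
  "finite_simple m s \<longleftrightarrow> simple_function m s \<and> {x \<in> space m. s x \<noteq> 0} \<in> finite_sets m"

lemma level_set_finite_sets:
  assumes "finite_simple m s" "y \<noteq> 0"
  shows "{x \<in> space m. s x = y} \<in> finite_sets m"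
proof -
  have [measurable]: "s \<in> borel_measurable m"
    using assms(1) by (auto simp: finite_simple_def intro: borel_measurable_simple_function)
  have "emeasure m {x \<in> space m. s x = y} \<le> emeasure m {x \<in> space m. s x \<noteq> 0}"
    using assms by (intro emeasure_mono) auto
  then show ?thesis using assms by (auto simp: finite_simple_def finite_sets_def)
qed

lemma finite_simple_diff:
  assumes "finite_simple m s" "finite_simple m s'"
  shows "finite_simple m (\<lambda>x. s x - s' x)"
proof -
  have [measurable]: "s \<in> borel_measurable m" "s' \<in> borel_measurable m"
    using assms by (auto simp: finite_simple_def intro: borel_measurable_simple_function)
  have S: "{x \<in> space m. s x \<noteq> 0} \<in> sets m" "{x \<in> space m. s' x \<noteq> 0} \<in> sets m" by measurable
  have "emeasure m {x \<in> space m. s x - s' x \<noteq> 0}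
      \<le> emeasure m ({x \<in> space m. s x \<noteq> 0} \<union> {x \<in> space m. s' x \<noteq> 0})"
    using S by (intro emeasure_mono) auto
  also have "\<dots> \<le> emeasure m {x \<in> space m. s x \<noteq> 0} + emeasure m {x \<in> space m. s' x \<noteq> 0}"
    using S by (rule emeasure_subadditive)
  also have "\<dots> < \<infinity>" using assms by (auto simp: finite_simple_def finite_sets_def)
  finally show ?thesis
    using assms by (auto simp: finite_simple_def finite_sets_def intro: simple_function_diff)
qed

text \<open>
  The zero tuple is left out because its level set need not have finite measure; the other
  level sets partition the joint support of the functions into sets on which all of them are
  constant.
\<close>

definition joint_values :: "'e measure \<Rightarrow> 't set \<Rightarrow> ('t \<Rightarrow> 'e \<Rightarrow> real) \<Rightarrow> ('t \<Rightarrow> real) set" where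
  "joint_values m F s = (\<lambda>x. \<lambda>t\<in>F. s t x) ` space m - {\<lambda>t\<in>F. 0}"

definition joint_level_set :: "'e measure \<Rightarrow> 't set \<Rightarrow> ('t \<Rightarrow> 'e \<Rightarrow> real) \<Rightarrow> ('t \<Rightarrow> real) \<Rightarrow> 'e set" where
  "joint_level_set m F s y = {x \<in> space m. (\<lambda>t\<in>F. s t x) = y}"

lemma finite_joint_values:
  assumes "finite F" "\<And>t. t \<in> F \<Longrightarrow> finite_simple m (s t)"
  shows "finite (joint_values m F s)"
proof -
  have "joint_values m F s \<subseteq> (\<Pi>\<^sub>E t\<in>F. s t ` space m)"
    by (auto simp: joint_values_def)
  moreover have "finite (\<Pi>\<^sub>E t\<in>F. s t ` space m)"
    using assms by (intro finite_PiE) (auto simp: finite_simple_def simple_function_def)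
  ultimately show ?thesis by (rule finite_subset)
qed

lemma joint_level_set_sets:
  assumes "finite F" "\<And>t. t \<in> F \<Longrightarrow> finite_simple m (s t)" "y \<in> extensional F"
  shows "joint_level_set m F s y \<in> sets m"
proof -
  have "joint_level_set m F s y = {x \<in> space m. \<forall>t\<in>F. s t x = y t}"
    using assms(3) by (auto simp: joint_level_set_def fun_eq_iff extensional_def restrict_def)
  also have "\<dots> \<in> sets m"
  proof -
    have [measurable]: "s t \<in> borel_measurable m" if "t \<in> F" for t
      using assms(2)[OF that] by (auto simp: finite_simple_def intro: borel_measurable_simple_function)
    show ?thesis using assms(1) by measurable
  qed
  finally show ?thesis .
qed

lemma joint_level_set_finite_sets:
  assumes "finite F" "\<And>t. t \<in> F \<Longrightarrow> finite_simple m (s t)" "y \<in> joint_values m F s"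
  shows "joint_level_set m F s y \<in> finite_sets m"
proof -
  have y: "y \<in> extensional F" "y \<noteq> (\<lambda>t\<in>F. 0)" using assms(3) by (auto simp: joint_values_def)
  have "\<exists>t\<in>F. y t \<noteq> 0"
  proof (rule ccontr)
    assume "\<not> ?thesis"
    then have "y = (\<lambda>t\<in>F. 0)" by (intro extensionalityI[OF y(1)]) auto
    with y(2) show False ..
  qed
  then obtain t where t: "t \<in> F" "y t \<noteq> 0" by auto
  then have "joint_level_set m F s y \<subseteq> {x \<in> space m. s t x \<noteq> 0}"
    by (auto simp: joint_level_set_def)
  then have "emeasure m (joint_level_set m F s y) \<le> emeasure m {x \<in> space m. s t x \<noteq> 0}"
    using assms(2)[OF t(1)] by (intro emeasure_mono) (auto simp: finite_simple_def finite_sets_def)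
  also have "\<dots> < \<infinity>" using assms(2)[OF t(1)] by (auto simp: finite_simple_def finite_sets_def)
  finally show ?thesis
    using joint_level_set_sets[OF assms(1,2) y(1)] by (simp add: finite_sets_def)
qed

lemma disjoint_joint_level_sets: "disjoint_family_on (joint_level_set m F s) I"
  by (auto simp: disjoint_family_on_def joint_level_set_def)

text \<open>
  Integrals of functions of the tuple become the weighted sums that occur in the bound for
  linear combinations of independent variables.
\<close>

lemma nn_integral_joint_values:
  fixes \<phi> :: "('t \<Rightarrow> real) \<Rightarrow> real"
  assumes "finite F" "\<And>t. t \<in> F \<Longrightarrow> finite_simple m (s t)"
    and "\<And>y. 0 \<le> \<phi> y" "\<phi> (\<lambda>t\<in>F. 0) = 0"
  shows "(\<integral>\<^sup>+x. ennreal (\<phi> (\<lambda>t\<in>F. s t x)) \<partial>m)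
      = ennreal (\<Sum>y\<in>joint_values m F s. measure m (joint_level_set m F s y) * \<phi> y)"
proof -
  let ?I = "joint_values m F s" and ?A = "joint_level_set m F s"
  have A: "y \<in> ?I \<Longrightarrow> ?A y \<in> sets m" "y \<in> ?I \<Longrightarrow> emeasure m (?A y) < \<infinity>" for y
    using joint_level_set_finite_sets[OF assms(1,2)] by (auto simp: finite_sets_def)
  have "(\<integral>\<^sup>+x. ennreal (\<phi> (\<lambda>t\<in>F. s t x)) \<partial>m)
      = (\<integral>\<^sup>+x. (\<Sum>y\<in>?I. ennreal (\<phi> y) * indicator (?A y) x) \<partial>m)"
  proof (intro nn_integral_cong)
    fix x assume x: "x \<in> space m"
    have *: "indicator (?A y) x = (if (\<lambda>t\<in>F. s t x) = y then 1 else (0::ennreal))" for y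
      using x by (auto simp: joint_level_set_def)
    show "ennreal (\<phi> (\<lambda>t\<in>F. s t x)) = (\<Sum>y\<in>?I. ennreal (\<phi> y) * indicator (?A y) x)"
      using x assms(4) finite_joint_values[OF assms(1,2)]
      by (auto simp: * joint_values_def if_distrib cong: if_cong)
  qed
  also have "\<dots> = (\<Sum>y\<in>?I. ennreal (\<phi> y) * emeasure m (?A y))"
    using A by (simp add: nn_integral_sum nn_integral_cmult_indicator)
  also have "\<dots> = (\<Sum>y\<in>?I. ennreal (measure m (?A y) * \<phi> y))"
    using A(2) assms(3)
    by (intro sum.cong) (auto simp: emeasure_eq_ennreal_measure less_top ennreal_mult'' mult.commute)
  also have "\<dots> = ennreal (\<Sum>y\<in>?I. measure m (?A y) * \<phi> y)"
    using assms(3) by (intro sum_ennreal) auto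
  finally show ?thesis .
qed

locale stable_measure = prob_space Q for Q :: "'q measure" +
  fixes \<alpha> :: real and m :: "'e measure" and M :: "'e set \<Rightarrow> 'q \<Rightarrow> real"
  assumes \<alpha>_pos: "0 < \<alpha>" and random_measure: "sas_random_measure \<alpha> m Q M"
begin

lemma M_measurable[measurable]: "A \<in> finite_sets m \<Longrightarrow> M A \<in> borel_measurable Q"
  using random_measure by (simp add: sas_random_measure_def)

lemma M_sas_law: "A \<in> finite_sets m \<Longrightarrow> has_sas_law \<alpha> Q (measure m A) (M A)"
  using random_measure by (simp add: sas_random_measure_def has_sas_law_def)

lemma empty_finite_sets: "{} \<in> finite_sets m"
  by (simp add: finite_sets_def)

text \<open>
  A finite family is turned into a sequence by padding with the empty set, the form in
  which scattering and additivity are given.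
\<close>

lemma pad_finite_family:
  assumes "finite I" "\<And>i. i \<in> I \<Longrightarrow> A i \<in> finite_sets m" "disjoint_family_on A I"
  obtains A' :: "nat \<Rightarrow> 'e set" and h where "bij_betw h I {..<card I}"
    "\<And>i. i \<in> I \<Longrightarrow> A' (h i) = A i" "\<And>n. card I \<le> n \<Longrightarrow> A' n = {}"
    "range A' \<subseteq> finite_sets m" "disjoint_family A'" "(\<Union>n. A' n) = (\<Union>i\<in>I. A i)"
proof -
  obtain h where h: "bij_betw h I {..<card I}"
    using ex_bij_betw_finite_nat[OF assms(1)] by (auto simp: atLeast0LessThan)
  define g where "g = inv_into I h"
  have g: "n < card I \<Longrightarrow> g n \<in> I" "n < card I \<Longrightarrow> h (g n) = n" "i \<in> I \<Longrightarrow> g (h i) = i" "i \<in> I \<Longrightarrow> h i < card I" for n i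
    using h by (auto simp: g_def bij_betw_def f_inv_into_f intro: inv_into_into)
  define A' where "A' n = (if n < card I then A (g n) else {})" for n
  show ?thesis
  proof (rule that[OF h])
    show "A' (h i) = A i" if "i \<in> I" for i using that g by (simp add: A'_def)
    show "A' n = {}" if "card I \<le> n" for n using that by (simp add: A'_def)
    show "range A' \<subseteq> finite_sets m" using assms(2) g empty_finite_sets by (auto simp: A'_def)
    show "disjoint_family A'"
      unfolding disjoint_family_on_def
    proof (intro ballI impI)
      fix k l :: nat assume "k \<noteq> l"
      then show "A' k \<inter> A' l = {}"
        using assms(3) g(1,2)[of k] g(1,2)[of l] by (auto simp: A'_def disjoint_family_on_def) (metis disjoint_iff)
    qed
    show "(\<Union>n. A' n) = (\<Union>i\<in>I. A i)"
      using g by (fastforce simp: A'_def split: if_splits)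
  qed
qed

lemma M_indep_vars:
  assumes "finite I" "\<And>i. i \<in> I \<Longrightarrow> A i \<in> finite_sets m" "disjoint_family_on A I"
  shows "indep_vars (\<lambda>_. borel) (\<lambda>i. M (A i)) I"
proof -
  obtain A' h where *: "bij_betw h I {..<card I}" "\<And>i. i \<in> I \<Longrightarrow> A' (h i) = A i"
    "range A' \<subseteq> finite_sets m" "disjoint_family A'"
    using pad_finite_family[OF assms] by metis
  then have "indep_vars (\<lambda>_. borel) (\<lambda>i. M (A' i)) UNIV"
    using random_measure by (auto simp: sas_random_measure_def)
  from indep_vars_reindex_inj[OF this, of h I] * show ?thesis
    by (subst indep_vars_cong[OF refl _ refl, of _ _ "\<lambda>i. M (A' (h i))"]) (auto simp: bij_betw_def)
qed

lemma AE_M_countably_additive: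
  fixes A :: "nat \<Rightarrow> 'e set"
  assumes "range A \<subseteq> finite_sets m" "disjoint_family A" "(\<Union>i. A i) \<in> finite_sets m"
  shows "AE \<omega> in Q. (\<lambda>i. M (A i) \<omega>) sums M (\<Union>i. A i) \<omega>"
  using random_measure assms by (simp add: sas_random_measure_def)

lemma AE_M_empty: "AE \<omega> in Q. M {} \<omega> = 0"
proof -
  have "disjoint_family (\<lambda>i::nat. {} :: 'e set)" by (simp add: disjoint_family_on_def)
  then have "AE \<omega> in Q. (\<lambda>i::nat. M {} \<omega>) sums M (\<Union>i::nat. {}) \<omega>"
    using empty_finite_sets by (intro AE_M_countably_additive) auto
  then show ?thesis
    by eventually_elim (auto dest!: sums_summable simp: summable_const_iff)
qed

lemma AE_M_additive:
  assumes "finite I" "\<And>i. i \<in> I \<Longrightarrow> A i \<in> finite_sets m" "disjoint_family_on A I"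
    and "(\<Union>i\<in>I. A i) \<in> finite_sets m"
  shows "AE \<omega> in Q. M (\<Union>i\<in>I. A i) \<omega> = (\<Sum>i\<in>I. M (A i) \<omega>)"
proof -
  obtain A' :: "nat \<Rightarrow> 'e set" and h where *: "bij_betw h I {..<card I}" "\<And>i. i \<in> I \<Longrightarrow> A' (h i) = A i"
    "\<And>n. card I \<le> n \<Longrightarrow> A' n = {}"
    "range A' \<subseteq> finite_sets m" "disjoint_family A'" "(\<Union>n. A' n) = (\<Union>i\<in>I. A i)"
    using pad_finite_family[OF assms(1-3)] by metis
  then have "AE \<omega> in Q. (\<lambda>n. M (A' n) \<omega>) sums M (\<Union>i\<in>I. A i) \<omega>"
    using AE_M_countably_additive[OF *(4,5)] assms(4) by simp
  with AE_M_empty show ?thesis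
  proof eventually_elim
    case (elim \<omega>)
    have "(\<lambda>n. M (A' n) \<omega>) sums (\<Sum>n<card I. M (A' n) \<omega>)"
      using *(3) elim(1) by (intro sums_finite) (auto simp: not_less)
    then have "M (\<Union>i\<in>I. A i) \<omega> = (\<Sum>n<card I. M (A' n) \<omega>)"
      using elim(2) by (rule sums_unique2[OF _, symmetric])
    also have "\<dots> = (\<Sum>i\<in>I. M (A' (h i)) \<omega>)"
      by (rule sum.reindex_bij_betw[OF *(1), symmetric])
    also have "\<dots> = (\<Sum>i\<in>I. M (A i) \<omega>)" using *(2) by (intro sum.cong) auto
    finally show ?case .
  qed
qed

lemma simple_stable_integral_measurable:
  assumes "finite_simple m s"
  shows "simple_stable_integral m M s \<in> borel_measurable Q"
  unfolding simple_stable_integral_def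
  using level_set_finite_sets[OF assms] by (auto intro!: borel_measurable_sum)

text \<open>
  Each level set of a single function is a finite disjoint union of joint level sets, and \<open>M\<close> is
  finitely additive almost surely.  In this form all the integrals of the family are linear
  combinations of the same independent stable variables.
\<close>

lemma AE_simple_stable_integral_joint:
  assumes "finite F" "\<And>t. t \<in> F \<Longrightarrow> finite_simple m (s t)" "t \<in> F"
  shows "AE \<omega> in Q. simple_stable_integral m M (s t) \<omega>
      = (\<Sum>y\<in>joint_values m F s. y t * M (joint_level_set m F s y) \<omega>)"
proof -
  let ?I = "joint_values m F s" and ?A = "joint_level_set m F s"
  have fin: "finite ?I" by (rule finite_joint_values[OF assms(1,2)])
  have finV: "finite (s t ` space m - {0})"
    using assms(2)[OF assms(3)] by (auto simp: finite_simple_def simple_function_def)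
  have "AE \<omega> in Q. \<forall>v\<in>s t ` space m - {0}. M {x \<in> space m. s t x = v} \<omega> = (\<Sum>y\<in>{y \<in> ?I. y t = v}. M (?A y) \<omega>)"
  proof (intro AE_finite_allI finV)
    fix v assume v: "v \<in> s t ` space m - {0}"
    have U: "{x \<in> space m. s t x = v} = (\<Union>y\<in>{y \<in> ?I. y t = v}. ?A y)"
    proof -
      have "(\<lambda>t\<in>F. s t x) \<in> ?I" if "s t x = v" "x \<in> space m" for x
      proof -
        have "(\<lambda>t\<in>F. s t x) t \<noteq> (\<lambda>t\<in>F. 0) t" using that v assms(3) by auto
        then have "(\<lambda>t\<in>F. s t x) \<noteq> (\<lambda>t\<in>F. 0)" by metis
        then show ?thesis using that(2) by (auto simp: joint_values_def)
      qed
      then show ?thesis using assms(3) by (force simp: joint_level_set_def)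
    qed
    show "AE \<omega> in Q. M {x \<in> space m. s t x = v} \<omega> = (\<Sum>y\<in>{y \<in> ?I. y t = v}. M (?A y) \<omega>)"
      unfolding U using fin joint_level_set_finite_sets[OF assms(1,2)] U v level_set_finite_sets[OF assms(2)[OF assms(3)], of v]
      by (intro AE_M_additive disjoint_joint_level_sets) auto
  qed
  then show ?thesis
  proof eventually_elim
    case (elim \<omega>)
    have "simple_stable_integral m M (s t) \<omega>
        = (\<Sum>v\<in>s t ` space m - {0}. \<Sum>y\<in>{y \<in> {y \<in> ?I. y t \<noteq> 0}. y t = v}. y t * M (?A y) \<omega>)"
      unfolding simple_stable_integral_def using elim
      by (intro sum.cong) (auto simp: sum_distrib_left intro!: sum.cong)
    also have "\<dots> = (\<Sum>y\<in>{y \<in> ?I. y t \<noteq> 0}. y t * M (?A y) \<omega>)"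
      using fin finV assms(3) by (intro sum.group) (auto simp: joint_values_def)
    also have "\<dots> = (\<Sum>y\<in>?I. y t * M (?A y) \<omega>)"
      using fin by (intro sum.mono_neutral_left) auto
    finally show ?case .
  qed
qed

text \<open>
  The two functions and their difference are treated as one family of three.
\<close>

lemma AE_simple_stable_integral_diff:
  assumes "finite_simple m s" "finite_simple m s'"
  shows "AE \<omega> in Q. simple_stable_integral m M (\<lambda>x. s x - s' x) \<omega>
      = simple_stable_integral m M s \<omega> - simple_stable_integral m M s' \<omega>"
proof -
  define S where "S i = (if i = 0 then s else if i = 1 then s' else (\<lambda>x. s x - s' x))" for i :: nat
  let ?F = "{0, 1, 2 :: nat}"
  have S: "finite_simple m (S t)" if "t \<in> ?F" for t
    using assms finite_simple_diff[OF assms] by (simp add: S_def)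
  have y: "y 2 = y 0 - y 1" if "y \<in> joint_values m ?F S" for y
    using that by (auto simp: joint_values_def S_def)
  have "AE \<omega> in Q. \<forall>t\<in>?F. simple_stable_integral m M (S t) \<omega>
      = (\<Sum>y\<in>joint_values m ?F S. y t * M (joint_level_set m ?F S y) \<omega>)"
    by (intro AE_finite_allI AE_simple_stable_integral_joint S) auto
  then show ?thesis
  proof eventually_elim
    case (elim \<omega>)
    have "(\<Sum>z\<in>joint_values m ?F S. z 2 * M (joint_level_set m ?F S z) \<omega>)
        = (\<Sum>z\<in>joint_values m ?F S. z 0 * M (joint_level_set m ?F S z) \<omega> - z 1 * M (joint_level_set m ?F S z) \<omega>)"
    proof (intro sum.cong refl)
      fix z assume "z \<in> joint_values m ?F S"
      then show "z 2 * M (joint_level_set m ?F S z) \<omega>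
          = z 0 * M (joint_level_set m ?F S z) \<omega> - z 1 * M (joint_level_set m ?F S z) \<omega>"
        by (simp only: y left_diff_distrib)
    qed
    then show ?case using elim by (simp add: sum_subtractf S_def)
  qed
qed

text \<open>
  The characteristic functions of the independent summands multiply, and the exponents add up
  to the integral of \<open>\<bar>s\<bar> powr \<alpha>\<close>.
\<close>

lemma simple_stable_integral_char:
  assumes "finite_simple m s"
  obtains \<sigma> where "0 \<le> \<sigma>" "(\<integral>\<^sup>+x. ennreal (\<bar>s x\<bar> powr \<alpha>) \<partial>m) = ennreal \<sigma>"
    "char (distr Q borel (simple_stable_integral m M s)) 1 = complex_of_real (exp (- \<sigma>))"
proof -
  let ?F = "{()}"
  let ?s = "\<lambda>_::unit. s"
  let ?I = "joint_values m ?F ?s" and ?A = "joint_level_set m ?F ?s"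
  have s: "finite ?F" "\<And>t. t \<in> ?F \<Longrightarrow> finite_simple m (?s t)" using assms by auto
  note fin = finite_joint_values[OF s]
  note A = joint_level_set_finite_sets[OF s]
  have meas[measurable]: "y \<in> ?I \<Longrightarrow> M (?A y) \<in> borel_measurable Q" for y using A by auto
  define \<sigma> where "\<sigma> = (\<Sum>y\<in>?I. measure m (?A y) * \<bar>y ()\<bar> powr \<alpha>)"
  have eq: "(\<integral>\<^sup>+x. ennreal (\<bar>s x\<bar> powr \<alpha>) \<partial>m) = ennreal \<sigma>"
    using nn_integral_joint_values[OF s, where \<phi> = "\<lambda>y. \<bar>y ()\<bar> powr \<alpha>"] by (simp add: \<sigma>_def)
  have indep: "indep_vars (\<lambda>_. borel) (\<lambda>y \<omega>. y () * M (?A y) \<omega>) ?I"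
    by (rule indep_vars_compose2[OF M_indep_vars[OF fin A disjoint_joint_level_sets], where Y = "\<lambda>y x. y () * x"]) auto
  have scaled: "char (distr Q borel (\<lambda>\<omega>. c * \<xi> \<omega>)) 1 = char (distr Q borel \<xi>) c"
    if [measurable]: "\<xi> \<in> borel_measurable Q" for c \<xi>
    unfolding char_def by (simp add: integral_distr)
  have "char (distr Q borel (simple_stable_integral m M s)) 1
      = char (distr Q borel (\<lambda>\<omega>. \<Sum>y\<in>?I. y () * M (?A y) \<omega>)) 1"
    using AE_simple_stable_integral_joint[of ?F ?s "()", OF s] simple_stable_integral_measurable[OF assms]
    by (subst distr_cong_AE[OF refl refl]) auto
  also have "\<dots> = (\<Prod>y\<in>?I. char (distr Q borel (\<lambda>\<omega>. y () * M (?A y) \<omega>)) 1)"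
    by (rule char_distr_sum[OF indep])
  also have "\<dots> = (\<Prod>y\<in>?I. complex_of_real (exp (- (measure m (?A y) * \<bar>y ()\<bar> powr \<alpha>))))"
    using M_sas_law[OF A] by (intro prod.cong) (auto simp: scaled has_sas_law_def mult.commute)
  also have "\<dots> = complex_of_real (exp (- \<sigma>))"
    by (simp add: \<sigma>_def exp_sum[OF fin, symmetric] sum_negf flip: of_real_prod)
  finally show ?thesis using that[of \<sigma>] eq by (simp add: \<sigma>_def sum_nonneg)
qed

lemma max_simple_stable_integral_tail:
  assumes "finite F" "F \<noteq> {}" "\<And>t. t \<in> F \<Longrightarrow> finite_simple m (s t)"
    and "0 < x" "0 < L" "0 < V" "0 \<le> B"
    and B: "(\<integral>\<^sup>+x. ennreal (Max ((\<lambda>t. \<bar>s t x\<bar> powr \<alpha>) ` F)) \<partial>m) \<le> ennreal B"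
    and V: "\<And>t. t \<in> F \<Longrightarrow> (\<integral>\<^sup>+x. ennreal (\<bar>s t x\<bar> powr \<alpha>) \<partial>m) \<le> ennreal V"
  shows "prob {\<omega> \<in> space Q. \<exists>t\<in>F. x \<le> \<bar>simple_stable_integral m M (s t) \<omega>\<bar>}
      \<le> stable_const \<alpha> * B / L powr \<alpha>
        + card F * (2 * exp 1 * (stable_const \<alpha> * V / L powr \<alpha>) powr (x / (2 * L)))"
proof -
  let ?I = "joint_values m F s" and ?A = "joint_level_set m F s"
  have [measurable]: "t \<in> F \<Longrightarrow> simple_stable_integral m M (s t) \<in> borel_measurable Q" for t
    by (intro simple_stable_integral_measurable assms)
  note fin = finite_joint_values[OF assms(1,3)]
  note A = joint_level_set_finite_sets[OF assms(1,3)]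
  have [measurable]: "y \<in> ?I \<Longrightarrow> M (?A y) \<in> borel_measurable Q" for y using A by auto
  define env where "env y = Max ((\<lambda>t. \<bar>y t\<bar> powr \<alpha>) ` F)" for y :: "'a \<Rightarrow> real"
  have env: "\<bar>y t\<bar> powr \<alpha> \<le> env y" if "t \<in> F" for y t
    unfolding env_def using that assms(1) by auto
  have env0: "0 \<le> env y" for y
    using assms(2) env[of _ y] by (metis all_not_in_conv order_trans powr_ge_zero)
  have env_zero: "env (\<lambda>t\<in>F. 0) = 0"
    using assms(2) by (simp add: env_def image_constant_conv cong: image_cong)
  have env_restrict: "Max ((\<lambda>t. \<bar>s t x\<bar> powr \<alpha>) ` F) = env (\<lambda>t\<in>F. s t x)" for x
    by (simp add: env_def cong: image_cong)
  have "AE \<omega> in Q. \<forall>t\<in>F. simple_stable_integral m M (s t) \<omega> = (\<Sum>y\<in>?I. y t * M (?A y) \<omega>)"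
    by (intro AE_finite_allI AE_simple_stable_integral_joint assms)
  then have "prob {\<omega> \<in> space Q. \<exists>t\<in>F. x \<le> \<bar>simple_stable_integral m M (s t) \<omega>\<bar>}
      = prob {\<omega> \<in> space Q. \<exists>t\<in>F. x \<le> \<bar>\<Sum>y\<in>?I. y t * M (?A y) \<omega>\<bar>}"
    using assms(1) by (intro finite_measure_eq_AE) auto
  also have "\<dots> \<le> stable_const \<alpha> * B / L powr \<alpha>
        + card F * (2 * exp 1 * (stable_const \<alpha> * V / L powr \<alpha>) powr (x / (2 * L)))"
  proof (rule max_stable_sum_tail[OF \<alpha>_pos fin M_indep_vars[OF fin A disjoint_joint_level_sets]
        M_sas_law[OF A] assms(1), where A = "\<lambda>y. env y powr (1 / \<alpha>)"])
    show "\<bar>y t\<bar> \<le> env y powr (1 / \<alpha>)" if "t \<in> F" for t y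
      using powr_mono2[OF _ _ env[OF that], of "1 / \<alpha>" y] \<alpha>_pos by (simp add: powr_powr)
    have "ennreal (\<Sum>y\<in>?I. measure m (?A y) * env y) \<le> ennreal B"
      using B nn_integral_joint_values[OF assms(1,3), where \<phi> = env, OF _ env0 env_zero] by (simp add: env_restrict)
    then show "(\<Sum>y\<in>?I. measure m (?A y) * (env y powr (1 / \<alpha>)) powr \<alpha>) \<le> B"
      using \<alpha>_pos env0 assms(7) by (simp add: powr_powr)
    show "(\<Sum>y\<in>?I. measure m (?A y) * \<bar>y t\<bar> powr \<alpha>) \<le> V" if "t \<in> F" for t
      using V[OF that] nn_integral_joint_values[of F m s "\<lambda>y. \<bar>y t\<bar> powr \<alpha>", OF assms(1,3)] assms(6) that
      by simp
  qed (use assms in auto)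
  finally show ?thesis .
qed

section \<open>Limits of simple stable integrals\<close>

lemma stable_integralE:
  assumes "has_stable_integral \<alpha> m Q M g Z"
  obtains s where "\<And>k. finite_simple m (s k)"
    "(\<lambda>k. \<integral>\<^sup>+x. ennreal (\<bar>s k x - g x\<bar> powr \<alpha>) \<partial>m) \<longlonglongrightarrow> 0"
    "\<And>\<epsilon>. 0 < \<epsilon> \<Longrightarrow> (\<lambda>k. prob {\<omega> \<in> space Q. \<epsilon> < \<bar>simple_stable_integral m M (s k) \<omega> - Z \<omega>\<bar>}) \<longlonglongrightarrow> 0"
  using assms unfolding has_stable_integral_def finite_simple_def by blast

lemma has_stable_integral_diff:
  assumes g: "has_stable_integral \<alpha> m Q M g Z" and h: "has_stable_integral \<alpha> m Q M h W"
  shows "has_stable_integral \<alpha> m Q M (\<lambda>x. g x - h x) (\<lambda>\<omega>. Z \<omega> - W \<omega>)"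
proof -
  have [measurable]: "g \<in> borel_measurable m" "h \<in> borel_measurable m" "Z \<in> borel_measurable Q" "W \<in> borel_measurable Q"
    using g h by (auto simp: has_stable_integral_def L_space_def)
  obtain s where s: "\<And>k. finite_simple m (s k)"
    "(\<lambda>k. \<integral>\<^sup>+x. ennreal (\<bar>s k x - g x\<bar> powr \<alpha>) \<partial>m) \<longlonglongrightarrow> 0"
    "\<And>\<epsilon>. 0 < \<epsilon> \<Longrightarrow> (\<lambda>k. prob {\<omega> \<in> space Q. \<epsilon> < \<bar>simple_stable_integral m M (s k) \<omega> - Z \<omega>\<bar>}) \<longlonglongrightarrow> 0"
    using stable_integralE[OF g] by blast
  obtain r where r: "\<And>k. finite_simple m (r k)"
    "(\<lambda>k. \<integral>\<^sup>+x. ennreal (\<bar>r k x - h x\<bar> powr \<alpha>) \<partial>m) \<longlonglongrightarrow> 0"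
    "\<And>\<epsilon>. 0 < \<epsilon> \<Longrightarrow> (\<lambda>k. prob {\<omega> \<in> space Q. \<epsilon> < \<bar>simple_stable_integral m M (r k) \<omega> - W \<omega>\<bar>}) \<longlonglongrightarrow> 0"
    using stable_integralE[OF h] by blast
  have [measurable]: "s k \<in> borel_measurable m" "r k \<in> borel_measurable m" for k
    using s(1) r(1) by (auto simp: finite_simple_def intro: borel_measurable_simple_function)
  note sr = finite_simple_diff[OF s(1) r(1)]
  have [measurable]: "simple_stable_integral m M (s k) \<in> borel_measurable Q"
      "simple_stable_integral m M (r k) \<in> borel_measurable Q"
      "simple_stable_integral m M (\<lambda>x. s k x - r k x) \<in> borel_measurable Q" for k
    by (intro simple_stable_integral_measurable s r sr)+
  have "(\<lambda>x. g x - h x) \<in> L_space \<alpha> m"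
  proof -
    have "integrable m (\<lambda>x. \<bar>g x\<bar> powr \<alpha>)" "integrable m (\<lambda>x. \<bar>h x\<bar> powr \<alpha>)"
      using g h by (auto simp: has_stable_integral_def L_space_def)
    then have "integrable m (\<lambda>x. 2 powr \<alpha> * (\<bar>g x\<bar> powr \<alpha> + \<bar>- h x\<bar> powr \<alpha>))" by simp
    then have "integrable m (\<lambda>x. \<bar>g x + - h x\<bar> powr \<alpha>)"
    proof (rule Bochner_Integration.integrable_bound)
      show "AE x in m. norm (\<bar>g x + - h x\<bar> powr \<alpha>) \<le> norm (2 powr \<alpha> * (\<bar>g x\<bar> powr \<alpha> + \<bar>- h x\<bar> powr \<alpha>))"
        unfolding real_norm_def abs_of_nonneg[OF powr_ge_zero]
        by (intro AE_I2 order_trans[OF powr_abs_add_le[OF \<alpha>_pos] abs_ge_self])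
    qed measurable
    then show ?thesis by (simp add: L_space_def)
  qed
  moreover have "(\<lambda>k. \<integral>\<^sup>+x. ennreal (\<bar>(s k x - r k x) - (g x - h x)\<bar> powr \<alpha>) \<partial>m) \<longlonglongrightarrow> 0"
  proof (rule tendsto_sandwich[OF _ _ tendsto_const])
    show "\<forall>\<^sub>F k in sequentially. (\<integral>\<^sup>+x. ennreal (\<bar>(s k x - r k x) - (g x - h x)\<bar> powr \<alpha>) \<partial>m)
       \<le> ennreal (2 powr \<alpha>) * ((\<integral>\<^sup>+x. ennreal (\<bar>s k x - g x\<bar> powr \<alpha>) \<partial>m) + (\<integral>\<^sup>+x. ennreal (\<bar>r k x - h x\<bar> powr \<alpha>) \<partial>m))"
    proof (intro always_eventually allI)
      fix k
      have "(\<integral>\<^sup>+x. ennreal (\<bar>(s k x - r k x) - (g x - h x)\<bar> powr \<alpha>) \<partial>m)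
          \<le> (\<integral>\<^sup>+x. ennreal (2 powr \<alpha>) * (ennreal (\<bar>s k x - g x\<bar> powr \<alpha>) + ennreal (\<bar>r k x - h x\<bar> powr \<alpha>)) \<partial>m)"
      proof (intro nn_integral_mono)
        fix x
        have "\<bar>(s k x - r k x) - (g x - h x)\<bar> powr \<alpha> \<le> 2 powr \<alpha> * (\<bar>s k x - g x\<bar> powr \<alpha> + \<bar>r k x - h x\<bar> powr \<alpha>)"
          using powr_abs_add_le[OF \<alpha>_pos, of "s k x - g x" "h x - r k x"]
          by (simp add: abs_minus_commute algebra_simps)
        then show "ennreal (\<bar>(s k x - r k x) - (g x - h x)\<bar> powr \<alpha>)
            \<le> ennreal (2 powr \<alpha>) * (ennreal (\<bar>s k x - g x\<bar> powr \<alpha>) + ennreal (\<bar>r k x - h x\<bar> powr \<alpha>))"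
          by (simp add: ennreal_plus[symmetric] ennreal_mult'[symmetric] ennreal_leI del: ennreal_plus)
      qed
      also have "\<dots> = ennreal (2 powr \<alpha>) * ((\<integral>\<^sup>+x. ennreal (\<bar>s k x - g x\<bar> powr \<alpha>) \<partial>m) + (\<integral>\<^sup>+x. ennreal (\<bar>r k x - h x\<bar> powr \<alpha>) \<partial>m))"
        by (subst nn_integral_cmult) (auto simp: nn_integral_add)
      finally show "(\<integral>\<^sup>+x. ennreal (\<bar>(s k x - r k x) - (g x - h x)\<bar> powr \<alpha>) \<partial>m) \<le> \<dots>" .
    qed
    have "(\<lambda>k. ennreal (2 powr \<alpha>) * ((\<integral>\<^sup>+x. ennreal (\<bar>s k x - g x\<bar> powr \<alpha>) \<partial>m) + (\<integral>\<^sup>+x. ennreal (\<bar>r k x - h x\<bar> powr \<alpha>) \<partial>m)))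
       \<longlonglongrightarrow> ennreal (2 powr \<alpha>) * (0 + 0)"
      by (intro ennreal_tendsto_cmult tendsto_add s r) auto
    then show "(\<lambda>k. ennreal (2 powr \<alpha>) * ((\<integral>\<^sup>+x. ennreal (\<bar>s k x - g x\<bar> powr \<alpha>) \<partial>m) + (\<integral>\<^sup>+x. ennreal (\<bar>r k x - h x\<bar> powr \<alpha>) \<partial>m)))
       \<longlonglongrightarrow> 0" by simp
  qed simp
  moreover have "(\<lambda>k. prob {\<omega> \<in> space Q. \<epsilon> < \<bar>simple_stable_integral m M (\<lambda>x. s k x - r k x) \<omega> - (Z \<omega> - W \<omega>)\<bar>}) \<longlonglongrightarrow> 0"
    if \<epsilon>: "0 < \<epsilon>" for \<epsilon>
  proof (rule tendsto_sandwich[OF _ _ tendsto_const])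
    show "\<forall>\<^sub>F k in sequentially. prob {\<omega> \<in> space Q. \<epsilon> < \<bar>simple_stable_integral m M (\<lambda>x. s k x - r k x) \<omega> - (Z \<omega> - W \<omega>)\<bar>}
       \<le> prob {\<omega> \<in> space Q. \<epsilon> / 2 < \<bar>simple_stable_integral m M (s k) \<omega> - Z \<omega>\<bar>}
        + prob {\<omega> \<in> space Q. \<epsilon> / 2 < \<bar>simple_stable_integral m M (r k) \<omega> - W \<omega>\<bar>}"
    proof (intro always_eventually allI)
      fix k
      have "prob {\<omega> \<in> space Q. \<epsilon> < \<bar>simple_stable_integral m M (\<lambda>x. s k x - r k x) \<omega> - (Z \<omega> - W \<omega>)\<bar>}
          \<le> prob ({\<omega> \<in> space Q. \<epsilon> / 2 < \<bar>simple_stable_integral m M (s k) \<omega> - Z \<omega>\<bar>}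
            \<union> {\<omega> \<in> space Q. \<epsilon> / 2 < \<bar>simple_stable_integral m M (r k) \<omega> - W \<omega>\<bar>})"
        using AE_simple_stable_integral_diff[OF s(1) r(1), of k k]
      proof (intro finite_measure_mono_AE, elim eventually_mono, intro impI)
        fix \<omega>
        assume "simple_stable_integral m M (\<lambda>x. s k x - r k x) \<omega>
            = simple_stable_integral m M (s k) \<omega> - simple_stable_integral m M (r k) \<omega>"
          "\<omega> \<in> {\<omega> \<in> space Q. \<epsilon> < \<bar>simple_stable_integral m M (\<lambda>x. s k x - r k x) \<omega> - (Z \<omega> - W \<omega>)\<bar>}"
        then show "\<omega> \<in> {\<omega> \<in> space Q. \<epsilon> / 2 < \<bar>simple_stable_integral m M (s k) \<omega> - Z \<omega>\<bar>}
            \<union> {\<omega> \<in> space Q. \<epsilon> / 2 < \<bar>simple_stable_integral m M (r k) \<omega> - W \<omega>\<bar>}"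
          unfolding mem_Collect_eq Un_iff by linarith
      qed auto
      also have "\<dots> \<le> prob {\<omega> \<in> space Q. \<epsilon> / 2 < \<bar>simple_stable_integral m M (s k) \<omega> - Z \<omega>\<bar>}
        + prob {\<omega> \<in> space Q. \<epsilon> / 2 < \<bar>simple_stable_integral m M (r k) \<omega> - W \<omega>\<bar>}"
        by (intro measure_Un_le) auto
      finally show "prob {\<omega> \<in> space Q. \<epsilon> < \<bar>simple_stable_integral m M (\<lambda>x. s k x - r k x) \<omega> - (Z \<omega> - W \<omega>)\<bar>} \<le> \<dots>" .
    qed
    show "(\<lambda>k. prob {\<omega> \<in> space Q. \<epsilon> / 2 < \<bar>simple_stable_integral m M (s k) \<omega> - Z \<omega>\<bar>}
        + prob {\<omega> \<in> space Q. \<epsilon> / 2 < \<bar>simple_stable_integral m M (r k) \<omega> - W \<omega>\<bar>}) \<longlonglongrightarrow> 0"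
      using tendsto_add[OF s(3) r(3), of "\<epsilon> / 2" "\<epsilon> / 2"] \<epsilon> by simp
  qed simp
  ultimately show ?thesis
    unfolding has_stable_integral_def using sr unfolding finite_simple_def
    by (intro conjI exI[of _ "\<lambda>k x. s k x - r k x"]) auto
qed

text \<open>
  The law of the integral controls the norm of the kernel: the characteristic functions of the
  approximating simple integrals converge, and their exponents are the norms of the
  approximating kernels.  An inequality up to constants suffices; it is used to
  bound the norms of all lattice increments uniformly, since these increments have the same law.
\<close>

lemma stable_norm_le_of_char:
  assumes Z: "has_stable_integral \<alpha> m Q M g Z"
    and char: "char (distr Q borel Z) 1 = complex_of_real (exp (- \<tau>))"
  shows "(\<integral>\<^sup>+x. ennreal (\<bar>g x\<bar> powr \<alpha>) \<partial>m) \<le> ennreal (2 powr \<alpha> * (\<tau> + 1))"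
proof -
  have [measurable]: "g \<in> borel_measurable m" "Z \<in> borel_measurable Q"
    using Z by (auto simp: has_stable_integral_def L_space_def)
  obtain s where s: "\<And>k. finite_simple m (s k)"
    "(\<lambda>k. \<integral>\<^sup>+x. ennreal (\<bar>s k x - g x\<bar> powr \<alpha>) \<partial>m) \<longlonglongrightarrow> 0"
    "\<And>\<epsilon>. 0 < \<epsilon> \<Longrightarrow> (\<lambda>k. prob {\<omega> \<in> space Q. \<epsilon> < \<bar>simple_stable_integral m M (s k) \<omega> - Z \<omega>\<bar>}) \<longlonglongrightarrow> 0"
    using stable_integralE[OF Z] by blast
  have [measurable]: "s k \<in> borel_measurable m" for k
    using s(1) by (auto simp: finite_simple_def intro: borel_measurable_simple_function)
  obtain \<sigma> where \<sigma>: "\<And>k. 0 \<le> \<sigma> k" "\<And>k. (\<integral>\<^sup>+x. ennreal (\<bar>s k x\<bar> powr \<alpha>) \<partial>m) = ennreal (\<sigma> k)"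
    "\<And>k. char (distr Q borel (simple_stable_integral m M (s k))) 1 = complex_of_real (exp (- \<sigma> k))"
  proof -
    have "\<forall>k. \<exists>c. 0 \<le> c \<and> (\<integral>\<^sup>+x. ennreal (\<bar>s k x\<bar> powr \<alpha>) \<partial>m) = ennreal c \<and>
        char (distr Q borel (simple_stable_integral m M (s k))) 1 = complex_of_real (exp (- c))"
      using simple_stable_integral_char[OF s(1)] by blast
    then show ?thesis using that unfolding choice_iff by blast
  qed
  have "(\<lambda>k. char (distr Q borel (simple_stable_integral m M (s k))) 1) \<longlonglongrightarrow> char (distr Q borel Z) 1"
    by (intro char_tendsto_of_tendsto_in_prob simple_stable_integral_measurable s) auto
  then have "(\<lambda>k. exp (- \<sigma> k)) \<longlonglongrightarrow> exp (- \<tau>)"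
    using tendsto_of_real_iff by (fastforce simp: \<sigma> char)
  then have "\<forall>\<^sub>F k in sequentially. exp (- (\<tau> + 1/2)) < exp (- \<sigma> k)"
    by (rule order_tendstoD) simp
  moreover have "\<forall>\<^sub>F k in sequentially. (\<integral>\<^sup>+x. ennreal (\<bar>s k x - g x\<bar> powr \<alpha>) \<partial>m) < ennreal (1/2)"
    by (rule order_tendstoD[OF s(2)], subst ennreal_less_zero_iff) simp
  ultimately have "\<forall>\<^sub>F k in sequentially. exp (- (\<tau> + 1/2)) < exp (- \<sigma> k)
      \<and> (\<integral>\<^sup>+x. ennreal (\<bar>s k x - g x\<bar> powr \<alpha>) \<partial>m) < ennreal (1/2)"
    by (rule eventually_conj)
  then obtain k where "exp (- (\<tau> + 1/2)) < exp (- \<sigma> k)"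
      and k2: "(\<integral>\<^sup>+x. ennreal (\<bar>s k x - g x\<bar> powr \<alpha>) \<partial>m) < ennreal (1/2)"
    unfolding eventually_sequentially by blast
  then have k: "\<sigma> k < \<tau> + 1/2" "(\<integral>\<^sup>+x. ennreal (\<bar>s k x - g x\<bar> powr \<alpha>) \<partial>m) < ennreal (1/2)"
    by auto
  have "(\<integral>\<^sup>+x. ennreal (\<bar>g x\<bar> powr \<alpha>) \<partial>m)
      \<le> ennreal (2 powr \<alpha>) * (ennreal (\<sigma> k) + (\<integral>\<^sup>+x. ennreal (\<bar>s k x - g x\<bar> powr \<alpha>) \<partial>m))"
    using nn_integral_powr_le_approx[OF \<alpha>_pos, of g m "s k"] by (simp add: \<sigma>)
  also have "\<dots> \<le> ennreal (2 powr \<alpha>) * (ennreal (\<tau> + 1/2) + ennreal (1/2))"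
    using k by (intro mult_left_mono add_mono ennreal_leI) auto
  also have "\<dots> = ennreal (2 powr \<alpha> * (\<tau> + 1))"
  proof -
    have \<tau>: "0 \<le> \<tau> + 1/2" using k(1) \<sigma>(1)[of k] by linarith
    have "ennreal (\<tau> + 1/2) + ennreal (1/2) = ennreal (\<tau> + 1)"
      using ennreal_plus[OF \<tau>, of "1/2", symmetric] by (simp only: add.assoc) simp
    then show ?thesis by (simp only: ennreal_mult'[symmetric] powr_ge_zero)
  qed
  finally show ?thesis .
qed

text \<open>
  Eventually the approximating simple kernels satisfy the hypotheses with \<open>B\<close> and \<open>V\<close> enlarged by
  the factor \<open>2 powr (\<alpha> + 1)\<close>, and the error made in each of the finitely many integrals
  exceeds \<open>x / 2\<close> with vanishing probability.
\<close>

lemma max_stable_integral_tail: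
  assumes "finite F" "F \<noteq> {}" and Z: "\<And>t. t \<in> F \<Longrightarrow> has_stable_integral \<alpha> m Q M (g t) (Z t)"
    and "0 < x" "0 < L" "0 < V" "0 < B"
    and B: "(\<integral>\<^sup>+x. ennreal (Max ((\<lambda>t. \<bar>g t x\<bar> powr \<alpha>) ` F)) \<partial>m) \<le> ennreal B"
    and V: "\<And>t. t \<in> F \<Longrightarrow> (\<integral>\<^sup>+x. ennreal (\<bar>g t x\<bar> powr \<alpha>) \<partial>m) \<le> ennreal V"
  shows "prob {\<omega> \<in> space Q. \<exists>t\<in>F. 2 * x \<le> \<bar>Z t \<omega>\<bar>}
      \<le> stable_const \<alpha> * (2 powr (\<alpha> + 1) * B) / L powr \<alpha>
        + card F * (2 * exp 1 * (stable_const \<alpha> * (2 powr (\<alpha> + 1) * V) / L powr \<alpha>) powr (x / (2 * L)))"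
    (is "?p \<le> ?R")
proof -
  have g_meas[measurable]: "t \<in> F \<Longrightarrow> g t \<in> borel_measurable m" "t \<in> F \<Longrightarrow> Z t \<in> borel_measurable Q" for t
    using Z by (auto simp: has_stable_integral_def L_space_def)
  have "\<forall>t\<in>F. \<exists>s. (\<forall>k. finite_simple m (s k)) \<and>
    (\<lambda>k. \<integral>\<^sup>+x. ennreal (\<bar>s k x - g t x\<bar> powr \<alpha>) \<partial>m) \<longlonglongrightarrow> 0 \<and>
    (\<forall>\<epsilon>>0. (\<lambda>k. prob {\<omega> \<in> space Q. \<epsilon> < \<bar>simple_stable_integral m M (s k) \<omega> - Z t \<omega>\<bar>}) \<longlonglongrightarrow> 0)"
    using Z by (intro ballI) (erule stable_integralE[OF Z], blast)
  then obtain s where s: "\<And>t k. t \<in> F \<Longrightarrow> finite_simple m (s t k)"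
    "\<And>t. t \<in> F \<Longrightarrow> (\<lambda>k. \<integral>\<^sup>+x. ennreal (\<bar>s t k x - g t x\<bar> powr \<alpha>) \<partial>m) \<longlonglongrightarrow> 0"
    "\<And>t \<epsilon>. t \<in> F \<Longrightarrow> 0 < \<epsilon> \<Longrightarrow> (\<lambda>k. prob {\<omega> \<in> space Q. \<epsilon> < \<bar>simple_stable_integral m M (s t k) \<omega> - Z t \<omega>\<bar>}) \<longlonglongrightarrow> 0"
    unfolding bchoice_iff by blast
  have s_meas[measurable]: "t \<in> F \<Longrightarrow> s t k \<in> borel_measurable m" for t k
    using s(1) by (auto simp: finite_simple_def intro: borel_measurable_simple_function)
  have I_meas[measurable]: "t \<in> F \<Longrightarrow> simple_stable_integral m M (s t k) \<in> borel_measurable Q" for t k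
    by (intro simple_stable_integral_measurable s)
  define err where "err k = (\<Sum>t\<in>F. \<integral>\<^sup>+x. ennreal (\<bar>s t k x - g t x\<bar> powr \<alpha>) \<partial>m)" for k
  define bad where "bad t k = {\<omega> \<in> space Q. x / 2 < \<bar>simple_stable_integral m M (s t k) \<omega> - Z t \<omega>\<bar>}" for t k
  have bad_sets[measurable]: "t \<in> F \<Longrightarrow> bad t k \<in> sets Q" for t k unfolding bad_def by measurable
  have err_lim: "err \<longlonglongrightarrow> 0"
    unfolding err_def using tendsto_sum[of F "\<lambda>t k. \<integral>\<^sup>+x. ennreal (\<bar>s t k x - g t x\<bar> powr \<alpha>) \<partial>m" "\<lambda>_. 0"] s(2) by simp
  have bad_lim: "(\<lambda>k. \<Sum>t\<in>F. prob (bad t k)) \<longlonglongrightarrow> 0"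
    unfolding bad_def using tendsto_sum[of F "\<lambda>t k. prob (bad t k)" "\<lambda>_. 0"] s(3)[of _ "x / 2"] assms(4) by (simp add: bad_def)
  have pointwise: "\<bar>s t k y\<bar> powr \<alpha> \<le> 2 powr \<alpha> * (\<bar>g t y\<bar> powr \<alpha> + \<bar>s t k y - g t y\<bar> powr \<alpha>)" for t k y
    using powr_abs_add_le[OF \<alpha>_pos, of "g t y" "s t k y - g t y"] by simp
  have step: "?p \<le> ?R + (\<Sum>t\<in>F. prob (bad t k))" if err: "err k < ennreal (min B V)" for k
  proof -
    have errB: "err k \<le> ennreal B" "err k \<le> ennreal V"
      using err by (meson ennreal_leI less_imp_le min.cobounded1 min.cobounded2 order_trans)+
    have "(\<integral>\<^sup>+y. ennreal (Max ((\<lambda>t. \<bar>s t k y\<bar> powr \<alpha>) ` F)) \<partial>m)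
      \<le> (\<integral>\<^sup>+y. ennreal (2 powr \<alpha>) * (ennreal (Max ((\<lambda>t. \<bar>g t y\<bar> powr \<alpha>) ` F)) + (\<Sum>t\<in>F. ennreal (\<bar>s t k y - g t y\<bar> powr \<alpha>))) \<partial>m)"
    proof (intro nn_integral_mono)
      fix y
      have "Max ((\<lambda>t. \<bar>s t k y\<bar> powr \<alpha>) ` F)
          \<le> 2 powr \<alpha> * (Max ((\<lambda>t. \<bar>g t y\<bar> powr \<alpha>) ` F) + (\<Sum>t\<in>F. \<bar>s t k y - g t y\<bar> powr \<alpha>))"
      proof (rule Max.boundedI)
        fix a assume "a \<in> (\<lambda>t. \<bar>s t k y\<bar> powr \<alpha>) ` F"
        then obtain t where t: "t \<in> F" and a: "a = \<bar>s t k y\<bar> powr \<alpha>" by blast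
        have "\<bar>g t y\<bar> powr \<alpha> \<le> Max ((\<lambda>t. \<bar>g t y\<bar> powr \<alpha>) ` F)" using t assms(1) by auto
        moreover have "\<bar>s t k y - g t y\<bar> powr \<alpha> \<le> (\<Sum>t\<in>F. \<bar>s t k y - g t y\<bar> powr \<alpha>)"
          using t assms(1) by (intro member_le_sum) auto
        ultimately show "a \<le> 2 powr \<alpha> * (Max ((\<lambda>t. \<bar>g t y\<bar> powr \<alpha>) ` F) + (\<Sum>t\<in>F. \<bar>s t k y - g t y\<bar> powr \<alpha>))"
          unfolding a by (intro order_trans[OF pointwise] mult_left_mono add_mono) auto
      qed (use assms(1,2) in auto)
      moreover have "0 \<le> Max ((\<lambda>t. \<bar>g t y\<bar> powr \<alpha>) ` F)"
        using assms(1,2) by (subst Max_ge_iff) auto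
      ultimately show "ennreal (Max ((\<lambda>t. \<bar>s t k y\<bar> powr \<alpha>) ` F))
          \<le> ennreal (2 powr \<alpha>) * (ennreal (Max ((\<lambda>t. \<bar>g t y\<bar> powr \<alpha>) ` F)) + (\<Sum>t\<in>F. ennreal (\<bar>s t k y - g t y\<bar> powr \<alpha>)))"
        by (simp add: sum_ennreal sum_nonneg ennreal_plus[symmetric] ennreal_mult'[symmetric] ennreal_leI del: ennreal_plus)
    qed
    also have "\<dots> = ennreal (2 powr \<alpha>) * ((\<integral>\<^sup>+y. ennreal (Max ((\<lambda>t. \<bar>g t y\<bar> powr \<alpha>) ` F)) \<partial>m) + err k)"
    proof -
      have [measurable]: "(\<lambda>y. Max ((\<lambda>t. \<bar>g t y\<bar> powr \<alpha>) ` F)) \<in> borel_measurable m"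
        using assms(1) by (intro borel_measurable_Max) auto
      show ?thesis unfolding err_def
        by (subst nn_integral_cmult)
          (auto simp: nn_integral_add nn_integral_sum sum_nonneg simp del: sum_ennreal)
    qed
    also have "\<dots> \<le> ennreal (2 powr \<alpha>) * (ennreal B + ennreal B)"
      using B errB by (intro mult_left_mono add_mono) auto
    also have "\<dots> = ennreal (2 powr (\<alpha> + 1) * B)"
      using assms(7) by (simp add: ennreal_plus[symmetric] ennreal_mult'[symmetric] powr_add del: ennreal_plus)
    finally have sB: "(\<integral>\<^sup>+y. ennreal (Max ((\<lambda>t. \<bar>s t k y\<bar> powr \<alpha>) ` F)) \<partial>m) \<le> ennreal (2 powr (\<alpha> + 1) * B)" .
    have sV: "(\<integral>\<^sup>+y. ennreal (\<bar>s t k y\<bar> powr \<alpha>) \<partial>m) \<le> ennreal (2 powr (\<alpha> + 1) * V)" if t: "t \<in> F" for t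
    proof -
      have "(\<integral>\<^sup>+y. ennreal (\<bar>g t y - s t k y\<bar> powr \<alpha>) \<partial>m) \<le> err k"
        unfolding err_def using t assms(1) member_le_sum[of t F "\<lambda>t. \<integral>\<^sup>+x. ennreal (\<bar>s t k x - g t x\<bar> powr \<alpha>) \<partial>m"]
        by (simp add: abs_minus_commute)
      then have "(\<integral>\<^sup>+y. ennreal (\<bar>s t k y\<bar> powr \<alpha>) \<partial>m) \<le> ennreal (2 powr \<alpha>) * (ennreal V + ennreal V)"
        using t V[OF t] errB(2)
        by (intro order_trans[OF nn_integral_powr_le_approx[OF \<alpha>_pos, of "s t k" m "g t"]] mult_left_mono add_mono) auto
      also have "\<dots> = ennreal (2 powr (\<alpha> + 1) * V)"
        using assms(6) by (simp add: ennreal_plus[symmetric] ennreal_mult'[symmetric] powr_add del: ennreal_plus)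
      finally show ?thesis .
    qed
    have "prob {\<omega> \<in> space Q. \<exists>t\<in>F. x \<le> \<bar>simple_stable_integral m M (s t k) \<omega>\<bar>} \<le> ?R"
      by (rule max_simple_stable_integral_tail[OF assms(1,2) s(1) assms(4,5) _ _ sB sV])
        (use assms in auto)
    moreover have "?p \<le> prob ({\<omega> \<in> space Q. \<exists>t\<in>F. x \<le> \<bar>simple_stable_integral m M (s t k) \<omega>\<bar>} \<union> (\<Union>t\<in>F. bad t k))"
    proof (rule finite_measure_mono)
      show "{\<omega> \<in> space Q. \<exists>t\<in>F. 2 * x \<le> \<bar>Z t \<omega>\<bar>}
          \<subseteq> {\<omega> \<in> space Q. \<exists>t\<in>F. x \<le> \<bar>simple_stable_integral m M (s t k) \<omega>\<bar>} \<union> (\<Union>t\<in>F. bad t k)"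
      proof
        fix \<omega> assume "\<omega> \<in> {\<omega> \<in> space Q. \<exists>t\<in>F. 2 * x \<le> \<bar>Z t \<omega>\<bar>}"
        then obtain t where t: "\<omega> \<in> space Q" "t \<in> F" "2 * x \<le> \<bar>Z t \<omega>\<bar>" by blast
        then have "x \<le> \<bar>simple_stable_integral m M (s t k) \<omega>\<bar> \<or> \<omega> \<in> bad t k"
          using assms(4) unfolding bad_def mem_Collect_eq by linarith
        then show "\<omega> \<in> {\<omega> \<in> space Q. \<exists>t\<in>F. x \<le> \<bar>simple_stable_integral m M (s t k) \<omega>\<bar>} \<union> (\<Union>t\<in>F. bad t k)"
          using t by blast
      qed
    next
      show "{\<omega> \<in> space Q. \<exists>t\<in>F. x \<le> \<bar>simple_stable_integral m M (s t k) \<omega>\<bar>} \<union> (\<Union>t\<in>F. bad t k) \<in> events"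
        using assms(1) by (intro sets.Un sets.finite_UN bad_sets) measurable
    qed
    moreover have "\<dots> \<le> prob {\<omega> \<in> space Q. \<exists>t\<in>F. x \<le> \<bar>simple_stable_integral m M (s t k) \<omega>\<bar>} + prob (\<Union>t\<in>F. bad t k)"
      using assms(1) by (intro measure_Un_le) auto
    moreover have "prob (\<Union>t\<in>F. bad t k) \<le> (\<Sum>t\<in>F. prob (bad t k))"
      using assms(1) by (intro finite_measure_subadditive_finite) auto
    ultimately show ?thesis by linarith
  qed
  have "\<forall>\<^sub>F k in sequentially. err k < ennreal (min B V)"
    using assms(6,7) by (intro order_tendstoD(2)[OF err_lim]) auto
  then have "\<forall>\<^sub>F k in sequentially. ?p \<le> ?R + (\<Sum>t\<in>F. prob (bad t k))"
    using step by (rule eventually_mono)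
  moreover have "(\<lambda>k. ?R + (\<Sum>t\<in>F. prob (bad t k))) \<longlonglongrightarrow> ?R + 0"
    by (intro tendsto_add tendsto_const bad_lim)
  ultimately show ?thesis
    using tendsto_lowerbound[of "\<lambda>k. ?R + (\<Sum>t\<in>F. prob (bad t k))" "?R + 0" sequentially ?p] by simp
qed

end

section \<open>Chaining along dyadic points\<close>

definition index_box :: "int \<Rightarrow> (int^'d) set" where
  "index_box b = {k. \<forall>i. 0 \<le> k $ i \<and> k $ i \<le> b}"

text \<open>
  The shift by \<open>1\<close> lets nonnegative indices describe a cube that contains the unit cube in
  its interior: \<open>index_box (2^(n + 2))\<close> is the grid of mesh \<open>2^(-n)\<close> in \<open>[-1, 3]\<close>.
\<close>

definition dyadic_point :: "nat \<Rightarrow> int^'d \<Rightarrow> real^'d" where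
  "dyadic_point n k = (1 / 2^n) *\<^sub>R of_int_vec k - 1"

lemma dyadic_point_nth: "dyadic_point n k $ i = real_of_int (k $ i) / 2^n - 1"
  by (simp add: dyadic_point_def of_int_vec_def)

definition coarsen :: "nat \<Rightarrow> int^'d \<Rightarrow> int^'d" where
  "coarsen j k = (\<chi> i. k $ i div 2^j)"

lemma coarsen_0 [simp]: "coarsen 0 k = k"
  by (simp add: coarsen_def vec_eq_iff)

lemma coarsen_index_box:
  assumes "k \<in> index_box (2^(n + j + 2))"
  shows "coarsen j k \<in> index_box (2^(n + 2))"
proof -
  have "k $ i div 2^j \<le> 2^(n + 2)" for i
  proof -
    have "k $ i div 2^j \<le> 2^(n + j + 2) div 2^j"
      using assms by (intro zdiv_mono1) (auto simp: index_box_def)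
    also have "\<dots> = (2^(n + 2) :: int)"
      by (simp add: power_add mult_ac)
    finally show ?thesis .
  qed
  then show ?thesis using assms by (auto simp: index_box_def coarsen_def pos_imp_zdiv_nonneg_iff)
qed

text \<open>
  Dropping one binary digit from each coordinate: the dropped digits form a vector with entries
  \<open>0\<close> and \<open>1\<close>.
\<close>

lemma coarsen_Suc:
  obtains v where "v \<in> insert 0 directions" "coarsen j k = v + 2 * coarsen (Suc j) k"
proof
  let ?v = "\<chi> i. (k $ i div 2^j) mod 2"
  show "?v \<in> insert 0 directions"
    using pos_mod_bound[of 2] pos_mod_sign[of 2] by (auto simp: directions_def)
  have "k $ i div 2 ^ Suc j = k $ i div 2^j div 2" for i
    by (subst power_Suc2, rule zdiv_zmult2_eq) simp
  then show "coarsen j k = ?v + 2 * coarsen (Suc j) k"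
    by (simp add: vec_eq_iff coarsen_def del: power_Suc)
qed

lemma dyadic_point_double: "dyadic_point (Suc n) (2 * k) = dyadic_point n k"
  by (simp add: vec_eq_iff dyadic_point_nth)

text \<open>
  Two points at distance at most \<open>2^(-n)\<close> have equal or adjacent ancestors at level \<open>n\<close>.
\<close>

lemma coarsen_diff:
  assumes "\<And>i. \<bar>a $ i - b $ i\<bar> \<le> 2^j"
  shows "coarsen j a - coarsen j b \<in> insert 0 directions"
proof -
  have "\<bar>a $ i div 2^j - b $ i div 2^j\<bar> \<le> 1" for i
  proof -
    have "a $ i \<le> b $ i + 1 * 2^j" "b $ i \<le> a $ i + 1 * 2^j"
      using assms[of i] by linarith+
    then have "a $ i div 2^j \<le> (b $ i + 1 * 2^j) div 2^j" "b $ i div 2^j \<le> (a $ i + 1 * 2^j) div 2^j"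
      by (intro zdiv_mono1; simp)+
    moreover have "(a $ i + 1 * 2^j) div 2^j = a $ i div 2^j + 1" "(b $ i + 1 * 2^j) div 2^j = b $ i div 2^j + 1"
      by simp_all
    ultimately show ?thesis by linarith
  qed
  then show ?thesis by (auto simp: directions_def coarsen_def abs_le_iff) (smt (verit))
qed

definition max_level_increment_le :: "(real^'d \<Rightarrow> real) \<Rightarrow> nat \<Rightarrow> real \<Rightarrow> bool" where
  "max_level_increment_le x n \<delta> \<longleftrightarrow>
     (\<forall>v\<in>directions. \<forall>k\<in>index_box (2^(n + 2)).
        \<bar>x (dyadic_point n (v + k)) - x (dyadic_point n k)\<bar> \<le> \<delta>)"

lemma chaining_to_coarse:
  fixes x :: "real^'d \<Rightarrow> real"
  assumes "\<And>j. n < j \<Longrightarrow> j \<le> n + l \<Longrightarrow> max_level_increment_le x j (\<delta> j) \<and> 0 \<le> \<delta> j"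
    and "k \<in> index_box (2^(n + l + 2))"
  shows "\<bar>x (dyadic_point (n + l) k) - x (dyadic_point n (coarsen l k))\<bar> \<le> (\<Sum>j\<in>{n<..n + l}. \<delta> j)"
  using assms
proof (induction l arbitrary: k)
  case 0
  then show ?case by simp
next
  case (Suc l)
  let ?c = "coarsen 1 k"
  obtain v where v: "v \<in> insert 0 directions" "coarsen 0 k = v + 2 * coarsen (Suc 0) k"
    by (rule coarsen_Suc)
  have c: "?c \<in> index_box (2^(n + l + 2))"
    using Suc.prems(2) by (intro coarsen_index_box) simp
  then have c2: "2 * ?c \<in> index_box (2^(n + Suc l + 2))" by (auto simp: index_box_def)
  have "\<bar>x (dyadic_point (n + Suc l) k) - x (dyadic_point (n + l) ?c)\<bar> \<le> \<delta> (n + Suc l)"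
  proof -
    have "\<bar>x (dyadic_point (n + Suc l) (v + 2 * ?c)) - x (dyadic_point (n + Suc l) (2 * ?c))\<bar> \<le> \<delta> (n + Suc l)"
      using Suc.prems(1)[of "n + Suc l"] v(1) c2 by (auto simp: max_level_increment_le_def)
    then show ?thesis using v(2) by (simp add: dyadic_point_double)
  qed
  moreover have "\<bar>x (dyadic_point (n + l) ?c) - x (dyadic_point n (coarsen l ?c))\<bar> \<le> (\<Sum>j\<in>{n<..n + l}. \<delta> j)"
    using Suc.prems(1) c by (intro Suc.IH) auto
  moreover have "coarsen l ?c = coarsen (Suc l) k"
    by (simp add: vec_eq_iff coarsen_def zdiv_zmult2_eq)
  moreover have "{n<..n + Suc l} = insert (n + Suc l) {n<..n + l}" by auto
  ultimately show ?case by simp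
qed

text \<open>
  Both points are joined to their ancestors at level \<open>n\<close>, at the cost of one increment per
  level, and the ancestors are equal or neighbours.
\<close>

lemma chaining:
  fixes x :: "real^'d \<Rightarrow> real"
  assumes level: "\<And>j. n \<le> j \<Longrightarrow> max_level_increment_le x j (\<delta> j) \<and> 0 \<le> \<delta> j"
    and "summable \<delta>"
    and a: "a \<in> index_box (2^(n + l + 2))" and b: "b \<in> index_box (2^(n + l + 2))"
    and "\<And>i. \<bar>a $ i - b $ i\<bar> \<le> 2^l"
  shows "\<bar>x (dyadic_point (n + l) a) - x (dyadic_point (n + l) b)\<bar> \<le> 2 * (\<Sum>j. \<delta> (j + n))"
proof -
  have sum: "summable (\<lambda>j. \<delta> (j + n))" using assms(2) by (simp add: summable_iff_shift)
  let ?S = "\<Sum>j\<in>{n<..n + l}. \<delta> j"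
  have "\<bar>x (dyadic_point (n + l) k) - x (dyadic_point n (coarsen l k))\<bar> \<le> ?S" if "k \<in> index_box (2^(n + l + 2))" for k
    using level that by (intro chaining_to_coarse) auto
  note this[OF a] this[OF b]
  moreover have "\<bar>x (dyadic_point n (coarsen l a)) - x (dyadic_point n (coarsen l b))\<bar> \<le> \<delta> n"
  proof -
    have "coarsen l a - coarsen l b \<in> insert 0 directions" by (rule coarsen_diff) fact
    moreover have "coarsen l b \<in> index_box (2^(n + 2))" using b by (rule coarsen_index_box)
    moreover have "\<forall>v\<in>insert 0 directions. \<forall>k\<in>index_box (2^(n + 2)).
        \<bar>x (dyadic_point n (v + k)) - x (dyadic_point n k)\<bar> \<le> \<delta> n"
      using level[of n] by (auto simp: max_level_increment_le_def)
    ultimately have "\<bar>x (dyadic_point n ((coarsen l a - coarsen l b) + coarsen l b)) - x (dyadic_point n (coarsen l b))\<bar> \<le> \<delta> n"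
      by blast
    then show ?thesis by simp
  qed
  moreover have "?S + \<delta> n \<le> (\<Sum>j. \<delta> (j + n))"
  proof -
    have "?S + \<delta> n = (\<Sum>j\<in>{n..n + l}. \<delta> j)"
      by (simp add: sum.head add.commute)
    also have "\<dots> = (\<Sum>j\<in>{..l}. \<delta> (j + n))"
      using sum.shift_bounds_cl_nat_ivl[of \<delta> 0 n l] by (simp add: atMost_atLeast0 add.commute)
    also have "\<dots> \<le> (\<Sum>j. \<delta> (j + n))"
      using level by (intro sum_le_suminf sum) auto
    finally show ?thesis .
  qed
  moreover have "0 \<le> \<delta> n" using level[of n] by simp
  ultimately show ?thesis by linarith
qed

definition chain_const :: "real \<Rightarrow> real \<Rightarrow> real" where
  "chain_const \<beta> q = (\<Sum>j. real (Suc j) powr q * 2 powr (- (\<beta> * real j)))"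

lemma summable_chain:
  assumes "0 < \<beta>"
  shows "summable (\<lambda>j. real (Suc j) powr q * 2 powr (- (\<beta> * real j)))"
proof (rule summable_comparison_test_bigo)
  show "summable (\<lambda>j. norm ((2 powr (- \<beta> / 2)) ^ j))"
    using assms by (auto intro!: summable_geometric simp: powr_less_one)
  show "(\<lambda>j. real (Suc j) powr q * 2 powr (- (\<beta> * real j))) \<in> O(\<lambda>j. (2 powr (- \<beta> / 2)) ^ j)"
    using assms by real_asymp
qed

text \<open>
  Since \<open>j + n \<le> (j + 1) * n\<close>, the tail of the series is dominated by its first term.
\<close>

lemma chain_tail_le:
  assumes "0 < \<beta>" "0 \<le> q" "1 \<le> n"
  shows "summable (\<lambda>j. real j powr q * 2 powr (- (\<beta> * real j)))"
    and "(\<Sum>j. real (j + n) powr q * 2 powr (- (\<beta> * real (j + n))))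
      \<le> chain_const \<beta> q * (real n powr q * 2 powr (- (\<beta> * real n)))"
proof -
  let ?f = "\<lambda>j. real j powr q * 2 powr (- (\<beta> * real j))"
  let ?g = "\<lambda>j. real (Suc j) powr q * 2 powr (- (\<beta> * real j))"
  note g = summable_chain[OF assms(1), of q]
  show f: "summable ?f"
  proof (rule summable_comparison_test'[OF g])
    fix j :: nat
    show "norm (?f j) \<le> ?g j" using assms(2) by (auto intro!: powr_mono2)
  qed
  have le: "?f (j + n) \<le> ?g j * ?f n" for j
  proof -
    have "1 * j \<le> n * j" using assms(3) by (intro mult_right_mono) auto
    then have "j + n \<le> Suc j * n" by simp
    then have "real (j + n) \<le> real (Suc j) * real n" by (metis of_nat_le_iff of_nat_mult)
    then have "real (j + n) powr q \<le> real (Suc j) powr q * real n powr q"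
      using assms(2) powr_mono2[of q "real (j + n)" "real (Suc j) * real n"] by (simp add: powr_mult)
    moreover have "2 powr (- (\<beta> * real (j + n))) = 2 powr (- (\<beta> * real j)) * 2 powr (- (\<beta> * real n))"
      by (simp add: powr_add[symmetric] algebra_simps)
    ultimately show ?thesis
      using mult_right_mono[of "real (j + n) powr q" "real (Suc j) powr q * real n powr q"
        "2 powr (- (\<beta> * real j)) * 2 powr (- (\<beta> * real n))"] by (simp add: mult_ac)
  qed
  have "(\<Sum>j. ?f (j + n)) \<le> (\<Sum>j. ?g j * ?f n)"
    using summable_iff_shift[of ?f n] f g by (intro suminf_le le summable_mult2) auto
  also have "\<dots> = chain_const \<beta> q * ?f n"
    unfolding chain_const_def by (rule suminf_mult2[OF g, symmetric])
  finally show "(\<Sum>j. ?f (j + n)) \<le> chain_const \<beta> q * ?f n" .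
qed

lemma dyadic_point_refine: "dyadic_point (n + l) (\<chi> i. 2^l * k $ i) = dyadic_point n k"
  by (simp add: vec_eq_iff dyadic_point_nth power_add)

definition dyadic_floor :: "nat \<Rightarrow> real^'d \<Rightarrow> int^'d" where
  "dyadic_floor n s = (\<chi> i. \<lfloor>2^n * (s $ i + 1)\<rfloor>)"

lemma dyadic_floor_bounds:
  fixes s :: "real^'d"
  shows "dyadic_point n (dyadic_floor n s) $ i \<le> s $ i"
  and "s $ i - dyadic_point n (dyadic_floor n s) $ i \<le> 1 / 2^n"
proof -
  have "real_of_int \<lfloor>2^n * (s $ i + 1)\<rfloor> \<le> 2^n * (s $ i + 1)" "2^n * (s $ i + 1) \<le> real_of_int \<lfloor>2^n * (s $ i + 1)\<rfloor> + 1"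
    by linarith+
  then have "real_of_int \<lfloor>2^n * (s $ i + 1)\<rfloor> / 2^n \<le> 2^n * (s $ i + 1) / 2^n"
      "2^n * (s $ i + 1) / 2^n \<le> (real_of_int \<lfloor>2^n * (s $ i + 1)\<rfloor> + 1) / 2^n"
    by (intro divide_right_mono; simp)+
  then show "dyadic_point n (dyadic_floor n s) $ i \<le> s $ i"
      "s $ i - dyadic_point n (dyadic_floor n s) $ i \<le> 1 / 2^n"
    by (simp_all add: dyadic_point_nth dyadic_floor_def add_divide_distrib)
qed

lemma dyadic_floor_index_box:
  assumes "\<And>i. -1 \<le> s $ i \<and> s $ i \<le> 3"
  shows "dyadic_floor n s \<in> index_box (2^(n + 2))"
proof -
  have "\<lfloor>2^n * (s $ i + 1)\<rfloor> \<le> 2^(n + 2)" "0 \<le> \<lfloor>2^n * (s $ i + 1)\<rfloor>" for i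
  proof -
    have "2^n * (s $ i + 1) \<le> 2^n * 4" using assms[of i] by (intro mult_left_mono) auto
    then have "2^n * (s $ i + 1) \<le> real_of_int (2^(n + 2))" by (simp add: power_add)
    then show "\<lfloor>2^n * (s $ i + 1)\<rfloor> \<le> 2^(n + 2)" by (metis floor_mono floor_of_int)
    show "0 \<le> \<lfloor>2^n * (s $ i + 1)\<rfloor>" using assms[of i] by simp
  qed
  then show ?thesis by (simp add: index_box_def dyadic_floor_def)
qed

text \<open>
  Points of different levels are regarded as points of a common finer grid.
\<close>

lemma dyadic_modulus:
  fixes x :: "real^'d \<Rightarrow> real"
  assumes level: "\<And>j. n \<le> j \<Longrightarrow> max_level_increment_le x j (\<delta> j) \<and> 0 \<le> \<delta> j"
    and "summable \<delta>"
    and a: "a \<in> index_box (2^(k + 2))" and b: "b \<in> index_box (2^(k' + 2))"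
    and close: "\<And>i. \<bar>dyadic_point k a $ i - dyadic_point k' b $ i\<bar> \<le> 1 / 2^n"
  shows "\<bar>x (dyadic_point k a) - x (dyadic_point k' b)\<bar> \<le> 2 * (\<Sum>j. \<delta> (j + n))"
proof -
  (* level n + l is finer than the levels n, k and k' *)
  define l where "l = k + k'"
  have refine: "(\<chi> i. 2^r * c $ i) \<in> index_box (2^(n' + r + 2))" if "c \<in> index_box (2^(n' + 2))" for c :: "int^'d" and n' r :: nat
    using that by (auto simp: index_box_def power_add mult_ac)
  define a' where "a' = (\<chi> i. 2^(n + k') * a $ i)"
  define b' where "b' = (\<chi> i. 2^(n + k) * b $ i)"
  have pa: "dyadic_point (n + l) a' = dyadic_point k a"
    using dyadic_point_refine[of k "n + k'" a] by (simp add: a'_def l_def ac_simps)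
  have pb: "dyadic_point (n + l) b' = dyadic_point k' b"
    using dyadic_point_refine[of k' "n + k" b] by (simp add: b'_def l_def ac_simps)
  have "a' \<in> index_box (2^(n + l + 2))" "b' \<in> index_box (2^(n + l + 2))"
    using refine[OF a, of "n + k'"] refine[OF b, of "n + k"] by (simp_all add: a'_def b'_def l_def ac_simps)
  moreover have "\<bar>a' $ i - b' $ i\<bar> \<le> 2^l" for i
  proof -
    have "\<bar>dyadic_point (n + l) a' $ i - dyadic_point (n + l) b' $ i\<bar> \<le> 1 / 2^n"
      unfolding pa pb by (rule close)
    then have "\<bar>(real_of_int (a' $ i) - real_of_int (b' $ i)) / 2^(n + l)\<bar> \<le> 1 / 2^n"
      by (simp add: dyadic_point_nth diff_divide_distrib)
    then have "\<bar>real_of_int (a' $ i) - real_of_int (b' $ i)\<bar> \<le> 2^l"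
      by (simp add: power_add abs_divide field_simps)
    then have "real_of_int \<bar>a' $ i - b' $ i\<bar> \<le> real_of_int (2^l)" by simp
    then show ?thesis by (simp only: of_int_le_iff)
  qed
  ultimately show ?thesis
    using chaining[OF level assms(2), of n a' l b'] by (simp add: pa pb)
qed

text \<open>
  Three steps of size \<open>2 * (\<Sum>j. \<delta> (j + n))\<close>.  Nearby points of \<open>S\<close> are compared through their dyadic
  approximations.  Around \<open>t\<close> there is a small ball in which all values at points of \<open>S\<close> differ by at
  most one such step, and separability extends this to \<open>t\<close> itself; the same is done at \<open>s\<close>,
  and the two balls are close enough to compare their points of \<open>S\<close>.
\<close>

lemma separable_modulus:
  fixes x :: "real^'d \<Rightarrow> real"
  assumes level: "\<And>j. n \<le> j \<Longrightarrow> max_level_increment_le x j (\<delta> j) \<and> 0 \<le> \<delta> j"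
    and sum: "summable \<delta>"
    and approx: "\<And>s \<epsilon> K. s \<in> S \<Longrightarrow> 0 < \<epsilon> \<Longrightarrow> \<exists>k\<ge>K. \<bar>x s - x (dyadic_point k (dyadic_floor k s))\<bar> \<le> \<epsilon>"
    and sep: "\<And>G F. open G \<Longrightarrow> closed F \<Longrightarrow> \<forall>t\<in>G \<inter> S. x t \<in> F \<Longrightarrow> \<forall>t\<in>G. x t \<in> F"
    and s: "s \<in> cbox 0 1" and t: "t \<in> cbox 0 1" and h: "infnorm (s - t) < 1 / 2^n"
  shows "\<bar>x t - x s\<bar> \<le> 6 * (\<Sum>j. \<delta> (j + n))"
proof -
  define w where "w = 2 * (\<Sum>j. \<delta> (j + n))"
  have S_close: "\<bar>x p - x q\<bar> \<le> w"
    if pq: "p \<in> S" "q \<in> S" and box: "\<And>i. -1 \<le> p $ i \<and> p $ i \<le> 3" "\<And>i. -1 \<le> q $ i \<and> q $ i \<le> 3"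
      and close: "\<And>i. \<bar>p $ i - q $ i\<bar> < 1 / 2^n" for p q
  proof (rule field_le_epsilon)
    fix \<epsilon> :: real assume \<epsilon>: "0 < \<epsilon>"
    have "\<forall>\<^sub>F K in sequentially. \<forall>i. (1/2)^K < (1 / 2^n - \<bar>p $ i - q $ i\<bar>) / 2"
    proof (intro eventually_all_finite order_tendstoD(2)[OF LIMSEQ_realpow_zero])
      show "0 < (1 / 2^n - \<bar>p $ i - q $ i\<bar>) / 2" for i using close[of i] by simp
    qed auto
    then obtain K where K: "\<And>k i. K \<le> k \<Longrightarrow> (1/2)^k < (1 / 2^n - \<bar>p $ i - q $ i\<bar>) / 2"
      by (auto simp: eventually_sequentially)
    obtain k where k: "K \<le> k" "\<bar>x p - x (dyadic_point k (dyadic_floor k p))\<bar> \<le> \<epsilon> / 2"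
      using approx[OF pq(1), of "\<epsilon> / 2" K] \<epsilon> by auto
    obtain k' where k': "K \<le> k'" "\<bar>x q - x (dyadic_point k' (dyadic_floor k' q))\<bar> \<le> \<epsilon> / 2"
      using approx[OF pq(2), of "\<epsilon> / 2" K] \<epsilon> by auto
    have "\<bar>x (dyadic_point k (dyadic_floor k p)) - x (dyadic_point k' (dyadic_floor k' q))\<bar> \<le> w"
      unfolding w_def
    proof (rule dyadic_modulus[OF level sum])
      show "dyadic_floor k p \<in> index_box (2^(k + 2))" "dyadic_floor k' q \<in> index_box (2^(k' + 2))"
        by (intro dyadic_floor_index_box box)+
      fix i
      show "\<bar>dyadic_point k (dyadic_floor k p) $ i - dyadic_point k' (dyadic_floor k' q) $ i\<bar> \<le> 1 / 2^n"
      proof -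
        have arith: "\<bar>c - c'\<bar> \<le> w" if "c \<le> p" "p - c \<le> u" "c' \<le> q" "q - c' \<le> u'"
            "u < (w - \<bar>p - q\<bar>) / 2" "u' < (w - \<bar>p - q\<bar>) / 2" for c p u c' q u' w :: real
        proof -
          have "p - q \<le> \<bar>p - q\<bar>" "q - p \<le> \<bar>p - q\<bar>" by linarith+
          moreover have "2 * u < w - \<bar>p - q\<bar>" "2 * u' < w - \<bar>p - q\<bar>" using that by (simp_all add: field_simps)
          ultimately have "c - c' \<le> w" "c' - c \<le> w" using that(1-4) by linarith+
          then show ?thesis by linarith
        qed
        show ?thesis
          by (rule arith[OF dyadic_floor_bounds dyadic_floor_bounds])
            (use K[OF k(1), of i] K[OF k'(1), of i] in \<open>simp_all only: power_one_over\<close>)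
      qed
    qed auto
    with k(2) k'(2) show "\<bar>x p - x q\<bar> \<le> w + \<epsilon>" by linarith
  qed
  define r where "r = (1 / 2^n - infnorm (s - t)) / 4"
  have r: "0 < r" using h by (simp add: r_def)
  have r_le: "r \<le> 1 / 4" "infnorm (s - t) + 2 * r < 1 / 2^n" "2 * r < 1 / 2^n"
  proof -
    have "1 / 2^n \<le> (1::real)" by simp
    then have "1 / 2^n - infnorm (s - t) \<le> 1" using infnorm_pos_le[of "s - t"] by linarith
    then show "r \<le> 1 / 4" unfolding r_def by (rule divide_right_mono) simp
    show "infnorm (s - t) + 2 * r < 1 / 2^n" using h by (simp add: r_def field_simps)
    then show "2 * r < 1 / 2^n" using infnorm_pos_le[of "s - t"] by linarith
  qed
  have coord: "\<bar>u $ i - p $ i\<bar> < r" if "p \<in> ball u r" for u p :: "real^'d" and i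
    using that component_le_norm_cart[of "u - p" i] by (simp add: dist_norm)
  have near: "\<exists>p\<in>ball u r \<inter> S. \<bar>x u - x p\<bar> \<le> w" if u: "u \<in> cbox 0 1" for u :: "real^'d"
  proof -
    have box: "-1 \<le> p $ i \<and> p $ i \<le> 3" if "p \<in> ball u r" for p i
      using coord[OF that, of i] r_le(1) u by (auto simp: mem_box_cart dest!: spec[of _ i])
    have "ball u r \<inter> S \<noteq> {}"
    proof
      assume "ball u r \<inter> S = {}"
      then have "\<forall>t\<in>ball u r \<inter> S. x t \<in> {}" by blast
      from bspec[OF sep[OF open_ball closed_empty this], of u] r show False by simp
    qed
    then obtain p where p: "p \<in> ball u r" "p \<in> S" by blast
    have within: "\<forall>t\<in>ball u r. x t \<in> cball (x p) w"
    proof (rule sep[OF open_ball closed_cball], rule ballI)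
      fix q assume q: "q \<in> ball u r \<inter> S"
      have "\<bar>x p - x q\<bar> \<le> w"
      proof (intro S_close p box)
        show "\<bar>p $ i - q $ i\<bar> < 1 / 2^n" for i
          using coord[OF p(1), of i] coord[of q u i] q r_le(3) by auto
      qed (use q in auto)
      then show "x q \<in> cball (x p) w" by (simp add: dist_real_def)
    qed
    from bspec[OF within, of u] have "\<bar>x u - x p\<bar> \<le> w"
      using r by (simp add: dist_real_def abs_minus_commute)
    with p show ?thesis by blast
  qed
  obtain p where p: "p \<in> ball t r" "p \<in> S" "\<bar>x t - x p\<bar> \<le> w" using near[OF t] by blast
  obtain q where q: "q \<in> ball s r" "q \<in> S" "\<bar>x s - x q\<bar> \<le> w" using near[OF s] by blast
  have "\<bar>x p - x q\<bar> \<le> w"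
  proof (intro S_close p q)
    show "-1 \<le> p $ i \<and> p $ i \<le> 3" for i
      using coord[OF p(1), of i] r_le(1) t by (auto simp: mem_box_cart dest!: spec[of _ i])
    show "-1 \<le> q $ i \<and> q $ i \<le> 3" for i
      using coord[OF q(1), of i] r_le(1) s by (auto simp: mem_box_cart dest!: spec[of _ i])
    show "\<bar>p $ i - q $ i\<bar> < 1 / 2^n" for i
    proof -
      have "\<bar>s $ i - t $ i\<bar> \<le> infnorm (s - t)"
        using component_le_infnorm_cart[of "s - t" i] by simp
      then show ?thesis
        using coord[OF p(1), of i] coord[OF q(1), of i] r_le(2) by linarith
    qed
  qed
  with p(3) q(3) show ?thesis by (simp add: w_def)
qed

section \<open>Increments of self-similar fields with stationary increments\<close>

lemma card_index_box:
  assumes "0 \<le> b"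
  shows "finite (index_box b :: (int^'d) set)" "card (index_box b :: (int^'d) set) \<le> nat (b + 1) ^ CARD('d)"
proof -
  let ?B = "index_box b :: (int^'d) set"
  let ?E = "PiE (UNIV :: 'd set) (\<lambda>_. {0..b})"
  have inj: "inj_on vec_nth ?B" by (rule inj_onI) (simp add: vec_eq_iff)
  have sub: "vec_nth ` ?B \<subseteq> ?E" by (auto simp: index_box_def)
  have fin: "finite ?E" by (intro finite_PiE) auto
  show "finite ?B" using finite_subset[OF sub fin] inj by (rule finite_imageD)
  have "card ?B = card (vec_nth ` ?B)" by (rule card_image[OF inj, symmetric])
  also have "\<dots> \<le> card ?E" by (rule card_mono[OF fin sub])
  also have "\<dots> = nat (b + 1) ^ CARD('d)" by (simp add: card_PiE)
  finally show "card ?B \<le> nat (b + 1) ^ CARD('d)" .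
qed

lemma finite_directions: "finite (directions :: (int^'d) set)"
proof (rule finite_subset)
  show "directions \<subseteq> (\<lambda>k. k - 1) ` (index_box 2 :: (int^'d) set)"
  proof
    fix v :: "int^'d" assume v: "v \<in> directions"
    have "0 \<le> (v + 1) $ i \<and> (v + 1) $ i \<le> 2" for i
    proof -
      have "v $ i \<in> {-1, 0, 1}" using v by (auto simp: directions_def)
      then show ?thesis by auto
    qed
    then have "v + 1 \<in> index_box 2" by (simp add: index_box_def)
    then show "v \<in> (\<lambda>k. k - 1) ` index_box 2" by (metis add_diff_cancel image_eqI)
  qed
qed (simp add: card_index_box)

lemma fdd_eq_distr:
  assumes eq: "fdd_eq P X Q Z" and F: "finite F"
    and [measurable]: "\<And>t. X t \<in> borel_measurable P" "\<And>t. Z t \<in> borel_measurable Q"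
    and \<Phi>[measurable]: "\<Phi> \<in> measurable (\<Pi>\<^sub>M t\<in>F. borel) N"
  shows "distr P N (\<lambda>\<omega>. \<Phi> (\<lambda>t\<in>F. X t \<omega>)) = distr Q N (\<lambda>\<omega>. \<Phi> (\<lambda>t\<in>F. Z t \<omega>))"
proof -
  have "distr P N (\<lambda>\<omega>. \<Phi> (\<lambda>t\<in>F. X t \<omega>)) = distr (distr P (\<Pi>\<^sub>M t\<in>F. borel) (\<lambda>\<omega>. \<lambda>t\<in>F. X t \<omega>)) N \<Phi>"
    by (subst distr_distr) (auto simp: comp_def)
  also have "\<dots> = distr (distr Q (\<Pi>\<^sub>M t\<in>F. borel) (\<lambda>\<omega>. \<lambda>t\<in>F. Z t \<omega>)) N \<Phi>"
    using eq F by (simp add: fdd_eq_def)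
  also have "\<dots> = distr Q N (\<lambda>\<omega>. \<Phi> (\<lambda>t\<in>F. Z t \<omega>))"
    by (subst distr_distr) (auto simp: comp_def)
  finally show ?thesis .
qed

lemma fdd_eq_increment_distr:
  assumes "fdd_eq P X Q Z"
    and "\<And>t. X t \<in> borel_measurable P" "\<And>t. Z t \<in> borel_measurable Q"
  shows "distr P borel (\<lambda>\<omega>. X p \<omega> - X q \<omega>) = distr Q borel (\<lambda>\<omega>. Z p \<omega> - Z q \<omega>)"
  using fdd_eq_distr[OF assms(1) _ assms(2,3), of "{p, q}" "\<lambda>y. y p - y q" borel] by simp

lemma fdd_eq_max_increment:
  fixes X :: "'t \<Rightarrow> 'p \<Rightarrow> real" and Z :: "'t \<Rightarrow> 'q \<Rightarrow> real"
  assumes "fdd_eq P X Q Z" "finite K"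
    and [measurable]: "\<And>t. X t \<in> borel_measurable P" "\<And>t. Z t \<in> borel_measurable Q"
  shows "measure P {\<omega> \<in> space P. \<exists>(p, q)\<in>K. x \<le> \<bar>X p \<omega> - X q \<omega>\<bar>}
       = measure Q {\<omega> \<in> space Q. \<exists>(p, q)\<in>K. x \<le> \<bar>Z p \<omega> - Z q \<omega>\<bar>}"
proof -
  let ?F = "fst ` K \<union> snd ` K"
  define \<Phi> where "\<Phi> y \<longleftrightarrow> (\<exists>(p, q)\<in>K. x \<le> \<bar>y p - y q\<bar>)" for y :: "'t \<Rightarrow> real"
  have \<Phi>[measurable]: "\<Phi> \<in> measurable (\<Pi>\<^sub>M t\<in>?F. borel) (count_space UNIV)"
  proof -
    have "Measurable.pred (\<Pi>\<^sub>M t\<in>?F. borel) (\<lambda>y. x \<le> \<bar>y (fst pq) - y (snd pq)\<bar>)" if "pq \<in> K" for pq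
    proof -
      have [measurable]: "(\<lambda>y. y (fst pq)) \<in> borel_measurable (\<Pi>\<^sub>M t\<in>?F. borel)"
          "(\<lambda>y. y (snd pq)) \<in> borel_measurable (\<Pi>\<^sub>M t\<in>?F. borel)"
        using that by (auto intro!: measurable_component_singleton)
      show ?thesis by measurable
    qed
    then show ?thesis
      unfolding \<Phi>_def case_prod_beta using assms(2) by (intro pred_intros_finite) auto
  qed
  have restrict: "\<Phi> (\<lambda>t\<in>?F. y t) \<longleftrightarrow> \<Phi> y" for y
    by (force simp: \<Phi>_def case_prod_beta)
  have meas: "measure R {\<omega> \<in> space R. \<Phi> (\<lambda>t\<in>?F. W t \<omega>)}
      = measure (distr R (count_space UNIV) (\<lambda>\<omega>. \<Phi> (\<lambda>t\<in>?F. W t \<omega>))) {True}"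
    if [measurable]: "\<And>t. W t \<in> borel_measurable R" for R :: "'r measure" and W
  proof -
    have "(\<lambda>\<omega>. \<Phi> (\<lambda>t\<in>?F. W t \<omega>)) -` {True} \<inter> space R = {\<omega> \<in> space R. \<Phi> (\<lambda>t\<in>?F. W t \<omega>)}" by auto
    then show ?thesis by (subst measure_distr) auto
  qed
  have "measure P {\<omega> \<in> space P. \<Phi> (\<lambda>t\<in>?F. X t \<omega>)} = measure Q {\<omega> \<in> space Q. \<Phi> (\<lambda>t\<in>?F. Z t \<omega>)}"
    using fdd_eq_distr[OF assms(1) _ assms(3,4) \<Phi>] assms(2) meas[of X P] meas[of Z Q] by simp
  then show ?thesis by (simp only: restrict) (simp add: \<Phi>_def)
qed

locale self_similar_stable_field = prob_space P for P :: "'w measure" +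
  fixes X :: "real^'d \<Rightarrow> 'w \<Rightarrow> real"
    and m :: "'e measure" and f :: "real^'d \<Rightarrow> 'e \<Rightarrow> real"
    and Q :: "'q measure" and M :: "'e set \<Rightarrow> 'q \<Rightarrow> real" and Z :: "real^'d \<Rightarrow> 'q \<Rightarrow> real"
    and \<alpha> H \<theta> :: real
  assumes \<alpha>: "0 < \<alpha>" and H: "0 < H"
    and sas: "sas_field \<alpha> P X"
    and self_sim: "self_similar H P X"
    and stat_inc: "stationary_increments P X"
    and random_measure: "sas_random_measure \<alpha> m Q M"
    and integral: "\<And>t. has_stable_integral \<alpha> m Q M (f t) (Z t)"
    and fdd: "fdd_eq P X Q Z"
    and \<theta>: "0 < \<theta>" "\<theta> < \<alpha> * H"
    and dim: "\<And>v. v \<in> directions \<Longrightarrow> weak_effective_dim_bounded \<alpha> m (increment_kernel f v) \<theta>"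
begin

sublocale Q: stable_measure Q \<alpha> m M
proof -
  interpret Q: prob_space Q using random_measure by (simp add: sas_random_measure_def)
  show "stable_measure Q \<alpha> m M"
    by unfold_locales (use \<alpha> random_measure in auto)
qed

lemma X_meas[measurable]: "X t \<in> borel_measurable P"
  using sas by (simp add: sas_field_def)

lemma sas_linear_combination:
  "finite F \<Longrightarrow> sas_distribution \<alpha> (distr P borel (\<lambda>\<omega>. \<Sum>t\<in>F. a t * X t \<omega>))"
  using sas by (simp add: sas_field_def)

lemma Z_meas[measurable]: "Z t \<in> borel_measurable Q"
  using integral by (simp add: has_stable_integral_def)

lemma f_meas[measurable]: "f t \<in> borel_measurable m"
  using integral by (simp add: has_stable_integral_def L_space_def)

text \<open>
  Stationarity of the increments removes the shift \<open>u\<close> and self-similarity the scale \<open>c\<close>.  Both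
  hold jointly for all pairs in \<open>K\<close>.
\<close>

lemma max_increment_rescale:
  assumes "finite K" "0 < c"
  shows "prob {\<omega> \<in> space P. \<exists>(p, q)\<in>K. x \<le> \<bar>X (c *\<^sub>R p + u) \<omega> - X (c *\<^sub>R q + u) \<omega>\<bar>}
       = prob {\<omega> \<in> space P. \<exists>(p, q)\<in>K. x \<le> c powr H * \<bar>X p \<omega> - X q \<omega>\<bar>}"
proof -
  let ?K = "(\<lambda>(p, q). (c *\<^sub>R p, c *\<^sub>R q)) ` K"
  have "prob {\<omega> \<in> space P. \<exists>(p, q)\<in>K. x \<le> \<bar>X (c *\<^sub>R p + u) \<omega> - X (c *\<^sub>R q + u) \<omega>\<bar>}
      = prob {\<omega> \<in> space P. \<exists>(p, q)\<in>?K. x \<le> \<bar>(X (p + u) \<omega> - X u \<omega>) - (X (q + u) \<omega> - X u \<omega>)\<bar>}"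
    by (rule arg_cong[where f = prob]) (auto simp: case_prod_beta)
  also have "\<dots> = prob {\<omega> \<in> space P. \<exists>(p, q)\<in>?K. x \<le> \<bar>(X p \<omega> - X 0 \<omega>) - (X q \<omega> - X 0 \<omega>)\<bar>}"
    using stat_inc assms(1) by (intro fdd_eq_max_increment) (auto simp: stationary_increments_def)
  also have "\<dots> = prob {\<omega> \<in> space P. \<exists>(p, q)\<in>K. x \<le> \<bar>X (c *\<^sub>R p) \<omega> - X (c *\<^sub>R q) \<omega>\<bar>}"
    by (rule arg_cong[where f = prob]) (auto simp: case_prod_beta)
  also have "\<dots> = prob {\<omega> \<in> space P. \<exists>(p, q)\<in>K. x \<le> \<bar>c powr H * X p \<omega> - c powr H * X q \<omega>\<bar>}"
    using self_sim assms by (intro fdd_eq_max_increment) (auto simp: self_similar_def)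
  also have "\<dots> = prob {\<omega> \<in> space P. \<exists>(p, q)\<in>K. x \<le> c powr H * \<bar>X p \<omega> - X q \<omega>\<bar>}"
    by (simp add: abs_mult flip: right_diff_distrib)
  finally show ?thesis .
qed

text \<open>
  By stationarity all the increments in direction \<open>v\<close> have the same law, and a symmetric
  stable law has a positive characteristic function, so its logarithm at \<open>1\<close> is finite.
\<close>

lemma increment_norm_bound:
  fixes v :: "int^'d"
  obtains V where "0 < V"
    "\<And>k. (\<integral>\<^sup>+x. ennreal (\<bar>increment_kernel f v k x\<bar> powr \<alpha>) \<partial>m) \<le> ennreal V"
proof -
  let ?c = "\<lambda>t::real^'d. if t = of_int_vec v then 1 else (-1::real)"
  let ?Y = "\<lambda>\<omega>. X (of_int_vec v) \<omega> - X 0 \<omega>"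
  have "sas_distribution \<alpha> (distr P borel ?Y)"
  proof (cases "of_int_vec v = (0 :: real^'d)")
    case True
    then show ?thesis using sas_linear_combination[of "{}"] by simp
  next
    case False
    then show ?thesis using sas_linear_combination[of "{of_int_vec v, 0}" ?c] by simp
  qed
  then obtain \<sigma> where "0 \<le> \<sigma>" and "\<forall>\<theta>. char (distr P borel ?Y) \<theta> = complex_of_real (exp (- (\<sigma> powr \<alpha> * \<bar>\<theta>\<bar> powr \<alpha>)))"
    unfolding sas_distribution_def by blast
  then have \<sigma>: "char (distr P borel ?Y) 1 = complex_of_real (exp (- (\<sigma> powr \<alpha>)))" by simp
  define V where "V = 2 powr \<alpha> * (\<sigma> powr \<alpha> + 1)"
  show ?thesis
  proof (rule that)
    show "0 < V" by (simp add: V_def add_nonneg_pos)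
    fix k :: "int^'d"
    let ?p = "of_int_vec (v + k) :: real^'d" and ?q = "of_int_vec k :: real^'d"
    have pq: "?p = of_int_vec v + ?q" by (simp add: of_int_vec_def vec_eq_iff)
    have "distr Q borel (\<lambda>\<omega>. Z ?p \<omega> - Z ?q \<omega>) = distr P borel (\<lambda>\<omega>. X ?p \<omega> - X ?q \<omega>)"
      by (rule fdd_eq_increment_distr[OF fdd, symmetric]) auto
    also have "\<dots> = distr P borel (\<lambda>\<omega>. (X (of_int_vec v + ?q) \<omega> - X ?q \<omega>) - (X (0 + ?q) \<omega> - X ?q \<omega>))"
      by (simp add: pq)
    also have "\<dots> = distr P borel (\<lambda>\<omega>. (X (of_int_vec v) \<omega> - X 0 \<omega>) - (X 0 \<omega> - X 0 \<omega>))"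
      using stat_inc
      by (intro fdd_eq_increment_distr[where X = "\<lambda>t \<omega>. X (t + ?q) \<omega> - X ?q \<omega>" and Z = "\<lambda>t \<omega>. X t \<omega> - X 0 \<omega>"])
        (auto simp: stationary_increments_def)
    finally have "char (distr Q borel (\<lambda>\<omega>. Z ?p \<omega> - Z ?q \<omega>)) 1 = complex_of_real (exp (- (\<sigma> powr \<alpha>)))"
      using \<sigma> by simp
    from Q.stable_norm_le_of_char[OF Q.has_stable_integral_diff[OF integral integral] this]
    show "(\<integral>\<^sup>+x. ennreal (\<bar>increment_kernel f v k x\<bar> powr \<alpha>) \<partial>m) \<le> ennreal V"
      by (simp add: V_def increment_kernel_def)
  qed
qed

text \<open>
  Along a coordinate axis an increment is a rescaled copy of a single random variable.
\<close>

lemma coordinate_increment_prob: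
  assumes "0 < \<epsilon>" "0 \<le> r" "r \<le> \<rho>"
  shows "prob {\<omega> \<in> space P. \<epsilon> < \<bar>X (t + r *\<^sub>R axis i 1) \<omega> - X t \<omega>\<bar>}
      \<le> prob {\<omega> \<in> space P. \<epsilon> \<le> \<rho> powr H * \<bar>X (axis i 1) \<omega> - X 0 \<omega>\<bar>}"
proof (cases "r = 0")
  case True
  then show ?thesis using assms by simp
next
  case False
  then have r: "0 < r" using assms by simp
  have "prob {\<omega> \<in> space P. \<epsilon> < \<bar>X (t + r *\<^sub>R axis i 1) \<omega> - X t \<omega>\<bar>}
      \<le> prob {\<omega> \<in> space P. \<epsilon> \<le> \<bar>X (r *\<^sub>R axis i 1 + t) \<omega> - X (r *\<^sub>R 0 + t) \<omega>\<bar>}"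
    by (intro finite_measure_mono) (auto simp: add.commute)
  also have "\<dots> = prob {\<omega> \<in> space P. \<epsilon> \<le> r powr H * \<bar>X (axis i 1) \<omega> - X 0 \<omega>\<bar>}"
    using max_increment_rescale[OF _ r, of "{(axis i 1, 0)}" \<epsilon> t] by simp
  also have "\<dots> \<le> prob {\<omega> \<in> space P. \<epsilon> \<le> \<rho> powr H * \<bar>X (axis i 1) \<omega> - X 0 \<omega>\<bar>}"
  proof (intro finite_measure_mono subsetI)
    fix \<omega> assume *: "\<omega> \<in> {\<omega> \<in> space P. \<epsilon> \<le> r powr H * \<bar>X (axis i 1) \<omega> - X 0 \<omega>\<bar>}"
    have "r powr H * \<bar>X (axis i 1) \<omega> - X 0 \<omega>\<bar> \<le> \<rho> powr H * \<bar>X (axis i 1) \<omega> - X 0 \<omega>\<bar>"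
      using assms H by (intro mult_right_mono powr_mono2) auto
    with * show "\<omega> \<in> {\<omega> \<in> space P. \<epsilon> \<le> \<rho> powr H * \<bar>X (axis i 1) \<omega> - X 0 \<omega>\<bar>}" by auto
  qed auto
  finally show ?thesis .
qed

text \<open>
  A general increment is decomposed into coordinate steps, because self-similarity by itself gives
  no uniformity over the directions in space.
\<close>

lemma box_increment_prob:
  fixes r :: "'d \<Rightarrow> real"
  assumes "finite J" "0 < \<epsilon>" "\<And>i. 0 \<le> r i \<and> r i \<le> \<rho>"
  shows "prob {\<omega> \<in> space P. real (card J) * \<epsilon> < \<bar>X (t + (\<Sum>i\<in>J. r i *\<^sub>R axis i 1)) \<omega> - X t \<omega>\<bar>}
      \<le> (\<Sum>i\<in>J. prob {\<omega> \<in> space P. \<epsilon> \<le> \<rho> powr H * \<bar>X (axis i 1) \<omega> - X 0 \<omega>\<bar>})"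
  using assms(1)
proof (induction J)
  case empty
  then show ?case by simp
next
  case (insert j J)
  let ?s = "t + (\<Sum>i\<in>J. r i *\<^sub>R axis i 1)"
  have eq: "t + (\<Sum>i\<in>insert j J. r i *\<^sub>R axis i 1) = ?s + r j *\<^sub>R axis j 1"
    using insert.hyps by (simp add: ac_simps)
  have "prob {\<omega> \<in> space P. real (card (insert j J)) * \<epsilon> < \<bar>X (?s + r j *\<^sub>R axis j 1) \<omega> - X t \<omega>\<bar>}
      \<le> prob ({\<omega> \<in> space P. \<epsilon> < \<bar>X (?s + r j *\<^sub>R axis j 1) \<omega> - X ?s \<omega>\<bar>}
        \<union> {\<omega> \<in> space P. real (card J) * \<epsilon> < \<bar>X ?s \<omega> - X t \<omega>\<bar>})"
  proof (intro finite_measure_mono subsetI)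
    fix \<omega> assume "\<omega> \<in> {\<omega> \<in> space P. real (card (insert j J)) * \<epsilon> < \<bar>X (?s + r j *\<^sub>R axis j 1) \<omega> - X t \<omega>\<bar>}"
    then have "\<omega> \<in> space P" "real (card J) * \<epsilon> + \<epsilon> < \<bar>X (?s + r j *\<^sub>R axis j 1) \<omega> - X t \<omega>\<bar>"
      using insert.hyps by (auto simp: algebra_simps)
    then show "\<omega> \<in> {\<omega> \<in> space P. \<epsilon> < \<bar>X (?s + r j *\<^sub>R axis j 1) \<omega> - X ?s \<omega>\<bar>}
        \<union> {\<omega> \<in> space P. real (card J) * \<epsilon> < \<bar>X ?s \<omega> - X t \<omega>\<bar>}"
      unfolding Un_iff mem_Collect_eq by linarith
  qed auto
  also have "\<dots> \<le> prob {\<omega> \<in> space P. \<epsilon> < \<bar>X (?s + r j *\<^sub>R axis j 1) \<omega> - X ?s \<omega>\<bar>}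
        + prob {\<omega> \<in> space P. real (card J) * \<epsilon> < \<bar>X ?s \<omega> - X t \<omega>\<bar>}"
    by (intro measure_Un_le) auto
  also have "\<dots> \<le> prob {\<omega> \<in> space P. \<epsilon> \<le> \<rho> powr H * \<bar>X (axis j 1) \<omega> - X 0 \<omega>\<bar>}
        + (\<Sum>i\<in>J. prob {\<omega> \<in> space P. \<epsilon> \<le> \<rho> powr H * \<bar>X (axis i 1) \<omega> - X 0 \<omega>\<bar>})"
    using assms(2,3) by (intro add_mono insert.IH coordinate_increment_prob) auto
  finally show ?case unfolding eq using insert.hyps by simp
qed

lemma scaled_tail_tendsto_0:
  assumes [measurable]: "Y \<in> borel_measurable P" and "0 < \<epsilon>"
  shows "(\<lambda>k. prob {\<omega> \<in> space P. \<epsilon> \<le> (1 / 2^k) powr H * \<bar>Y \<omega>\<bar>}) \<longlonglongrightarrow> 0"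
proof -
  let ?A = "\<lambda>k. {\<omega> \<in> space P. \<epsilon> \<le> (1 / 2^k) powr H * \<bar>Y \<omega>\<bar>}"
  have "(\<lambda>k. prob (?A k)) \<longlonglongrightarrow> prob (\<Inter>k. ?A k)"
  proof (rule finite_Lim_measure_decseq)
    show "range ?A \<subseteq> events" by auto
    show "decseq ?A"
    proof (rule decseq_SucI, rule subsetI)
      fix k \<omega> assume *: "\<omega> \<in> ?A (Suc k)"
      have "(1 / 2 ^ Suc k) powr H * \<bar>Y \<omega>\<bar> \<le> (1 / 2^k) powr H * \<bar>Y \<omega>\<bar>"
        using H by (intro mult_right_mono powr_mono2) (auto simp: field_simps)
      with * show "\<omega> \<in> ?A k" by auto
    qed
  qed
  moreover have "(\<Inter>k. ?A k) = {}"
  proof (rule equals0I)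
    fix \<omega> assume "\<omega> \<in> (\<Inter>k. ?A k)"
    then have *: "\<epsilon> \<le> (1 / 2^k) powr H * \<bar>Y \<omega>\<bar>" for k by auto
    have "(\<lambda>k. (1 / 2^k) powr H * \<bar>Y \<omega>\<bar>) \<longlonglongrightarrow> 0"
      using H by real_asymp
    then have "\<epsilon> \<le> 0" using * by (intro LIMSEQ_le_const) auto
    with assms(2) show False by simp
  qed
  ultimately show ?thesis by simp
qed

text \<open>
  Convergence in probability along the dyadic approximations; for a fixed tolerance the event
  that all late approximations fail has probability zero.
\<close>

lemma AE_dyadic_approximation:
  "AE \<omega> in P. \<forall>\<epsilon>>0. \<forall>K. \<exists>k\<ge>K. \<bar>X s \<omega> - X (dyadic_point k (dyadic_floor k s)) \<omega>\<bar> \<le> \<epsilon>"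
proof -
  let ?s = "\<lambda>k. dyadic_point k (dyadic_floor k s)"
  have lim: "(\<lambda>k. prob {\<omega> \<in> space P. \<epsilon> < \<bar>X s \<omega> - X (?s k) \<omega>\<bar>}) \<longlonglongrightarrow> 0" if \<epsilon>: "0 < \<epsilon>" for \<epsilon>
  proof (rule tendsto_sandwich[OF _ _ tendsto_const])
    let ?e = "\<epsilon> / real CARD('d)"
    have e: "0 < ?e" "real CARD('d) * ?e = \<epsilon>" using \<epsilon> by auto
    show "\<forall>\<^sub>F k in sequentially. prob {\<omega> \<in> space P. \<epsilon> < \<bar>X s \<omega> - X (?s k) \<omega>\<bar>}
      \<le> (\<Sum>i\<in>UNIV. prob {\<omega> \<in> space P. ?e \<le> (1 / 2^k) powr H * \<bar>X (axis i 1) \<omega> - X 0 \<omega>\<bar>})"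
    proof (intro always_eventually allI)
      fix k
      have s: "s = ?s k + (\<Sum>i\<in>UNIV. (s $ i - ?s k $ i) *\<^sub>R axis i 1)"
        by (simp add: vec_eq_iff axis_def if_distrib cong: if_cong)
      have "prob {\<omega> \<in> space P. real CARD('d) * ?e < \<bar>X (?s k + (\<Sum>i\<in>UNIV. (s $ i - ?s k $ i) *\<^sub>R axis i 1)) \<omega> - X (?s k) \<omega>\<bar>}
        \<le> (\<Sum>i\<in>UNIV. prob {\<omega> \<in> space P. ?e \<le> (1 / 2^k) powr H * \<bar>X (axis i 1) \<omega> - X 0 \<omega>\<bar>})"
        using dyadic_floor_bounds e(1) by (intro box_increment_prob) (auto simp: le_diff_eq)
      then show "prob {\<omega> \<in> space P. \<epsilon> < \<bar>X s \<omega> - X (?s k) \<omega>\<bar>}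
        \<le> (\<Sum>i\<in>UNIV. prob {\<omega> \<in> space P. ?e \<le> (1 / 2^k) powr H * \<bar>X (axis i 1) \<omega> - X 0 \<omega>\<bar>})"
        using s e(2) by simp
    qed
    have "(\<lambda>k. \<Sum>i\<in>UNIV. prob {\<omega> \<in> space P. ?e \<le> (1 / 2^k) powr H * \<bar>X (axis i 1) \<omega> - X 0 \<omega>\<bar>}) \<longlonglongrightarrow> (\<Sum>i\<in>(UNIV::'d set). 0)"
      using e(1) by (intro tendsto_sum scaled_tail_tendsto_0) auto
    then show "(\<lambda>k. \<Sum>i\<in>UNIV. prob {\<omega> \<in> space P. ?e \<le> (1 / 2^k) powr H * \<bar>X (axis i 1) \<omega> - X 0 \<omega>\<bar>}) \<longlonglongrightarrow> 0"
      by simp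
  qed simp
  have "AE \<omega> in P. \<exists>k\<ge>K. \<bar>X s \<omega> - X (?s k) \<omega>\<bar> \<le> \<epsilon>" if "0 < \<epsilon>" for \<epsilon> K
  proof -
    let ?N = "{\<omega> \<in> space P. \<forall>k\<ge>K. \<epsilon> < \<bar>X s \<omega> - X (?s k) \<omega>\<bar>}"
    have [measurable]: "?N \<in> events" by measurable
    have "prob ?N \<le> 0"
    proof (rule LIMSEQ_le_const[OF lim[OF that]])
      show "\<exists>n0. \<forall>n\<ge>n0. prob ?N \<le> prob {\<omega> \<in> space P. \<epsilon> < \<bar>X s \<omega> - X (?s n) \<omega>\<bar>}"
        by (intro exI[of _ K] allI impI finite_measure_mono) auto
    qed
    then have "prob ?N = 0" by (simp add: measure_le_0_iff)
    then have "AE \<omega> in P. \<omega> \<notin> ?N" by (simp add: prob_eq_0)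
    then show ?thesis
      using AE_space by eventually_elim (simp add: not_less)
  qed
  then have "AE \<omega> in P. \<forall>j K :: nat. \<exists>k\<ge>K. \<bar>X s \<omega> - X (?s k) \<omega>\<bar> \<le> inverse (real (Suc j))"
    unfolding AE_all_countable by simp
  then show ?thesis
  proof eventually_elim
    case (elim \<omega>)
    show ?case
    proof (intro allI impI)
      fix \<epsilon> :: real and K :: nat assume "0 < \<epsilon>"
      then obtain j where "inverse (real (Suc j)) < \<epsilon>" using reals_Archimedean by blast
      with elim show "\<exists>k\<ge>K. \<bar>X s \<omega> - X (?s k) \<omega>\<bar> \<le> \<epsilon>" by (meson less_imp_le order_trans)
    qed
  qed
qed

end

section \<open>The modulus of continuity\<close>

lemma index_box_eq_interval:
  "index_box b = {k :: int^'d. 0 \<le> k \<and> k \<le> (\<chi> i. b)}"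
  by (auto simp: index_box_def less_eq_vec_def)

text \<open>
  The grid with side \<open>n\<close> counts \<open>n + 1\<close> points in each direction, whence the successor.
\<close>

lemma nn_integral_Max_eq_max_scale:
  fixes g :: "int^'d \<Rightarrow> 'e \<Rightarrow> real"
  assumes "0 < \<alpha>" and g: "\<And>k. g k \<in> L_space \<alpha> m"
  shows "(\<integral>\<^sup>+x. ennreal (Max ((\<lambda>k. \<bar>g k x\<bar> powr \<alpha>) ` index_box (int n))) \<partial>m)
      = ennreal (max_scale \<alpha> m g (Suc n) powr \<alpha>)"
proof -
  let ?F = "index_box (int n) :: (int^'d) set"
  let ?max = "\<lambda>x. Max ((\<lambda>k. \<bar>g k x\<bar> powr \<alpha>) ` ?F)"
  have fin: "finite ?F" by (simp add: card_index_box)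
  have "0 \<in> ?F" by (simp add: index_box_def)
  then have ne: "?F \<noteq> {}" by blast
  have [measurable]: "g k \<in> borel_measurable m" for k using g by (simp add: L_space_def)
  have nonneg: "0 \<le> ?max x" for x
    using fin ne by (subst Max_ge_iff) auto
  have le: "?max x \<le> (\<Sum>k\<in>?F. \<bar>g k x\<bar> powr \<alpha>)" for x
  proof (rule Max.boundedI)
    show "y \<le> (\<Sum>k\<in>?F. \<bar>g k x\<bar> powr \<alpha>)" if y: "y \<in> (\<lambda>k. \<bar>g k x\<bar> powr \<alpha>) ` ?F" for y
    proof -
      obtain k where k: "k \<in> ?F" "y = \<bar>g k x\<bar> powr \<alpha>" using y by blast
      show ?thesis unfolding k(2) by (rule member_le_sum[OF k(1)]) (use fin in auto)
    qed
  qed (use fin ne in auto)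
  have "integrable m ?max"
  proof (rule Bochner_Integration.integrable_bound)
    show "integrable m (\<lambda>x. \<Sum>k\<in>?F. \<bar>g k x\<bar> powr \<alpha>)"
      using g by (intro Bochner_Integration.integrable_sum) (auto simp: L_space_def)
    show "?max \<in> borel_measurable m" using fin by (intro borel_measurable_Max) auto
    show "AE x in m. norm (?max x) \<le> norm (\<Sum>k\<in>?F. \<bar>g k x\<bar> powr \<alpha>)"
      unfolding real_norm_def abs_of_nonneg[OF nonneg] by (intro AE_I2 order_trans[OF le abs_ge_self])
  qed
  then have "(\<integral>\<^sup>+x. ennreal (?max x) \<partial>m) = ennreal (\<integral>x. ?max x \<partial>m)"
    using nonneg by (intro nn_integral_eq_integral) auto
  also have "(\<integral>x. ?max x \<partial>m) = max_scale \<alpha> m g (Suc n) powr \<alpha>"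
    using assms(1) nonneg
    by (simp add: max_scale_def index_box_eq_interval[symmetric] powr_powr integral_nonneg_AE)
  finally show ?thesis .
qed

context self_similar_stable_field begin

text \<open>
  The bound for the maximum of stable integrals with \<open>B = b * 2 powr (\<theta> * n)\<close>, the upper bound
  given by the weak effective dimension, and with threshold \<open>\<kappa> * B powr (1 / \<alpha>)\<close>.  The term of the joint
  majorant becomes a multiple of \<open>\<kappa> powr -\<alpha>\<close>.  In the other term the ratio of the norm of a
  single kernel to \<open>B\<close> decays like \<open>2 powr (- \<theta> * n)\<close>, and its power \<open>(d + 1) / \<theta>\<close>
  outweighs the number of grid points.
\<close>

lemma lattice_increment_tail:
  assumes v: "v \<in> directions"
  obtains c D where "0 < c" "0 < D"
    "\<forall>\<^sub>F n in sequentially. \<forall>\<kappa>\<ge>1. Q.prob {\<omega> \<in> space Q. \<exists>k\<in>index_box (2^(n + 2)).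
        \<kappa> * c * 2 powr (\<theta> / \<alpha> * real n) \<le> \<bar>Z (of_int_vec (v + k)) \<omega> - Z (of_int_vec k) \<omega>\<bar>}
      \<le> D * (\<kappa> powr (-\<alpha>) + (1/2)^n)"
proof -
  obtain c2 where c2: "0 < c2"
    and ev: "\<forall>\<^sub>F N in sequentially. max_scale \<alpha> m (increment_kernel f v) N powr \<alpha> \<le> c2 * real N powr \<theta>"
  proof -
    obtain c1 c2 \<theta>\<^sub>1 where "0 < c2" and *: "\<forall>\<^sub>F n in sequentially.
        c1 * real n powr \<theta>\<^sub>1 \<le> max_scale \<alpha> m (increment_kernel f v) n powr \<alpha> \<and>
        max_scale \<alpha> m (increment_kernel f v) n powr \<alpha> \<le> c2 * real n powr \<theta>"
      using dim[OF v] unfolding weak_effective_dim_bounded_def by blast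
    show ?thesis by (rule that[OF \<open>0 < c2\<close>], rule eventually_mono[OF *]) blast
  qed
  obtain V where V: "0 < V"
    "\<And>k. (\<integral>\<^sup>+x. ennreal (\<bar>increment_kernel f v k x\<bar> powr \<alpha>) \<partial>m) \<le> ennreal V"
    by (rule increment_norm_bound[of v]) (rule that)
  let ?d = "real CARD('d)"
  define S where "S = stable_const \<alpha> * 2 powr (\<alpha> + 1)"
  have S: "0 < S" using stable_const_pos[OF \<alpha>] by (simp add: S_def)
  define b where "b = c2 * 8 powr \<theta>"
  have b: "0 < b" using c2 by (simp add: b_def)
  define B where "B n = b * 2 powr (\<theta> * real n)" for n
  have B: "0 < B n" for n using b by (simp add: B_def)
  (* truncating at this fraction of the threshold makes the exponent equal to (d + 1) / \<theta>,
     which outweighs the number of grid points, of order 2^(n * d) *)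
  define \<eta> where "\<eta> = \<theta> / (?d + 1) / 2"
  have \<eta>: "0 < \<eta>" using \<theta> by (simp add: \<eta>_def)
  define E where "E = (?d + 1) / \<theta>"
  have E: "0 < E" using \<theta> by (simp add: E_def)
  define D where "D = S / \<eta> powr \<alpha> + 8 ^ CARD('d) * (2 * exp 1 * (S * V / (\<eta> powr \<alpha> * b)) powr E)"
  define c where "c = 2 * b powr (1 / \<alpha>)"
  have kernel: "increment_kernel f v k \<in> L_space \<alpha> m" for k
    using Q.has_stable_integral_diff[OF integral integral, of "of_int_vec (v + k)" "of_int_vec k"]
    by (simp add: has_stable_integral_def increment_kernel_def[abs_def])
  have "\<forall>\<^sub>F n in sequentially. max_scale \<alpha> m (increment_kernel f v) (Suc (2^(n + 2))) powr \<alpha> \<le> c2 * real (Suc (2^(n + 2))) powr \<theta>"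
  proof -
    have "filterlim (\<lambda>n. Suc (2^(n + 2))) sequentially sequentially"
      by (rule filterlim_subseq) (auto simp: strict_mono_Suc_iff)
    from eventually_compose_filterlim[OF ev this] show ?thesis .
  qed
  then have tail: "\<forall>\<^sub>F n in sequentially. \<forall>\<kappa>\<ge>1. Q.prob {\<omega> \<in> space Q. \<exists>k\<in>index_box (2^(n + 2)).
        \<kappa> * c * 2 powr (\<theta> / \<alpha> * real n) \<le> \<bar>Z (of_int_vec (v + k)) \<omega> - Z (of_int_vec k) \<omega>\<bar>}
      \<le> D * (\<kappa> powr (-\<alpha>) + (1/2)^n)"
  proof (rule eventually_mono, intro allI impI)
    fix n and \<kappa> :: real
    assume scale: "max_scale \<alpha> m (increment_kernel f v) (Suc (2^(n + 2))) powr \<alpha> \<le> c2 * real (Suc (2^(n + 2))) powr \<theta>"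
      and \<kappa>: "1 \<le> \<kappa>"
    let ?F = "index_box (2^(n + 2)) :: (int^'d) set"
    let ?x = "\<kappa> * B n powr (1 / \<alpha>)"
    let ?L = "\<eta> * ?x"
    have fin: "finite ?F" by (simp add: card_index_box)
    have "0 \<in> ?F" by (simp add: index_box_def)
    then have ne: "?F \<noteq> {}" by blast
    have x: "0 < ?x" using \<kappa> B[of n] by simp
    have L: "0 < ?L" using x \<eta> by simp
    have size: "Suc (2^(n + 2)) \<le> 8 * 2^n"
    proof -
      have "Suc (2^(n + 2)) \<le> 4 * 2^n + 2^n" by simp
      then show ?thesis by linarith
    qed
    have "c2 * real (Suc (2^(n + 2))) powr \<theta> \<le> c2 * (8 * 2^n) powr \<theta>"
    proof (intro mult_left_mono powr_mono2)
      show "real (Suc (2^(n + 2))) \<le> 8 * 2^n"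
        using of_nat_mono[OF size, where ?'a = real] by simp
    qed (use c2 \<theta> in auto)
    also have "\<dots> = B n"
      by (simp add: B_def b_def powr_mult powr_powr powr_realpow[symmetric] mult.commute)
    finally have NB: "c2 * real (Suc (2^(n + 2))) powr \<theta> \<le> B n" .
    have Bn: "(\<integral>\<^sup>+x. ennreal (Max ((\<lambda>k. \<bar>increment_kernel f v k x\<bar> powr \<alpha>) ` ?F)) \<partial>m) \<le> ennreal (B n)"
      using nn_integral_Max_eq_max_scale[OF \<alpha>, where g = "increment_kernel f v", OF kernel, of "2^(n + 2)"] scale NB
      by (simp add: ennreal_leI)
    have L_pow: "?L powr \<alpha> = \<eta> powr \<alpha> * \<kappa> powr \<alpha> * B n"
      using \<eta> \<kappa> B[of n] \<alpha> by (simp add: powr_mult powr_powr)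
    have "Q.prob {\<omega> \<in> space Q. \<exists>k\<in>?F. 2 * ?x \<le> \<bar>Z (of_int_vec (v + k)) \<omega> - Z (of_int_vec k) \<omega>\<bar>}
      \<le> stable_const \<alpha> * (2 powr (\<alpha> + 1) * B n) / ?L powr \<alpha>
        + card ?F * (2 * exp 1 * (stable_const \<alpha> * (2 powr (\<alpha> + 1) * V) / ?L powr \<alpha>) powr (?x / (2 * ?L)))"
      by (rule Q.max_stable_integral_tail[where g = "increment_kernel f v" and Z = "\<lambda>k \<omega>. Z (of_int_vec (v + k)) \<omega> - Z (of_int_vec k) \<omega>", OF fin ne _ x L V(1) B Bn V(2)])
        (simp add: increment_kernel_def[abs_def] Q.has_stable_integral_diff[OF integral integral])
    also have "stable_const \<alpha> * (2 powr (\<alpha> + 1) * B n) / ?L powr \<alpha> = S / \<eta> powr \<alpha> * \<kappa> powr (-\<alpha>)"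
      unfolding L_pow using B[of n] by (simp add: S_def powr_minus field_simps)
    also have "?x / (2 * ?L) = E"
    proof -
      have cancel: "y / (2 * (\<eta> * y)) = E" if "y \<noteq> 0" for y
      proof -
        have "2 * (r / 2 * y) = r * y" for r :: real by simp
        then have "2 * (\<eta> * y) = \<theta> / (?d + 1) * y" unfolding \<eta>_def by blast
        then show ?thesis using that by (simp add: E_def)
      qed
      show ?thesis by (rule cancel[OF less_imp_neq[OF x, symmetric]])
    qed
    also have "real (card ?F) * (2 * exp 1 * (stable_const \<alpha> * (2 powr (\<alpha> + 1) * V) / ?L powr \<alpha>) powr E)
        \<le> (8 ^ CARD('d) * 2 powr (?d * real n)) * (2 * exp 1 * ((S * V / (\<eta> powr \<alpha> * b)) powr E * 2 powr (- ((?d + 1) * real n))))"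
    proof (intro mult_mono mult_left_mono)
      have "real (card ?F) \<le> real (nat (2^(n + 2) + 1) ^ CARD('d))"
        using card_index_box(2)[of "2^(n + 2)", where 'd = 'd] by (intro of_nat_mono) simp
      also have "\<dots> \<le> real ((8 * 2^n) ^ CARD('d))"
      proof (intro of_nat_mono power_mono)
        show "nat (2^(n + 2) + 1) \<le> 8 * 2^n" using size by (simp add: nat_add_distrib nat_mult_distrib nat_power_eq)
      qed simp
      also have "\<dots> = 8 ^ CARD('d) * 2 powr (?d * real n)"
        by (simp add: power_mult_distrib powr_realpow[symmetric] powr_powr mult.commute flip: power_mult)
      finally show "real (card ?F) \<le> 8 ^ CARD('d) * 2 powr (?d * real n)" .
      have "(stable_const \<alpha> * (2 powr (\<alpha> + 1) * V) / ?L powr \<alpha>) \<le> S * V / (\<eta> powr \<alpha> * b) * 2 powr (- (\<theta> * real n))"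
      proof -
        have "stable_const \<alpha> * (2 powr (\<alpha> + 1) * V) / ?L powr \<alpha>
            = (S * V / (\<eta> powr \<alpha> * b) * 2 powr (- (\<theta> * real n))) * \<kappa> powr (-\<alpha>)"
          unfolding L_pow unfolding B_def by (simp add: S_def powr_minus field_simps)
        also have "\<dots> \<le> (S * V / (\<eta> powr \<alpha> * b) * 2 powr (- (\<theta> * real n))) * 1"
        proof (rule mult_left_mono)
          show "\<kappa> powr (-\<alpha>) \<le> 1" using \<kappa> \<alpha> powr_mono[of "-\<alpha>" 0 \<kappa>] by simp
        qed (use S V b in simp)
        finally show ?thesis by simp
      qed
      then have "(stable_const \<alpha> * (2 powr (\<alpha> + 1) * V) / ?L powr \<alpha>) powr E
          \<le> (S * V / (\<eta> powr \<alpha> * b) * 2 powr (- (\<theta> * real n))) powr E"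
        using E V stable_const_pos[OF \<alpha>] by (intro powr_mono2) auto
      also have "\<dots> = (S * V / (\<eta> powr \<alpha> * b)) powr E * 2 powr (- ((?d + 1) * real n))"
      proof -
        have "- (\<theta> * real n) * E = - ((?d + 1) * real n)" using \<theta> by (simp add: E_def)
        then have "(2 powr (- (\<theta> * real n))) powr E = 2 powr (- ((?d + 1) * real n))"
          by (simp only: powr_powr)
        moreover have "0 \<le> S * V / (\<eta> powr \<alpha> * b)" using S V b by simp
        ultimately show ?thesis by (subst powr_mult) simp_all
      qed
      finally show "(stable_const \<alpha> * (2 powr (\<alpha> + 1) * V) / ?L powr \<alpha>) powr E
          \<le> (S * V / (\<eta> powr \<alpha> * b)) powr E * 2 powr (- ((?d + 1) * real n))" .
    qed auto
    also have "(8 ^ CARD('d) * 2 powr (?d * real n)) * (2 * exp 1 * ((S * V / (\<eta> powr \<alpha> * b)) powr E * 2 powr (- ((?d + 1) * real n))))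
        = 8 ^ CARD('d) * (2 * exp 1 * (S * V / (\<eta> powr \<alpha> * b)) powr E) * (1/2)^n"
    proof -
      have "2 powr (?d * real n) * 2 powr (- ((?d + 1) * real n)) = 2 powr (- real n)"
        by (simp add: powr_add[symmetric] algebra_simps)
      also have "\<dots> = (1/2)^n" by (simp add: powr_minus powr_realpow power_one_over inverse_eq_divide)
      finally show ?thesis by (simp add: mult_ac)
    qed
    also have "S / \<eta> powr \<alpha> * \<kappa> powr (-\<alpha>) + 8 ^ CARD('d) * (2 * exp 1 * (S * V / (\<eta> powr \<alpha> * b)) powr E) * (1/2)^n
        \<le> D * (\<kappa> powr (-\<alpha>) + (1/2)^n)"
    proof -
      have "S / \<eta> powr \<alpha> * \<kappa> powr (-\<alpha>) \<le> D * \<kappa> powr (-\<alpha>)"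
        by (intro mult_right_mono) (auto simp: D_def)
      moreover have "8 ^ CARD('d) * (2 * exp 1 * (S * V / (\<eta> powr \<alpha> * b)) powr E) * (1/2)^n \<le> D * (1/2)^n"
        using S by (intro mult_right_mono) (auto simp: D_def)
      ultimately show ?thesis unfolding distrib_left by (rule add_mono)
    qed
    finally have "Q.prob {\<omega> \<in> space Q. \<exists>k\<in>?F. 2 * ?x \<le> \<bar>Z (of_int_vec (v + k)) \<omega> - Z (of_int_vec k) \<omega>\<bar>}
      \<le> D * (\<kappa> powr (-\<alpha>) + (1/2)^n)" by simp
    moreover have "2 * ?x = \<kappa> * c * 2 powr (\<theta> / \<alpha> * real n)"
      using b by (simp add: c_def B_def powr_mult powr_powr)
    ultimately show "Q.prob {\<omega> \<in> space Q. \<exists>k\<in>?F. \<kappa> * c * 2 powr (\<theta> / \<alpha> * real n) \<le> \<bar>Z (of_int_vec (v + k)) \<omega> - Z (of_int_vec k) \<omega>\<bar>}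
      \<le> D * (\<kappa> powr (-\<alpha>) + (1/2)^n)" by simp
  qed
  show ?thesis
  proof (rule that[OF _ _ tail])
    show "0 < c" using b by (simp add: c_def)
    show "0 < D" using S \<eta> by (simp add: D_def add_pos_nonneg)
  qed
qed

lemma level_increment_prob_eq:
  fixes v :: "int^'d"
  shows "prob {\<omega> \<in> space P. \<exists>k\<in>index_box (2^(n + 2)). x \<le> \<bar>X (dyadic_point n (v + k)) \<omega> - X (dyadic_point n k) \<omega>\<bar>}
      = Q.prob {\<omega> \<in> space Q. \<exists>k\<in>index_box (2^(n + 2)).
          x \<le> (1 / 2^n) powr H * \<bar>Z (of_int_vec (v + k)) \<omega> - Z (of_int_vec k) \<omega>\<bar>}"
proof -
  let ?K = "(\<lambda>k. (of_int_vec (v + k), of_int_vec k)) ` index_box (2^(n + 2)) :: ((real^'d) \<times> (real^'d)) set"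
  let ?h = "(1 / 2^n) powr H"
  have K: "finite ?K" by (simp add: card_index_box)
  have h: "0 < ?h" by simp
  have scale: "x \<le> ?h * y \<longleftrightarrow> x / ?h \<le> y" for y using h by (simp add: field_simps)
  have "prob {\<omega> \<in> space P. \<exists>k\<in>index_box (2^(n + 2)). x \<le> \<bar>X (dyadic_point n (v + k)) \<omega> - X (dyadic_point n k) \<omega>\<bar>}
      = prob {\<omega> \<in> space P. \<exists>(p, q)\<in>?K. x \<le> \<bar>X ((1 / 2^n) *\<^sub>R p + (- 1)) \<omega> - X ((1 / 2^n) *\<^sub>R q + (- 1)) \<omega>\<bar>}"
    by (simp add: dyadic_point_def)
  also have "\<dots> = prob {\<omega> \<in> space P. \<exists>(p, q)\<in>?K. x / ?h \<le> \<bar>X p \<omega> - X q \<omega>\<bar>}"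
    by (subst max_increment_rescale[OF K]) (simp, simp only: scale)
  also have "\<dots> = Q.prob {\<omega> \<in> space Q. \<exists>(p, q)\<in>?K. x / ?h \<le> \<bar>Z p \<omega> - Z q \<omega>\<bar>}"
    by (rule fdd_eq_max_increment[OF fdd K X_meas Z_meas])
  also have "\<dots> = Q.prob {\<omega> \<in> space Q. \<exists>(p, q)\<in>?K. x \<le> ?h * \<bar>Z p \<omega> - Z q \<omega>\<bar>}"
    by (simp only: scale)
  finally show ?thesis by simp
qed

text \<open>
  Borel-Cantelli with \<open>\<kappa> = \<epsilon> / c * n powr (1 / \<gamma>)\<close>: then \<open>\<kappa> powr -\<alpha>\<close> is of order \<open>n powr (- \<alpha> / \<gamma>)\<close>,
  and \<open>\<alpha> / \<gamma> > 1\<close>.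
\<close>

lemma AE_eventually_level_increment_direction:
  assumes v: "v \<in> directions" and \<gamma>: "0 < \<gamma>" "\<gamma> < \<alpha>" and \<epsilon>: "0 < \<epsilon>"
  shows "AE \<omega> in P. \<forall>\<^sub>F n in sequentially. \<forall>k\<in>index_box (2^(n + 2)).
      \<bar>X (dyadic_point n (v + k)) \<omega> - X (dyadic_point n k) \<omega>\<bar>
        \<le> \<epsilon> * (real n powr (1 / \<gamma>) * 2 powr (- ((H - \<theta> / \<alpha>) * real n)))"
proof -
  let ?\<delta> = "\<lambda>n. \<epsilon> * (real n powr (1 / \<gamma>) * 2 powr (- ((H - \<theta> / \<alpha>) * real n)))"
  let ?A = "\<lambda>n. {\<omega> \<in> space P. \<exists>k\<in>index_box (2^(n + 2)).
      ?\<delta> n \<le> \<bar>X (dyadic_point n (v + k)) \<omega> - X (dyadic_point n k) \<omega>\<bar>}"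
  obtain c D where c: "0 < c" and D: "0 < D" and tail:
    "\<forall>\<^sub>F n in sequentially. \<forall>\<kappa>\<ge>1. Q.prob {\<omega> \<in> space Q. \<exists>k\<in>index_box (2^(n + 2)).
        \<kappa> * c * 2 powr (\<theta> / \<alpha> * real n) \<le> \<bar>Z (of_int_vec (v + k)) \<omega> - Z (of_int_vec k) \<omega>\<bar>}
      \<le> D * (\<kappa> powr (-\<alpha>) + (1/2)^n)"
    by (rule lattice_increment_tail[OF v])
  have fin: "finite (index_box (2^(n + 2)) :: (int^'d) set)" for n by (simp add: card_index_box)
  have A_sets: "?A n \<in> events" for n
    using fin[of n] by measurable
  let ?\<kappa> = "\<lambda>n. \<epsilon> / c * real n powr (1 / \<gamma>)"
  have \<kappa>_ev: "\<forall>\<^sub>F n in sequentially. 1 \<le> ?\<kappa> n"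
  proof -
    have "filterlim ?\<kappa> at_top sequentially" using \<epsilon> c \<gamma> by real_asymp
    then show ?thesis by (simp add: filterlim_at_top)
  qed
  have A_bound: "\<forall>\<^sub>F n in sequentially. prob (?A n) \<le> D * ((\<epsilon> / c) powr (-\<alpha>) * real n powr (- (\<alpha> / \<gamma>)) + (1/2)^n)"
    using tail \<kappa>_ev
  proof eventually_elim
    case (elim n)
    let ?h = "(1 / 2^n) powr H"
    have h: "?h = 2 powr (- (H * real n))"
      by (simp add: powr_divide powr_minus powr_realpow[symmetric] powr_powr inverse_eq_divide mult.commute)
    have eq: "?\<delta> n = ?h * (?\<kappa> n * c * 2 powr (\<theta> / \<alpha> * real n))"
    proof -
      have "- ((H - \<theta> / \<alpha>) * real n) = - (H * real n) + \<theta> / \<alpha> * real n"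
        by (simp add: algebra_simps)
      then have "2 powr (- ((H - \<theta> / \<alpha>) * real n)) = ?h * 2 powr (\<theta> / \<alpha> * real n)"
        by (simp only: h powr_add)
      then show ?thesis using c by (simp only: field_simps) simp
    qed
    have hp: "0 < ?h" by simp
    have "prob (?A n) = Q.prob {\<omega> \<in> space Q. \<exists>k\<in>index_box (2^(n + 2)).
          ?\<delta> n \<le> ?h * \<bar>Z (of_int_vec (v + k)) \<omega> - Z (of_int_vec k) \<omega>\<bar>}"
      by (rule level_increment_prob_eq)
    also have "\<dots> = Q.prob {\<omega> \<in> space Q. \<exists>k\<in>index_box (2^(n + 2)).
          ?\<kappa> n * c * 2 powr (\<theta> / \<alpha> * real n) \<le> \<bar>Z (of_int_vec (v + k)) \<omega> - Z (of_int_vec k) \<omega>\<bar>}"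
      unfolding eq mult_le_cancel_left_pos[OF hp] ..
    also have "\<dots> \<le> D * (?\<kappa> n powr (-\<alpha>) + (1/2)^n)"
      using elim(1,2) by blast
    also have "?\<kappa> n powr (-\<alpha>) = (\<epsilon> / c) powr (-\<alpha>) * real n powr (- (\<alpha> / \<gamma>))"
      using \<epsilon> c by (subst powr_mult) (simp_all add: powr_powr)
    finally show ?case .
  qed
  have "summable (\<lambda>n. prob (?A n))"
  proof (rule summable_comparison_test_ev)
    show "\<forall>\<^sub>F n in sequentially. norm (prob (?A n)) \<le> D * ((\<epsilon> / c) powr (-\<alpha>) * real n powr (- (\<alpha> / \<gamma>)) + (1/2)^n)"
      using A_bound by simp
    have "summable (\<lambda>n. real n powr (- (\<alpha> / \<gamma>)))"
      using \<gamma> by (simp add: summable_real_powr_iff)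
    then show "summable (\<lambda>n. D * ((\<epsilon> / c) powr (-\<alpha>) * real n powr (- (\<alpha> / \<gamma>)) + (1/2)^n))"
      by (intro summable_mult summable_add summable_geometric) auto
  qed
  then have "AE \<omega> in P. \<forall>\<^sub>F n in sequentially. \<omega> \<in> space P - ?A n"
    using A_sets by (intro borel_cantelli_AE1) (auto simp: less_top[symmetric])
  then show ?thesis
  proof eventually_elim
    case (elim \<omega>)
    then show ?case
    proof (rule eventually_mono, intro ballI)
      fix n and k :: "int^'d" assume "\<omega> \<in> space P - ?A n" "k \<in> index_box (2^(n + 2))"
      then have "\<not> ?\<delta> n \<le> \<bar>X (dyadic_point n (v + k)) \<omega> - X (dyadic_point n k) \<omega>\<bar>" by blast
      then show "\<bar>X (dyadic_point n (v + k)) \<omega> - X (dyadic_point n k) \<omega>\<bar> \<le> ?\<delta> n" by linarith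
    qed
  qed
qed

lemma AE_eventually_level_increment:
  assumes \<gamma>: "0 < \<gamma>" "\<gamma> < \<alpha>"
  shows "AE \<omega> in P. \<forall>\<epsilon>>0. \<forall>\<^sub>F n in sequentially.
      max_level_increment_le (\<lambda>t. X t \<omega>) n (\<epsilon> * (real n powr (1 / \<gamma>) * 2 powr (- ((H - \<theta> / \<alpha>) * real n))))"
proof -
  let ?\<delta> = "\<lambda>n. real n powr (1 / \<gamma>) * 2 powr (- ((H - \<theta> / \<alpha>) * real n))"
  have "AE \<omega> in P. \<forall>j::nat. \<forall>v\<in>directions. \<forall>\<^sub>F n in sequentially. \<forall>k\<in>index_box (2^(n + 2)).
      \<bar>X (dyadic_point n (v + k)) \<omega> - X (dyadic_point n k) \<omega>\<bar> \<le> inverse (real (Suc j)) * ?\<delta> n"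
    unfolding AE_all_countable
    by (intro allI AE_finite_allI finite_directions AE_eventually_level_increment_direction \<gamma>) auto
  then show ?thesis
  proof eventually_elim
    case (elim \<omega>)
    show ?case
    proof (intro allI impI)
      fix \<epsilon> :: real assume "0 < \<epsilon>"
      then obtain j where j: "inverse (real (Suc j)) < \<epsilon>" using reals_Archimedean by blast
      have "\<forall>\<^sub>F n in sequentially. \<forall>v\<in>directions. \<forall>k\<in>index_box (2^(n + 2)).
          \<bar>X (dyadic_point n (v + k)) \<omega> - X (dyadic_point n k) \<omega>\<bar> \<le> inverse (real (Suc j)) * ?\<delta> n"
        using elim by (intro eventually_ball_finite finite_directions) blast
      then show "\<forall>\<^sub>F n in sequentially. max_level_increment_le (\<lambda>t. X t \<omega>) n (\<epsilon> * ?\<delta> n)"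
      proof (rule eventually_mono)
        fix n assume *: "\<forall>v\<in>directions. \<forall>k\<in>index_box (2^(n + 2)).
          \<bar>X (dyadic_point n (v + k)) \<omega> - X (dyadic_point n k) \<omega>\<bar> \<le> inverse (real (Suc j)) * ?\<delta> n"
        have "inverse (real (Suc j)) * ?\<delta> n \<le> \<epsilon> * ?\<delta> n"
          using j by (intro mult_right_mono) auto
        with * show "max_level_increment_le (\<lambda>t. X t \<omega>) n (\<epsilon> * ?\<delta> n)"
          unfolding max_level_increment_le_def by (meson order_trans)
      qed
    qed
  qed
qed

end

text \<open>
  The given \<open>h\<close> is placed between consecutive powers \<open>2^(-n - 1)\<close> and \<open>2^(-n)\<close>; then
  \<open>2 powr (- \<beta> * n)\<close> and \<open>n\<close> are bounded by constant multiples of \<open>h powr \<beta>\<close> and \<open>ln (1 / h)\<close>.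
\<close>

lemma modulus_of_continuity_eventually:
  fixes x :: "real^'d \<Rightarrow> real"
  assumes \<beta>: "0 < \<beta>" and q: "0 < q"
    and level: "\<And>\<epsilon>. 0 < \<epsilon> \<Longrightarrow> \<forall>\<^sub>F n in sequentially.
      max_level_increment_le x n (\<epsilon> * (real n powr q * 2 powr (- (\<beta> * real n))))"
    and approx: "\<And>s \<epsilon> K. s \<in> S \<Longrightarrow> 0 < \<epsilon> \<Longrightarrow> \<exists>k\<ge>K. \<bar>x s - x (dyadic_point k (dyadic_floor k s))\<bar> \<le> \<epsilon>"
    and sep: "\<And>G F. open G \<Longrightarrow> closed F \<Longrightarrow> \<forall>t\<in>G \<inter> S. x t \<in> F \<Longrightarrow> \<forall>t\<in>G. x t \<in> F"
    and e: "0 < e"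
  shows "\<forall>\<^sub>F h in at_right 0. \<forall>t\<in>cbox 0 1. \<forall>s\<in>cbox 0 1. infnorm (s - t) \<le> h \<longrightarrow>
      \<bar>x t - x s\<bar> \<le> e * (h powr \<beta> * ln (1 / h) powr q)"
proof -
  let ?r = "\<lambda>n. real n powr q * 2 powr (- (\<beta> * real n))"
  define c where "c = 6 * chain_const \<beta> q * (2 powr \<beta> / ln 2 powr q)"
  have "0 < chain_const \<beta> q"
    unfolding chain_const_def by (intro suminf_pos summable_chain \<beta>) auto
  then have c: "0 < c" by (simp add: c_def)
  define \<epsilon> where "\<epsilon> = e / c"
  have \<epsilon>: "0 < \<epsilon>" using e c by (simp add: \<epsilon>_def)
  obtain n0 where n0: "\<And>n. n0 \<le> n \<Longrightarrow> max_level_increment_le x n (\<epsilon> * ?r n)"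
    using level[OF \<epsilon>] by (auto simp: eventually_sequentially)
  define h0 :: real where "h0 = 2 powr (- (real n0 + 2))"
  have main: "\<bar>x t - x s\<bar> \<le> e * (h powr \<beta> * ln (1 / h) powr q)"
    if h: "0 < h" "h < h0" and ts: "t \<in> cbox 0 1" "s \<in> cbox 0 1" "infnorm (s - t) \<le> h" for h s t
  proof -
    (* the level with 2^-(n+1) \<le> h < 2^-n *)
    define n where "n = nat (\<lceil>log 2 (1 / h)\<rceil> - 1)"
    have lg: "real n0 + 2 < log 2 (1 / h)"
    proof -
      have "log 2 h < log 2 h0" using h by simp
      then show ?thesis using h by (simp add: h0_def log_divide)
    qed
    have n_eq: "real n = real_of_int \<lceil>log 2 (1 / h)\<rceil> - 1"
    proof -
      have "1 \<le> \<lceil>log 2 (1 / h)\<rceil>" using lg by linarith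
      then show ?thesis by (simp add: n_def)
    qed
    have n: "real n < log 2 (1 / h)" "log 2 (1 / h) \<le> real n + 1"
      unfolding n_eq by linarith+
    have nn0: "n0 \<le> n" "1 \<le> n" using lg n by linarith+
    have h_lt: "h < 1 / 2^n"
    proof -
      have "2 powr real n < 1 / h" using n(1) h by (simp add: less_log_iff)
      then show ?thesis using h by (simp add: powr_realpow field_simps)
    qed
    have h_ge: "2 powr (- real n) \<le> 2 * h"
    proof -
      have "1 / h \<le> 2 powr (real n + 1)" using n(2) h by (simp add: log_le_iff)
      then show ?thesis using h by (simp add: powr_add powr_minus field_simps)
    qed
    have "\<bar>x t - x s\<bar> \<le> 6 * (\<Sum>j. \<epsilon> * ?r (j + n))"
    proof (rule separable_modulus[OF _ _ approx sep])
      show "max_level_increment_le x j (\<epsilon> * ?r j) \<and> 0 \<le> \<epsilon> * ?r j" if "n \<le> j" for j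
        using n0[of j] that nn0(1) \<epsilon> by simp
      show "summable (\<lambda>j. \<epsilon> * ?r j)"
        using q by (intro summable_mult chain_tail_le(1)[OF \<beta> _ nn0(2)]) simp
      show "infnorm (s - t) < 1 / 2^n" using ts(3) h_lt by linarith
    qed (use ts in auto)
    also have "(\<Sum>j. \<epsilon> * ?r (j + n)) = \<epsilon> * (\<Sum>j. ?r (j + n))"
    proof (rule suminf_mult)
      show "summable (\<lambda>j. ?r (j + n))"
        using chain_tail_le(1)[OF \<beta> _ nn0(2), of q] q summable_iff_shift[of ?r n] by simp
    qed
    also have "6 * (\<epsilon> * (\<Sum>j. ?r (j + n))) \<le> 6 * (\<epsilon> * (chain_const \<beta> q * ?r n))"
      using \<epsilon> q by (intro mult_left_mono chain_tail_le(2) \<beta> nn0) auto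
    also have "?r n \<le> (ln (1 / h) / ln 2) powr q * (2 powr \<beta> * h powr \<beta>)"
    proof (rule mult_mono)
      show "real n powr q \<le> (ln (1 / h) / ln 2) powr q"
        using n(1) q by (intro powr_mono2) (auto simp: log_def)
      have "2 powr (- (\<beta> * real n)) = (2 powr (- real n)) powr \<beta>" by (simp add: powr_powr mult.commute)
      also have "\<dots> \<le> (2 * h) powr \<beta>" using h_ge \<beta> by (intro powr_mono2) auto
      finally show "2 powr (- (\<beta> * real n)) \<le> 2 powr \<beta> * h powr \<beta>" using h by (simp add: powr_mult)
    qed auto
    also have "6 * (\<epsilon> * (chain_const \<beta> q * ((ln (1 / h) / ln 2) powr q * (2 powr \<beta> * h powr \<beta>))))
        = (\<epsilon> * c) * (h powr \<beta> * ln (1 / h) powr q)"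
    proof -
      have "0 \<le> ln (1 / h)"
        using lg by (simp add: log_def field_simps) (smt (verit) ln_gt_zero mult_nonneg_nonneg of_nat_0_le_iff)
      then show ?thesis by (simp add: c_def powr_divide)
    qed
    also have "\<epsilon> * c = e" using c by (simp add: \<epsilon>_def)
    finally show ?thesis using \<epsilon> \<open>0 < chain_const \<beta> q\<close> by simp
  qed
  have "0 < h0" by (simp add: h0_def)
  then have "\<forall>\<^sub>F h in at_right 0. 0 < h \<and> h < h0"
    by (auto simp: eventually_at_right_field)
  then show ?thesis by (rule eventually_mono) (use main in blast)
qed

lemma Limsup_modulus_eq_0:
  fixes x :: "real^'d \<Rightarrow> real"
  assumes "\<And>e. 0 < e \<Longrightarrow> \<forall>\<^sub>F h in at_right 0. \<forall>t\<in>cbox 0 1. \<forall>s\<in>cbox 0 1. infnorm (s - t) \<le> h \<longrightarrow>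
      \<bar>x t - x s\<bar> \<le> e * (h powr \<beta> * ln (1 / h) powr q)"
  shows "Limsup (at_right 0) (\<lambda>h :: real.
             (SUP t\<in>cbox 0 1. SUP s\<in>{s \<in> cbox 0 1. infnorm (s - t) \<le> h}. ereal \<bar>x t - x s\<bar>)
             / ereal (h powr \<beta> * ln (1 / h) powr q)) = 0"
proof -
  let ?sup = "\<lambda>h. SUP t\<in>cbox 0 1. SUP s\<in>{s \<in> cbox 0 1. infnorm (s - t) \<le> h}. ereal \<bar>x t - x s\<bar>"
  let ?d = "\<lambda>h::real. h powr \<beta> * ln (1 / h) powr q"
  have small: "\<forall>\<^sub>F h in at_right 0. 0 < h \<and> h < (1::real)"
    by (auto simp: eventually_at_right_field intro: exI[of _ 1])
  have d_pos: "0 < ?d h" if "0 < h" "h < 1" for h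
  proof -
    have "0 < ln (1 / h)" using that by (intro ln_gt_zero) simp
    then show ?thesis using that by simp
  qed
  have sup_nonneg: "0 \<le> ?sup h" if "0 < h" for h
  proof -
    have "0 \<in> cbox (0::real^'d) 1" by (simp add: mem_box_cart)
    then have "ereal \<bar>x 0 - x 0\<bar> \<le> ?sup h"
      using that by (intro SUP_upper2[of 0]) (auto intro!: SUP_upper2[of 0] simp: infnorm_0)
    then show ?thesis by (simp add: zero_ereal_def)
  qed
  have "((\<lambda>h. ?sup h / ereal (?d h)) \<longlongrightarrow> 0) (at_right 0)"
  proof (rule order_tendstoI)
    fix a :: ereal assume "a < 0"
    show "\<forall>\<^sub>F h in at_right 0. a < ?sup h / ereal (?d h)"
      using small
    proof (rule eventually_mono)
      fix h :: real assume h: "0 < h \<and> h < 1"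
      have "0 \<le> ?sup h / ereal (?d h)"
        using sup_nonneg[of h] d_pos[of h] h by (intro zero_le_divide_ereal) auto
      with \<open>a < 0\<close> show "a < ?sup h / ereal (?d h)" by (rule less_le_trans)
    qed
  next
    fix a :: ereal assume "0 < a"
    then obtain e where e: "0 < ereal e" "ereal e < a" using ereal_dense2 by blast
    have "\<forall>\<^sub>F h in at_right 0. (0 < h \<and> h < 1) \<and> (\<forall>t\<in>cbox 0 1. \<forall>s\<in>cbox 0 1. infnorm (s - t) \<le> h \<longrightarrow>
      \<bar>x t - x s\<bar> \<le> e * ?d h)"
      using e by (intro eventually_conj[OF small assms]) auto
    then show "\<forall>\<^sub>F h in at_right 0. ?sup h / ereal (?d h) < a"
    proof (rule eventually_mono)
      fix h assume h: "(0 < h \<and> h < 1) \<and> (\<forall>t\<in>cbox 0 1. \<forall>s\<in>cbox 0 1. infnorm (s - t) \<le> h \<longrightarrow>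
        \<bar>x t - x s\<bar> \<le> e * ?d h)"
      have "?sup h \<le> ereal (e * ?d h)"
        using h by (intro SUP_least) auto
      then have "?sup h \<le> ereal (?d h) * ereal e" by (simp add: mult.commute)
      then have "?sup h / ereal (?d h) \<le> ereal e"
        using d_pos[of h] h by (subst ereal_divide_le_pos) auto
      with e(2) show "?sup h / ereal (?d h) < a" by (rule le_less_trans[rotated])
    qed
  qed
  then show ?thesis by (intro lim_imp_Limsup) simp_all
qed

theorem corollary4p4:
  fixes P :: "'w measure" and X :: "real^'d \<Rightarrow> 'w \<Rightarrow> real"
    and m :: "'e measure" and f :: "real^'d \<Rightarrow> 'e \<Rightarrow> real"
    and Q :: "'q measure" and M :: "'e set \<Rightarrow> 'q \<Rightarrow> real" and Z :: "real^'d \<Rightarrow> 'q \<Rightarrow> real"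
    and \<alpha> H \<theta>\<^sub>2 \<gamma> :: real
  assumes "0 < \<alpha>" and "\<alpha> < 2" and "0 < H"
    and "prob_space P"
    and "sas_field \<alpha> P X"
    and "separable_field P X"
    and "self_similar H P X"
    and "stationary_increments P X"
    and "sas_random_measure \<alpha> m Q M"
    and "\<And>t. f t \<in> L_space \<alpha> m"
    and "\<And>t. has_stable_integral \<alpha> m Q M (f t) (Z t)"
    and "fdd_eq P X Q Z"
    and "0 < \<theta>\<^sub>2" and "\<theta>\<^sub>2 < \<alpha> * H"
    and "\<And>v. v \<in> directions \<Longrightarrow>
           weak_effective_dim_bounded \<alpha> m (increment_kernel f v) \<theta>\<^sub>2"
    and "0 < \<gamma>" and "\<gamma> < \<alpha>"
  shows "AE \<omega> in P.
           Limsup (at_right 0) (\<lambda>h :: real.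
             (SUP t\<in>cbox 0 1. SUP s\<in>{s \<in> cbox 0 1. infnorm (s - t) \<le> h}.
                ereal \<bar>X t \<omega> - X s \<omega>\<bar>)
             / ereal (h powr (H - \<theta>\<^sub>2 / \<alpha>) * ln (1 / h) powr (1 / \<gamma>))) = 0"
proof -
  interpret prob_space P by fact
  interpret self_similar_stable_field P X m f Q M Z \<alpha> H \<theta>\<^sub>2
    by unfold_locales (use assms in auto)
  have \<beta>: "0 < H - \<theta>\<^sub>2 / \<alpha>" using assms(1,14) by (simp add: field_simps)
  obtain S where S: "countable S" and sep: "AE \<omega> in P. \<forall>G F. open G \<longrightarrow> closed F \<longrightarrow>
      (\<forall>t\<in>G \<inter> S. X t \<omega> \<in> F) \<longrightarrow> (\<forall>t\<in>G. X t \<omega> \<in> F)"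
    using assms(6) by (auto simp: separable_field_def)
  have "AE \<omega> in P. \<forall>s\<in>S. \<forall>\<epsilon>>0. \<forall>K. \<exists>k\<ge>K. \<bar>X s \<omega> - X (dyadic_point k (dyadic_floor k s)) \<omega>\<bar> \<le> \<epsilon>"
    unfolding AE_ball_countable[OF S] by (intro ballI AE_dyadic_approximation)
  with sep AE_eventually_level_increment[OF assms(16,17)] show ?thesis
  proof eventually_elim
    case (elim \<omega>)
    show ?case
    proof (rule Limsup_modulus_eq_0)
      have q: "0 < 1 / \<gamma>" using assms(16) by simp
      have level: "\<forall>\<^sub>F n in sequentially. max_level_increment_le (\<lambda>t. X t \<omega>) n
          (\<epsilon> * (real n powr (1 / \<gamma>) * 2 powr (- ((H - \<theta>\<^sub>2 / \<alpha>) * real n))))" if "0 < \<epsilon>" for \<epsilon>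
        using elim(2) that by blast
      have approx: "\<exists>k\<ge>K. \<bar>X s \<omega> - X (dyadic_point k (dyadic_floor k s)) \<omega>\<bar> \<le> \<epsilon>"
        if "s \<in> S" "0 < \<epsilon>" for s \<epsilon> K
        using elim(3) that by blast
      have separating: "\<forall>t\<in>G. X t \<omega> \<in> F" if "open G" "closed F" "\<forall>t\<in>G \<inter> S. X t \<omega> \<in> F" for G F
        using elim(1) that by blast
      fix e :: real assume "0 < e"
      then show "\<forall>\<^sub>F h in at_right 0. \<forall>t\<in>cbox 0 1. \<forall>s\<in>cbox 0 1. infnorm (s - t) \<le> h \<longrightarrow>
          \<bar>X t \<omega> - X s \<omega>\<bar> \<le> e * (h powr (H - \<theta>\<^sub>2 / \<alpha>) * ln (1 / h) powr (1 / \<gamma>))"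
        using modulus_of_continuity_eventually[of "H - \<theta>\<^sub>2 / \<alpha>" "1 / \<gamma>" "\<lambda>t. X t \<omega>" S e,
            OF \<beta> q level approx separating] by blast
    qed
  qed
qed

end
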